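(* There is no deformation of the form $\varphi_{bcd}\to\tilde\varphi_{bcd}=\varphi_{bcd}+v^e\psi_{bcde}$ (with $v$ a vector field) within the strict torsion class $W_1$; that is, no such deformation takes a $G_2$-structure with torsion in the strict class $W_1$ to a $G_2$-structure with torsion in the strict class $W_1$.
   Context: A $3$-form on a $7$-manifold is positive if at each point it lies in the $GL(7,\mathbb R)$-orbit of $\varphi_0=e^{123}+e^{145}+e^{167}+e^{246}-e^{257}-e^{347}-e^{356}$. A positive $3$-form $\varphi$ determines a Riemannian metric $g$ and volume form by $g(u,w)\,\mathrm{vol}=\frac16(u\lrcorner\varphi)\wedge(w\lrcorner\varphi)\wedge\varphi$; the pair $(\varphi,g)$ is a $G_2$-structure. $\psi=*\varphi$ and $\nabla$ is the Levi-Civita connection of $g$. The full torsion tensor $T_{ab}$ is defined by $\nabla_a\varphi_{bcd}=T_a{}^e\psi_{ebcd}$. It decomposes as $T_{ab}=\tau_1g_{ab}+\tau_7^c\varphi_{cab}+(\tau_{14})_{ab}+(\tau_{27})_{ab}$ with $\tau_1$ a function, $\tau_7$ a $1$-form, $\tau_{14}$ a $2$-form with $(\tau_{14})^{ab}\varphi_{abc}=0$ and $\tau_{27}$ a traceless symmetric tensor. The torsion lies in the strict class $W_1$ if its only non-zero component is $\tau_1$. For every vector field $v$ the form $\tilde\varphi$ is positive; its torsion is taken with respect to $\tilde\varphi$ and its own metric $\tilde g$. *)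

theory Defs
  imports "HOL-Analysis.Analysis"
begin

section \<open>Smooth functions on open subsets of coordinate space\<close>

definition partial :: "7 \<Rightarrow> (real^7 \<Rightarrow> real) \<Rightarrow> real^7 \<Rightarrow> real" where
  "partial a f q = frechet_derivative f (at q) (axis a 1)"

text \<open>Only meant for open \<open>S\<close>, since the derivatives are taken in the whole space.\<close>

primrec C_k_on :: "nat \<Rightarrow> (real^7) set \<Rightarrow> (real^7 \<Rightarrow> real) \<Rightarrow> bool" where
  "C_k_on 0 S f \<longleftrightarrow> continuous_on S f"
| "C_k_on (Suc k) S f \<longleftrightarrow> (\<forall>q\<in>S. f differentiable (at q)) \<and> (\<forall>a. C_k_on k S (partial a f))"

definition smooth_on :: "(real^7) set \<Rightarrow> (real^7 \<Rightarrow> real) \<Rightarrow> bool" where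
  "smooth_on S f \<longleftrightarrow> (\<forall>k. C_k_on k S f)"


section \<open>Smooth 7-manifolds and tensor fields\<close>

text \<open>A chart is a pair of its domain and its coordinate map. Tensor fields are given by their
  components in every chart of the atlas: the components in a chart \<open>(U, x)\<close> are functions on
  \<open>x ` U\<close>, and the components in two charts are related by the tensor transformation law. Values
  outside \<open>x ` U\<close> are irrelevant.\<close>

type_synonym 'm chart = "'m set \<times> ('m \<Rightarrow> real^7)"

abbreviation chart_image :: "'m chart \<Rightarrow> (real^7) set" where
  "chart_image c \<equiv> snd c ` fst c"

definition is_chart :: "'m topology \<Rightarrow> 'm chart \<Rightarrow> bool" where
  "is_chart X c \<longleftrightarrow> openin X (fst c) \<and> open (chart_image c) \<and>
     homeomorphic_map (subtopology X (fst c)) (top_of_set (chart_image c)) (snd c)"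

definition transition :: "'m chart \<Rightarrow> 'm chart \<Rightarrow> real^7 \<Rightarrow> real^7" where
  "transition c d q = snd d (inv_into (fst c) (snd c) q)"

definition smooth_manifold7 :: "'m topology \<Rightarrow> 'm chart set \<Rightarrow> bool" where
  "smooth_manifold7 X A \<longleftrightarrow>
     Hausdorff_space X \<and> second_countable X \<and>
     (\<forall>c\<in>A. is_chart X c) \<and> (\<Union>c\<in>A. fst c) = topspace X \<and>
     (\<forall>c\<in>A. \<forall>d\<in>A. \<forall>i. smooth_on (snd c ` (fst c \<inter> fst d)) (\<lambda>q. transition c d q $ i))"

text \<open>For \<open>c = (U, x)\<close> and \<open>d = (V, y)\<close> this is \<open>\<partial>y\<^sup>i / \<partial>x\<^sup>a\<close> at the point \<open>p\<close>.\<close>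

definition jac :: "'m chart \<Rightarrow> 'm chart \<Rightarrow> 'm \<Rightarrow> 7 \<Rightarrow> 7 \<Rightarrow> real" where
  "jac c d p i a = partial a (\<lambda>q. transition c d q $ i) (snd c p)"

type_synonym 'm vfield = "'m chart \<Rightarrow> real^7 \<Rightarrow> real^7"
type_synonym 'm field2 = "'m chart \<Rightarrow> real^7 \<Rightarrow> real^7^7"
type_synonym 'm field3 = "'m chart \<Rightarrow> real^7 \<Rightarrow> 7 \<Rightarrow> 7 \<Rightarrow> 7 \<Rightarrow> real"
type_synonym 'm density = "'m chart \<Rightarrow> real^7 \<Rightarrow> real"

definition vector_field :: "'m chart set \<Rightarrow> 'm vfield \<Rightarrow> bool" where
  "vector_field A v \<longleftrightarrow>
     (\<forall>c\<in>A. \<forall>i. smooth_on (chart_image c) (\<lambda>q. v c q $ i)) \<and>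
     (\<forall>c\<in>A. \<forall>d\<in>A. \<forall>p\<in>fst c \<inter> fst d. \<forall>i.
        v d (snd d p) $ i = (\<Sum>a\<in>UNIV. jac c d p i a * v c (snd c p) $ a))"

definition three_form :: "'m chart set \<Rightarrow> 'm field3 \<Rightarrow> bool" where
  "three_form A \<phi> \<longleftrightarrow>
     (\<forall>c\<in>A. \<forall>i j k. smooth_on (chart_image c) (\<lambda>q. \<phi> c q i j k)) \<and>
     (\<forall>c\<in>A. \<forall>q\<in>chart_image c. \<forall>i j k.
        \<phi> c q j i k = - \<phi> c q i j k \<and> \<phi> c q i k j = - \<phi> c q i j k) \<and>
     (\<forall>c\<in>A. \<forall>d\<in>A. \<forall>p\<in>fst c \<inter> fst d. \<forall>a b e.
        \<phi> c (snd c p) a b e =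
          (\<Sum>i\<in>UNIV. \<Sum>j\<in>UNIV. \<Sum>k\<in>UNIV.
             jac c d p i a * jac c d p j b * jac c d p k e * \<phi> d (snd d p) i j k))"

definition riemannian_metric :: "'m chart set \<Rightarrow> 'm field2 \<Rightarrow> bool" where
  "riemannian_metric A g \<longleftrightarrow>
     (\<forall>c\<in>A. \<forall>i j. smooth_on (chart_image c) (\<lambda>q. g c q $ i $ j)) \<and>
     (\<forall>c\<in>A. \<forall>q\<in>chart_image c.
        transpose (g c q) = g c q \<and> (\<forall>u. u \<noteq> 0 \<longrightarrow> u \<bullet> (g c q *v u) > 0)) \<and>
     (\<forall>c\<in>A. \<forall>d\<in>A. \<forall>p\<in>fst c \<inter> fst d. \<forall>a b.
        g c (snd c p) $ a $ b =
          (\<Sum>i\<in>UNIV. \<Sum>j\<in>UNIV. jac c d p i a * jac c d p j b * g d (snd d p) $ i $ j))"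

text \<open>The 7-form \<open>vol c dx\<^sup>1 \<and> \<dots> \<and> dx\<^sup>7\<close>, of unit length with respect to \<open>g\<close>. The coefficient is
  \<open>sqrt (det g)\<close> or \<open>- sqrt (det g)\<close>, depending on whether the chart is positively oriented.\<close>

definition volume_form :: "'m chart set \<Rightarrow> 'm field2 \<Rightarrow> 'm density \<Rightarrow> bool" where
  "volume_form A g vol \<longleftrightarrow>
     (\<forall>c\<in>A. smooth_on (chart_image c) (vol c)) \<and>
     (\<forall>c\<in>A. \<forall>q\<in>chart_image c. (vol c q)\<^sup>2 = det (g c q)) \<and>
     (\<forall>c\<in>A. \<forall>d\<in>A. \<forall>p\<in>fst c \<inter> fst d.
        vol c (snd c p) = det (\<chi> i a. jac c d p i a) * vol d (snd d p))"


section \<open>Exterior algebra in components\<close>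

text \<open>The seven indices are the elements \<open>1, \<dots>, 7\<close> of the numeral type \<open>7\<close> (where \<open>7 = 0\<close>).
  A \<open>k\<close>-form \<open>\<alpha>\<close> has components \<open>\<alpha>(e\<^sub>i, e\<^sub>j, \<dots>)\<close>, so that \<open>e\<^sup>1\<^sup>2\<^sup>3\<close> has component \<open>1\<close> at \<open>1 2 3\<close>.\<close>

definition coframe3 :: "7 \<Rightarrow> 7 \<Rightarrow> 7 \<Rightarrow> 7 \<Rightarrow> 7 \<Rightarrow> 7 \<Rightarrow> real" where
  "coframe3 i j k a b c =
     det (vector [vector [of_bool (i = a), of_bool (i = b), of_bool (i = c)],
                  vector [of_bool (j = a), of_bool (j = b), of_bool (j = c)],
                  vector [of_bool (k = a), of_bool (k = b), of_bool (k = c)]] :: real^3^3)"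

definition phi0 :: "7 \<Rightarrow> 7 \<Rightarrow> 7 \<Rightarrow> real" where
  "phi0 a b c =
     coframe3 1 2 3 a b c + coframe3 1 4 5 a b c + coframe3 1 6 7 a b c + coframe3 2 4 6 a b c
     - coframe3 2 5 7 a b c - coframe3 3 4 7 a b c - coframe3 3 5 6 a b c"

definition positive3 :: "(7 \<Rightarrow> 7 \<Rightarrow> 7 \<Rightarrow> real) \<Rightarrow> bool" where
  "positive3 f \<longleftrightarrow> (\<exists>L :: real^7^7. invertible L \<and>
     (\<forall>a b c. f a b c =
        (\<Sum>i\<in>UNIV. \<Sum>j\<in>UNIV. \<Sum>k\<in>UNIV. L $ i $ a * L $ j $ b * L $ k $ c * phi0 i j k)))"

text \<open>The permutation symbol: the sign of \<open>i1 \<dots> i7\<close> as a permutation of \<open>1 \<dots> 7\<close>, or \<open>0\<close>.\<close>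

definition perm_symbol :: "7 \<Rightarrow> 7 \<Rightarrow> 7 \<Rightarrow> 7 \<Rightarrow> 7 \<Rightarrow> 7 \<Rightarrow> 7 \<Rightarrow> real" where
  "perm_symbol i1 i2 i3 i4 i5 i6 i7 =
     det (vector [axis i1 1, axis i2 1, axis i3 1, axis i4 1, axis i5 1, axis i6 1, axis i7 1]
          :: real^7^7)"

text \<open>The coefficient of \<open>e\<^sup>1 \<and> \<dots> \<and> e\<^sup>7\<close> in \<open>\<alpha> \<and> \<beta> \<and> \<gamma>\<close>, for two 2-forms and a 3-form;
  \<open>24 = 2! 2! 3!\<close>.\<close>

definition wedge223 ::
  "(7 \<Rightarrow> 7 \<Rightarrow> real) \<Rightarrow> (7 \<Rightarrow> 7 \<Rightarrow> real) \<Rightarrow> (7 \<Rightarrow> 7 \<Rightarrow> 7 \<Rightarrow> real) \<Rightarrow> real" where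
  "wedge223 \<alpha> \<beta> \<gamma> =
     (\<Sum>i1\<in>UNIV. \<Sum>i2\<in>UNIV. \<Sum>i3\<in>UNIV. \<Sum>i4\<in>UNIV. \<Sum>i5\<in>UNIV. \<Sum>i6\<in>UNIV. \<Sum>i7\<in>UNIV.
        perm_symbol i1 i2 i3 i4 i5 i6 i7 * \<alpha> i1 i2 * \<beta> i3 i4 * \<gamma> i5 i6 i7) / 24"

definition interior3 :: "real^7 \<Rightarrow> (7 \<Rightarrow> 7 \<Rightarrow> 7 \<Rightarrow> real) \<Rightarrow> 7 \<Rightarrow> 7 \<Rightarrow> real" where
  "interior3 u f b c = (\<Sum>a\<in>UNIV. u $ a * f a b c)"

text \<open>\<open>(*f)\<^sub>a\<^sub>b\<^sub>c\<^sub>d = (1/3!) f\<^sup>i\<^sup>j\<^sup>k vol\<^sub>i\<^sub>j\<^sub>k\<^sub>a\<^sub>b\<^sub>c\<^sub>d\<close>, where \<open>w\<close> is the coefficient of the volume form.\<close>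

definition hodge3 ::
  "real^7^7 \<Rightarrow> real \<Rightarrow> (7 \<Rightarrow> 7 \<Rightarrow> 7 \<Rightarrow> real) \<Rightarrow> 7 \<Rightarrow> 7 \<Rightarrow> 7 \<Rightarrow> 7 \<Rightarrow> real" where
  "hodge3 G w f a b c d =
     (\<Sum>i\<in>UNIV. \<Sum>j\<in>UNIV. \<Sum>k\<in>UNIV. \<Sum>l\<in>UNIV. \<Sum>m\<in>UNIV. \<Sum>n\<in>UNIV.
        matrix_inv G $ i $ l * matrix_inv G $ j $ m * matrix_inv G $ k $ n * f l m n
        * (w * perm_symbol i j k a b c d)) / 6"


section \<open>\<open>G\<^sub>2\<close>-structures and their torsion\<close>

definition G2_structure ::
  "'m chart set \<Rightarrow> 'm field3 \<Rightarrow> 'm field2 \<Rightarrow> 'm density \<Rightarrow> bool" where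
  "G2_structure A \<phi> g vol \<longleftrightarrow>
     three_form A \<phi> \<and> riemannian_metric A g \<and> volume_form A g vol \<and>
     (\<forall>c\<in>A. \<forall>q\<in>chart_image c.
        positive3 (\<phi> c q) \<and>
        (\<forall>u w. (u \<bullet> (g c q *v w)) * vol c q =
           wedge223 (interior3 u (\<phi> c q)) (interior3 w (\<phi> c q)) (\<phi> c q) / 6))"

text \<open>\<open>christoffel g q e a b\<close> is the Christoffel symbol \<open>\<Gamma>\<^sup>e\<^sub>a\<^sub>b\<close> of the Levi-Civita connection.\<close>

definition christoffel :: "(real^7 \<Rightarrow> real^7^7) \<Rightarrow> real^7 \<Rightarrow> 7 \<Rightarrow> 7 \<Rightarrow> 7 \<Rightarrow> real" where
  "christoffel g q e a b =
     (\<Sum>d\<in>UNIV. matrix_inv (g q) $ e $ d *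
        (partial a (\<lambda>r. g r $ b $ d) q + partial b (\<lambda>r. g r $ a $ d) q
         - partial d (\<lambda>r. g r $ a $ b) q)) / 2"

definition nabla3 ::
  "(real^7 \<Rightarrow> real^7^7) \<Rightarrow> (real^7 \<Rightarrow> 7 \<Rightarrow> 7 \<Rightarrow> 7 \<Rightarrow> real) \<Rightarrow> real^7 \<Rightarrow> 7 \<Rightarrow> 7 \<Rightarrow> 7 \<Rightarrow> 7 \<Rightarrow> real" where
  "nabla3 g f q a b c d =
     partial a (\<lambda>r. f r b c d) q
     - (\<Sum>e\<in>UNIV. christoffel g q e a b * f q e c d)
     - (\<Sum>e\<in>UNIV. christoffel g q e a c * f q b e d)
     - (\<Sum>e\<in>UNIV. christoffel g q e a d * f q b c e)"

text \<open>\<open>\<nabla>\<^sub>a f\<^sub>b\<^sub>c\<^sub>d = T\<^sub>a\<^sup>e (*f)\<^sub>e\<^sub>b\<^sub>c\<^sub>d\<close> at the point \<open>q\<close>.\<close>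

definition full_torsion ::
  "(real^7 \<Rightarrow> 7 \<Rightarrow> 7 \<Rightarrow> 7 \<Rightarrow> real) \<Rightarrow> (real^7 \<Rightarrow> real^7^7) \<Rightarrow> (real^7 \<Rightarrow> real) \<Rightarrow> real^7
    \<Rightarrow> (7 \<Rightarrow> 7 \<Rightarrow> real) \<Rightarrow> bool" where
  "full_torsion f g vol q T \<longleftrightarrow> (\<forall>a b c d.
     nabla3 g f q a b c d =
       (\<Sum>e\<in>UNIV. (\<Sum>m\<in>UNIV. T a m * matrix_inv (g q) $ m $ e)
          * hodge3 (g q) (vol q) (f q) e b c d))"

definition torsion_components ::
  "real^7^7 \<Rightarrow> (7 \<Rightarrow> 7 \<Rightarrow> 7 \<Rightarrow> real) \<Rightarrow> (7 \<Rightarrow> 7 \<Rightarrow> real)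
    \<Rightarrow> real \<Rightarrow> real^7 \<Rightarrow> (7 \<Rightarrow> 7 \<Rightarrow> real) \<Rightarrow> (7 \<Rightarrow> 7 \<Rightarrow> real) \<Rightarrow> bool" where
  "torsion_components G f T t1 t7 t14 t27 \<longleftrightarrow>
     (\<forall>a b. T a b = t1 * G $ a $ b + (\<Sum>c\<in>UNIV. (matrix_inv G *v t7) $ c * f c a b)
                    + t14 a b + t27 a b) \<and>
     (\<forall>a b. t14 b a = - t14 a b) \<and>
     (\<forall>c. (\<Sum>a\<in>UNIV. \<Sum>b\<in>UNIV. \<Sum>k\<in>UNIV. \<Sum>l\<in>UNIV.
        matrix_inv G $ a $ k * matrix_inv G $ b $ l * t14 k l * f a b c) = 0) \<and>
     (\<forall>a b. t27 b a = t27 a b) \<and>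
     (\<Sum>a\<in>UNIV. \<Sum>b\<in>UNIV. matrix_inv G $ a $ b * t27 a b) = 0"

text \<open>The manifold need not be connected; \<open>\<tau>1\<close> counts as non-zero if it does not vanish
  identically on any connected component.\<close>

definition strict_W1 ::
  "'m topology \<Rightarrow> 'm chart set \<Rightarrow> 'm field3 \<Rightarrow> 'm field2 \<Rightarrow> 'm density \<Rightarrow> bool" where
  "strict_W1 X A \<phi> g vol \<longleftrightarrow> (\<exists>\<tau>1 :: 'm \<Rightarrow> real.
     (\<forall>c\<in>A. \<forall>p\<in>fst c. \<exists>T.
        full_torsion (\<phi> c) (g c) (vol c) (snd c p) T \<and>
        torsion_components (g c (snd c p)) (\<phi> c (snd c p)) T (\<tau>1 p) 0 (\<lambda>_ _. 0) (\<lambda>_ _. 0)) \<and>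
     (\<forall>K\<in>connected_components_of X. \<exists>p\<in>K. \<tau>1 p \<noteq> 0))"

text \<open>\<open>\<phi>\<^sub>b\<^sub>c\<^sub>d + v\<^sup>e \<psi>\<^sub>b\<^sub>c\<^sub>d\<^sub>e\<close> with \<open>\<psi> = *\<phi>\<close>.\<close>

definition deform :: "'m field3 \<Rightarrow> 'm field2 \<Rightarrow> 'm density \<Rightarrow> 'm vfield \<Rightarrow> 'm field3" where
  "deform \<phi> g vol v ch q b c d =
     \<phi> ch q b c d
     + (\<Sum>e\<in>UNIV. v ch q $ e * hodge3 (g ch q) (vol ch q) (\<phi> ch q) b c d e)"

end

theory Submission
  imports Defs
begin

text \<open>Let \<open>P\<close> be the cross product of a \<open>G\<^sub>2\<close>-structure with \<open>\<nabla>\<phi> = \<tau>\<psi>\<close>. The metric connection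
  \<open>\<nabla> + (\<tau>/3) P\<close> has skew torsion and makes \<open>g\<close>, \<open>\<phi>\<close> and \<open>\<psi>\<close> parallel. Therefore \<open>d\<phi> = 4\<tau>\<psi>\<close> and
  \<open>d\<psi> = 0\<close>, and \<open>d(d\<phi>) = 0\<close> shows that \<open>\<tau>\<close> is locally constant.

  Put \<open>h = 1 + |v|\<^sup>2\<close> and let \<open>\<phi>'\<close> be the deformed form. In a frame in which \<open>\<phi>\<close> is the standard form
  and \<open>v = r e\<^sub>1\<close>, the form \<open>\<phi>'\<close> is the pull-back of the standard form by an explicit linear map, which
  gives \<open>\<psi>' = h\<close> to the power \<open>-1/3\<close> times \<open>h \<psi> + v \<and> \<phi>'\<close>. The equations \<open>d\<phi>' = 4\<tau>'\<psi>'\<close> and \<open>d\<psi>' = 0\<close> are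
  linear in \<open>\<nabla>v\<close> and determine it completely. With \<open>b = \<tau>' / root 3 h\<close> they yield
  \<open>dh = 2 (\<tau> - b h + 4 b (h - 1)) v\<close> and \<open>dv = (2/3) (4 b - \<tau>) (v \<lrcorner> \<phi>)\<close>, and one component of \<open>d(dv) = 0\<close> is
  \<open>(4 b - \<tau>) (\<tau> - b h) = 0\<close>. If either factor vanishes on an open set then \<open>h\<close> is constant there, so the
  coefficient of \<open>v\<close> in \<open>dh\<close> vanishes; but it equals \<open>3 b h\<close> or \<open>4 b (h - 1)\<close>, which is not zero where \<open>v \<noteq> 0\<close>.\<close>

section \<open>The standard 3-form and its dual\<close>

text \<open>The metric of \<open>\<phi>'\<close> depends on \<open>v\<close> in a complicated way,
  so the two Levi-Civita connections are never compared. From the deformed structure only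
  \<open>d\<phi>' = 4\<tau>'\<psi>'\<close>, \<open>d\<psi>' = 0\<close> and the constancy of
  \<open>\<tau>'\<close> enter, and all derivatives are expressed by the connection of the
  undeformed structure. At a point these are 35 and 21 scalar equations for the 49 components of the
  derivative of \<open>v\<close>. Frames serve the algebra at a single point and are never
  differentiated. The objects that are differentiated are multilinear forms on constant coordinate
  vectors; there the Christoffel symbols are symmetric and drop out of every exterior derivative.
  The function \<tau> comes from a pointwise decomposition and carries no regularity, so its
  differentiability has to be extracted from \<phi> before its derivative can be shown to
  vanish.\<close>

lemma UNIV_7: "(UNIV :: 7 set) = {1, 2, 3, 4, 5, 6, 7}"
proof -
  have "card {1, 2, 3, 4, 5, 6, 7 :: 7} = CARD(7)" by simp
  then show ?thesis by (metis card_subset_eq finite top_greatest)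
qed

lemma sum_7: "sum f (UNIV :: 7 set) = f 1 + f 2 + f 3 + f 4 + f 5 + f 6 + f 7"
  unfolding UNIV_7 by (simp add: ac_simps)

lemma forall_7: "(\<forall>i::7. P i) \<longleftrightarrow> P 1 \<and> P 2 \<and> P 3 \<and> P 4 \<and> P 5 \<and> P 6 \<and> P 7"
proof -
  have "(\<forall>i::7. P i) \<longleftrightarrow> (\<forall>i\<in>{1, 2, 3, 4, 5, 6, 7}. P i)" unfolding UNIV_7[symmetric] by simp
  then show ?thesis by simp
qed

lemma neq_7:
  "(1::7) \<noteq> 2" "(1::7) \<noteq> 3" "(1::7) \<noteq> 4" "(1::7) \<noteq> 5" "(1::7) \<noteq> 6" "(1::7) \<noteq> 7"
  "(2::7) \<noteq> 1" "(2::7) \<noteq> 3" "(2::7) \<noteq> 4" "(2::7) \<noteq> 5" "(2::7) \<noteq> 6" "(2::7) \<noteq> 7"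
  "(3::7) \<noteq> 1" "(3::7) \<noteq> 2" "(3::7) \<noteq> 4" "(3::7) \<noteq> 5" "(3::7) \<noteq> 6" "(3::7) \<noteq> 7"
  "(4::7) \<noteq> 1" "(4::7) \<noteq> 2" "(4::7) \<noteq> 3" "(4::7) \<noteq> 5" "(4::7) \<noteq> 6" "(4::7) \<noteq> 7"
  "(5::7) \<noteq> 1" "(5::7) \<noteq> 2" "(5::7) \<noteq> 3" "(5::7) \<noteq> 4" "(5::7) \<noteq> 6" "(5::7) \<noteq> 7"
  "(6::7) \<noteq> 1" "(6::7) \<noteq> 2" "(6::7) \<noteq> 3" "(6::7) \<noteq> 4" "(6::7) \<noteq> 5" "(6::7) \<noteq> 7"
  "(7::7) \<noteq> 1" "(7::7) \<noteq> 2" "(7::7) \<noteq> 3" "(7::7) \<noteq> 4" "(7::7) \<noteq> 5" "(7::7) \<noteq> 6"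
  by simp_all

lemma coframe3_eq:
  "coframe3 i j k a b c =
     of_bool (i = a \<and> j = b \<and> k = c) + of_bool (i = b \<and> j = c \<and> k = a)
     + of_bool (i = c \<and> j = a \<and> k = b) - of_bool (i = a \<and> j = c \<and> k = b)
     - of_bool (i = b \<and> j = a \<and> k = c) - of_bool (i = c \<and> j = b \<and> k = a)"
  unfolding coframe3_def det_3 vector_3 by (simp add: of_bool_conj)

lemma coframe3_antisym:
  "coframe3 i j k b a c = - coframe3 i j k a b c" "coframe3 i j k a c b = - coframe3 i j k a b c"
  unfolding coframe3_eq by (simp_all add: conj_ac)

lemma phi0_antisym: "phi0 b a c = - phi0 a b c" "phi0 a c b = - phi0 a b c"
  unfolding phi0_def coframe3_antisym(1)[of _ _ _ b a c] coframe3_antisym(2)[of _ _ _ a c b] by simp_all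

text \<open>One list equation for all 343 components; splitting it yields rewrite rules with literal
  indices, so that later computations never unfold a determinant.\<close>

lemma phi0_array:
  "map (\<lambda>a. map (\<lambda>b. map (phi0 a b) [1,2,3,4,5,6,7]) [1,2,3,4,5,6,7]) [1,2,3,4,5,6,7] =
  [[[0,0,0,0,0,0,0], [0,0,1,0,0,0,0], [0,-1,0,0,0,0,0], [0,0,0,0,1,0,0], [0,0,0,-1,0,0,0], [0,0,0,0,0,0,1],
      [0,0,0,0,0,-1,0]],
   [[0,0,-1,0,0,0,0], [0,0,0,0,0,0,0], [1,0,0,0,0,0,0], [0,0,0,0,0,1,0], [0,0,0,0,0,0,-1], [0,0,0,-1,0,0,0],
       [0,0,0,0,1,0,0]],
   [[0,1,0,0,0,0,0], [-1,0,0,0,0,0,0], [0,0,0,0,0,0,0], [0,0,0,0,0,0,-1], [0,0,0,0,0,-1,0], [0,0,0,0,1,0,0],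
       [0,0,0,1,0,0,0]],
   [[0,0,0,0,-1,0,0], [0,0,0,0,0,-1,0], [0,0,0,0,0,0,1], [0,0,0,0,0,0,0], [1,0,0,0,0,0,0], [0,1,0,0,0,0,0],
       [0,0,-1,0,0,0,0]],
   [[0,0,0,1,0,0,0], [0,0,0,0,0,0,1], [0,0,0,0,0,1,0], [-1,0,0,0,0,0,0], [0,0,0,0,0,0,0], [0,0,-1,0,0,0,0],
       [0,-1,0,0,0,0,0]],
   [[0,0,0,0,0,0,-1], [0,0,0,1,0,0,0], [0,0,0,0,-1,0,0], [0,-1,0,0,0,0,0], [0,0,1,0,0,0,0], [0,0,0,0,0,0,0],
       [1,0,0,0,0,0,0]],
   [[0,0,0,0,0,1,0], [0,0,0,0,-1,0,0], [0,0,0,-1,0,0,0], [0,0,1,0,0,0,0], [0,1,0,0,0,0,0], [-1,0,0,0,0,0,0],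
       [0,0,0,0,0,0,0]]]"
  unfolding phi0_def coframe3_eq list.map
  by (simp only: neq_7 of_bool_eq simp_thms add_0_right add_0_left diff_0_right diff_0 minus_minus)

lemmas phi0_table = phi0_array[unfolded list.map list.inject simp_thms]

text \<open>The contraction identity for the dual 4-form serves as its definition, because it can be
  differentiated without a derivative of the volume form; see \<open>hodge_phi0\<close> and \<open>H_eq_F_P\<close>.\<close>

definition psi0 :: "7 \<Rightarrow> 7 \<Rightarrow> 7 \<Rightarrow> 7 \<Rightarrow> real" where
  "psi0 i j k l =
     (\<Sum>m\<in>UNIV. phi0 i j m * phi0 m k l) - of_bool (i = k \<and> j = l) + of_bool (i = l \<and> j = k)"

text \<open>The cross product of two basis vectors is zero or plus or minus a basis vector, so each
  sum over \<open>m\<close> has at most one term. The factor \<open>f\<close> is arbitrary, which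
  lets contractions collapse before anything is evaluated.\<close>

lemma phi0_contract_array:
  "map (\<lambda>i. map (\<lambda>j. \<Sum>m\<in>UNIV. phi0 i j m * f m) [1,2,3,4,5,6,7]) [1,2,3,4,5,6,7] =
  [[0, f 3, - f 2, f 5, - f 4, f 7, - f 6],
   [- f 3, 0, f 1, f 6, - f 7, - f 4, f 5],
   [f 2, - f 1, 0, - f 7, - f 6, f 5, f 4],
   [- f 5, - f 6, f 7, 0, f 1, f 2, - f 3],
   [f 4, f 7, f 6, - f 1, 0, - f 3, - f 2],
   [- f 7, f 4, - f 5, - f 2, f 3, 0, f 1],
   [f 6, - f 5, - f 4, f 3, f 2, - f 1, 0]]"
  by (simp add: sum_7 phi0_table)

lemmas phi0_contract = phi0_contract_array[unfolded list.map list.inject simp_thms]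
lemmas psi0_eval = psi0_def phi0_contract phi0_table neq_7

lemma psi0_array:
  "map (\<lambda>a. map (\<lambda>b. map (\<lambda>c. map (psi0 a b c) [1,2,3,4,5,6,7]) [1,2,3,4,5,6,7]) [1,2,3,4,5,6,7]) [1,2,3,4,5,6,7] =
  [[[[0,0,0,0,0,0,0],[0,0,0,0,0,0,0],[0,0,0,0,0,0,0],[0,0,0,0,0,0,0],[0,0,0,0,0,0,0],[0,0,0,0,0,0,0],[0,0,0,0,0,0,0]],
    [[0,0,0,0,0,0,0],[0,0,0,0,0,0,0],[0,0,0,0,0,0,0],[0,0,0,0,0,0,-1],[0,0,0,0,0,-1,0],[0,0,0,0,1,0,0],[0,0,0,1,0,0,0]],
    [[0,0,0,0,0,0,0],[0,0,0,0,0,0,0],[0,0,0,0,0,0,0],[0,0,0,0,0,-1,0],[0,0,0,0,0,0,1],[0,0,0,1,0,0,0],[0,0,0,0,-1,0,0]],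
    [[0,0,0,0,0,0,0],[0,0,0,0,0,0,1],[0,0,0,0,0,1,0],[0,0,0,0,0,0,0],[0,0,0,0,0,0,0],[0,0,-1,0,0,0,0],[0,-1,0,0,0,0,0]],
    [[0,0,0,0,0,0,0],[0,0,0,0,0,1,0],[0,0,0,0,0,0,-1],[0,0,0,0,0,0,0],[0,0,0,0,0,0,0],[0,-1,0,0,0,0,0],[0,0,1,0,0,0,0]],
    [[0,0,0,0,0,0,0],[0,0,0,0,-1,0,0],[0,0,0,-1,0,0,0],[0,0,1,0,0,0,0],[0,1,0,0,0,0,0],[0,0,0,0,0,0,0],[0,0,0,0,0,0,0]],
    [[0,0,0,0,0,0,0],[0,0,0,-1,0,0,0],[0,0,0,0,1,0,0],[0,1,0,0,0,0,0],[0,0,-1,0,0,0,0],[0,0,0,0,0,0,0],[0,0,0,0,0,0,0]]],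
   [[[0,0,0,0,0,0,0],[0,0,0,0,0,0,0],[0,0,0,0,0,0,0],[0,0,0,0,0,0,1],[0,0,0,0,0,1,0],[0,0,0,0,-1,0,0],[0,0,0,-1,0,0,0]],
    [[0,0,0,0,0,0,0],[0,0,0,0,0,0,0],[0,0,0,0,0,0,0],[0,0,0,0,0,0,0],[0,0,0,0,0,0,0],[0,0,0,0,0,0,0],[0,0,0,0,0,0,0]],
    [[0,0,0,0,0,0,0],[0,0,0,0,0,0,0],[0,0,0,0,0,0,0],[0,0,0,0,1,0,0],[0,0,0,-1,0,0,0],[0,0,0,0,0,0,1],[0,0,0,0,0,-1,0]],
    [[0,0,0,0,0,0,-1],[0,0,0,0,0,0,0],[0,0,0,0,-1,0,0],[0,0,0,0,0,0,0],[0,0,1,0,0,0,0],[0,0,0,0,0,0,0],[1,0,0,0,0,0,0]],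
    [[0,0,0,0,0,-1,0],[0,0,0,0,0,0,0],[0,0,0,1,0,0,0],[0,0,-1,0,0,0,0],[0,0,0,0,0,0,0],[1,0,0,0,0,0,0],[0,0,0,0,0,0,0]],
    [[0,0,0,0,1,0,0],[0,0,0,0,0,0,0],[0,0,0,0,0,0,-1],[0,0,0,0,0,0,0],[-1,0,0,0,0,0,0],[0,0,0,0,0,0,0],[0,0,1,0,0,0,0]],
    [[0,0,0,1,0,0,0],[0,0,0,0,0,0,0],[0,0,0,0,0,1,0],[-1,0,0,0,0,0,0],[0,0,0,0,0,0,0],[0,0,-1,0,0,0,0],[0,0,0,0,0,0,0]]],
   [[[0,0,0,0,0,0,0],[0,0,0,0,0,0,0],[0,0,0,0,0,0,0],[0,0,0,0,0,1,0],[0,0,0,0,0,0,-1],[0,0,0,-1,0,0,0],[0,0,0,0,1,0,0]],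
    [[0,0,0,0,0,0,0],[0,0,0,0,0,0,0],[0,0,0,0,0,0,0],[0,0,0,0,-1,0,0],[0,0,0,1,0,0,0],[0,0,0,0,0,0,-1],[0,0,0,0,0,1,0]],
    [[0,0,0,0,0,0,0],[0,0,0,0,0,0,0],[0,0,0,0,0,0,0],[0,0,0,0,0,0,0],[0,0,0,0,0,0,0],[0,0,0,0,0,0,0],[0,0,0,0,0,0,0]],
    [[0,0,0,0,0,-1,0],[0,0,0,0,1,0,0],[0,0,0,0,0,0,0],[0,0,0,0,0,0,0],[0,-1,0,0,0,0,0],[1,0,0,0,0,0,0],[0,0,0,0,0,0,0]],
    [[0,0,0,0,0,0,1],[0,0,0,-1,0,0,0],[0,0,0,0,0,0,0],[0,1,0,0,0,0,0],[0,0,0,0,0,0,0],[0,0,0,0,0,0,0],[-1,0,0,0,0,0,0]],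
    [[0,0,0,1,0,0,0],[0,0,0,0,0,0,1],[0,0,0,0,0,0,0],[-1,0,0,0,0,0,0],[0,0,0,0,0,0,0],[0,0,0,0,0,0,0],[0,-1,0,0,0,0,0]],
    [[0,0,0,0,-1,0,0],[0,0,0,0,0,-1,0],[0,0,0,0,0,0,0],[0,0,0,0,0,0,0],[1,0,0,0,0,0,0],[0,1,0,0,0,0,0],[0,0,0,0,0,0,0]]],
   [[[0,0,0,0,0,0,0],[0,0,0,0,0,0,-1],[0,0,0,0,0,-1,0],[0,0,0,0,0,0,0],[0,0,0,0,0,0,0],[0,0,1,0,0,0,0],[0,1,0,0,0,0,0]],
    [[0,0,0,0,0,0,1],[0,0,0,0,0,0,0],[0,0,0,0,1,0,0],[0,0,0,0,0,0,0],[0,0,-1,0,0,0,0],[0,0,0,0,0,0,0],[-1,0,0,0,0,0,0]],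
    [[0,0,0,0,0,1,0],[0,0,0,0,-1,0,0],[0,0,0,0,0,0,0],[0,0,0,0,0,0,0],[0,1,0,0,0,0,0],[-1,0,0,0,0,0,0],[0,0,0,0,0,0,0]],
    [[0,0,0,0,0,0,0],[0,0,0,0,0,0,0],[0,0,0,0,0,0,0],[0,0,0,0,0,0,0],[0,0,0,0,0,0,0],[0,0,0,0,0,0,0],[0,0,0,0,0,0,0]],
    [[0,0,0,0,0,0,0],[0,0,1,0,0,0,0],[0,-1,0,0,0,0,0],[0,0,0,0,0,0,0],[0,0,0,0,0,0,0],[0,0,0,0,0,0,1],[0,0,0,0,0,-1,0]],
    [[0,0,-1,0,0,0,0],[0,0,0,0,0,0,0],[1,0,0,0,0,0,0],[0,0,0,0,0,0,0],[0,0,0,0,0,0,-1],[0,0,0,0,0,0,0],[0,0,0,0,1,0,0]],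
    [[0,-1,0,0,0,0,0],[1,0,0,0,0,0,0],[0,0,0,0,0,0,0],[0,0,0,0,0,0,0],[0,0,0,0,0,1,0],[0,0,0,0,-1,0,0],[0,0,0,0,0,0,0]]],
   [[[0,0,0,0,0,0,0],[0,0,0,0,0,-1,0],[0,0,0,0,0,0,1],[0,0,0,0,0,0,0],[0,0,0,0,0,0,0],[0,1,0,0,0,0,0],[0,0,-1,0,0,0,0]],
    [[0,0,0,0,0,1,0],[0,0,0,0,0,0,0],[0,0,0,-1,0,0,0],[0,0,1,0,0,0,0],[0,0,0,0,0,0,0],[-1,0,0,0,0,0,0],[0,0,0,0,0,0,0]],
    [[0,0,0,0,0,0,-1],[0,0,0,1,0,0,0],[0,0,0,0,0,0,0],[0,-1,0,0,0,0,0],[0,0,0,0,0,0,0],[0,0,0,0,0,0,0],[1,0,0,0,0,0,0]],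
    [[0,0,0,0,0,0,0],[0,0,-1,0,0,0,0],[0,1,0,0,0,0,0],[0,0,0,0,0,0,0],[0,0,0,0,0,0,0],[0,0,0,0,0,0,-1],[0,0,0,0,0,1,0]],
    [[0,0,0,0,0,0,0],[0,0,0,0,0,0,0],[0,0,0,0,0,0,0],[0,0,0,0,0,0,0],[0,0,0,0,0,0,0],[0,0,0,0,0,0,0],[0,0,0,0,0,0,0]],
    [[0,-1,0,0,0,0,0],[1,0,0,0,0,0,0],[0,0,0,0,0,0,0],[0,0,0,0,0,0,1],[0,0,0,0,0,0,0],[0,0,0,0,0,0,0],[0,0,0,-1,0,0,0]],
    [[0,0,1,0,0,0,0],[0,0,0,0,0,0,0],[-1,0,0,0,0,0,0],[0,0,0,0,0,-1,0],[0,0,0,0,0,0,0],[0,0,0,1,0,0,0],[0,0,0,0,0,0,0]]],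
   [[[0,0,0,0,0,0,0],[0,0,0,0,1,0,0],[0,0,0,1,0,0,0],[0,0,-1,0,0,0,0],[0,-1,0,0,0,0,0],[0,0,0,0,0,0,0],[0,0,0,0,0,0,0]],
    [[0,0,0,0,-1,0,0],[0,0,0,0,0,0,0],[0,0,0,0,0,0,1],[0,0,0,0,0,0,0],[1,0,0,0,0,0,0],[0,0,0,0,0,0,0],[0,0,-1,0,0,0,0]],
    [[0,0,0,-1,0,0,0],[0,0,0,0,0,0,-1],[0,0,0,0,0,0,0],[1,0,0,0,0,0,0],[0,0,0,0,0,0,0],[0,0,0,0,0,0,0],[0,1,0,0,0,0,0]],
    [[0,0,1,0,0,0,0],[0,0,0,0,0,0,0],[-1,0,0,0,0,0,0],[0,0,0,0,0,0,0],[0,0,0,0,0,0,1],[0,0,0,0,0,0,0],[0,0,0,0,-1,0,0]],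
    [[0,1,0,0,0,0,0],[-1,0,0,0,0,0,0],[0,0,0,0,0,0,0],[0,0,0,0,0,0,-1],[0,0,0,0,0,0,0],[0,0,0,0,0,0,0],[0,0,0,1,0,0,0]],
    [[0,0,0,0,0,0,0],[0,0,0,0,0,0,0],[0,0,0,0,0,0,0],[0,0,0,0,0,0,0],[0,0,0,0,0,0,0],[0,0,0,0,0,0,0],[0,0,0,0,0,0,0]],
    [[0,0,0,0,0,0,0],[0,0,1,0,0,0,0],[0,-1,0,0,0,0,0],[0,0,0,0,1,0,0],[0,0,0,-1,0,0,0],[0,0,0,0,0,0,0],[0,0,0,0,0,0,0]]],
   [[[0,0,0,0,0,0,0],[0,0,0,1,0,0,0],[0,0,0,0,-1,0,0],[0,-1,0,0,0,0,0],[0,0,1,0,0,0,0],[0,0,0,0,0,0,0],[0,0,0,0,0,0,0]],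
    [[0,0,0,-1,0,0,0],[0,0,0,0,0,0,0],[0,0,0,0,0,-1,0],[1,0,0,0,0,0,0],[0,0,0,0,0,0,0],[0,0,1,0,0,0,0],[0,0,0,0,0,0,0]],
    [[0,0,0,0,1,0,0],[0,0,0,0,0,1,0],[0,0,0,0,0,0,0],[0,0,0,0,0,0,0],[-1,0,0,0,0,0,0],[0,-1,0,0,0,0,0],[0,0,0,0,0,0,0]],
    [[0,1,0,0,0,0,0],[-1,0,0,0,0,0,0],[0,0,0,0,0,0,0],[0,0,0,0,0,0,0],[0,0,0,0,0,-1,0],[0,0,0,0,1,0,0],[0,0,0,0,0,0,0]],
    [[0,0,-1,0,0,0,0],[0,0,0,0,0,0,0],[1,0,0,0,0,0,0],[0,0,0,0,0,1,0],[0,0,0,0,0,0,0],[0,0,0,-1,0,0,0],[0,0,0,0,0,0,0]],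
    [[0,0,0,0,0,0,0],[0,0,-1,0,0,0,0],[0,1,0,0,0,0,0],[0,0,0,0,-1,0,0],[0,0,0,1,0,0,0],[0,0,0,0,0,0,0],[0,0,0,0,0,0,0]],
    [[0,0,0,0,0,0,0],[0,0,0,0,0,0,0],[0,0,0,0,0,0,0],[0,0,0,0,0,0,0],[0,0,0,0,0,0,0],[0,0,0,0,0,0,0],[0,0,0,0,0,0,0]]]]"
  unfolding list.map
  by (simp only: psi0_eval of_bool_eq simp_thms add_0_right add_0_left diff_0_right diff_0 minus_zero minus_minus
      diff_self left_minus)
lemmas psi0_table = psi0_array[unfolded list.map list.inject simp_thms]

lemma psi0_antisym:
  "psi0 j i k l = - psi0 i j k l" "psi0 i k j l = - psi0 i j k l" "psi0 i j l k = - psi0 i j k l"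
proof -
  have "\<forall>i j k l. psi0 j i k l = - psi0 i j k l \<and> psi0 i k j l = - psi0 i j k l \<and> psi0 i j l k = - psi0 i j k l"
    unfolding forall_7 by (simp only: psi0_table minus_zero minus_minus simp_thms)
  then show "psi0 j i k l = - psi0 i j k l" "psi0 i k j l = - psi0 i j k l" "psi0 i j l k = - psi0 i j k l"
    by blast+
qed

lemma phi0_contract_pair: "(\<Sum>k\<in>UNIV. \<Sum>l\<in>UNIV. phi0 i k l * phi0 j k l) = 6 * of_bool (i = j)"
proof -
  have "\<forall>i j. (\<Sum>k\<in>UNIV. \<Sum>l\<in>UNIV. phi0 i k l * phi0 j k l) = 6 * of_bool (i = j)"
    unfolding forall_7 by (simp add: phi0_contract sum_7 phi0_table neq_7 del: eq_numeral_iff_iszero)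
  then show ?thesis by blast
qed

lemma sum_of_bool:
  fixes f :: "'a::finite \<Rightarrow> real"
  shows "(\<Sum>k\<in>UNIV. of_bool (a = k) * f k) = f a" "(\<Sum>k\<in>UNIV. of_bool (k = a) * f k) = f a"
    "(\<Sum>k\<in>UNIV. f k * of_bool (a = k)) = f a" "(\<Sum>k\<in>UNIV. f k * of_bool (k = a)) = f a"
proof -
  have *: "f k * of_bool (a = k) = (if a = k then f k else 0)" "f k * of_bool (k = a) = (if k
      = a then f k else 0)" for k
    by simp_all
  show "(\<Sum>k\<in>UNIV. f k * of_bool (a = k)) = f a" "(\<Sum>k\<in>UNIV. f k * of_bool (k = a)) = f a"
    unfolding * by simp_all
  then show "(\<Sum>k\<in>UNIV. of_bool (a = k) * f k) = f a" "(\<Sum>k\<in>UNIV. of_bool (k = a) * f k) = f a"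
    by (simp_all add: mult.commute)
qed

text \<open>The product of two copies of \<open>phi0\<close> in \<open>psi0\<close> contributes 6 by
  \<open>phi0_contract_pair\<close>; the two Kronecker terms contribute -2 because
  \<open>phi0\<close> is alternating.\<close>

lemma phi0_psi0_contract: "(\<Sum>k\<in>UNIV. \<Sum>l\<in>UNIV. psi0 i j k l * phi0 b k l) = 4 * phi0 b i j"
proof -
  have "(\<Sum>k\<in>UNIV. \<Sum>l\<in>UNIV. psi0 i j k l * phi0 b k l) =
    (\<Sum>k\<in>UNIV. \<Sum>l\<in>UNIV. \<Sum>m\<in>UNIV. phi0 i j m * (phi0 m k l * phi0 b k l))
    - (\<Sum>k\<in>UNIV. of_bool (i = k) * (\<Sum>l\<in>UNIV. of_bool (j = l) * phi0 b k l))
    + (\<Sum>k\<in>UNIV. of_bool (j = k) * (\<Sum>l\<in>UNIV. of_bool (i = l) * phi0 b k l))"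
  proof -
    have "psi0 i j k l * phi0 b k l = (\<Sum>m\<in>UNIV. phi0 i j m * (phi0 m k l * phi0 b k l))
      - of_bool (i = k) * (of_bool (j = l) * phi0 b k l) + of_bool (j = k) * (of_bool (i = l) * phi0 b k l)" for k l
      unfolding psi0_def of_bool_conj by (simp add: algebra_simps sum_distrib_left)
    then show ?thesis by (simp only: sum.distrib sum_subtractf sum_distrib_left)
  qed
  also have "(\<Sum>k\<in>UNIV. \<Sum>l\<in>UNIV. \<Sum>m\<in>UNIV. phi0 i j m * (phi0 m k l * phi0 b k l)) =
     (\<Sum>m\<in>UNIV. phi0 i j m * (\<Sum>k\<in>UNIV. \<Sum>l\<in>UNIV. phi0 m k l * phi0 b k l))"
    by (simp add: sum_distrib_left, subst (2) sum.swap, subst sum.swap, rule refl)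
  also have "\<dots> = 6 * phi0 i j b"
  proof -
    have "(\<Sum>m\<in>UNIV. phi0 i j m * (6 * of_bool (m = b))) = 6 * (\<Sum>m\<in>UNIV. phi0 i j m * of_bool (m = b))"
      by (simp only: sum_distrib_left mult_ac)
    then show ?thesis unfolding phi0_contract_pair sum_of_bool .
  qed
  finally show ?thesis
    using phi0_antisym(1)[of i b j] phi0_antisym(2)[of i b j] phi0_antisym(2)[of b i j]
    by (simp add: sum_of_bool)
qed

section \<open>Determinants and multilinear forms\<close>

lemma vector_7:
  "vector [a, b, c, d, e, f, g] $ (1::7) = a" "vector [a, b, c, d, e, f, g] $ (2::7) = b"
  "vector [a, b, c, d, e, f, g] $ (3::7) = c" "vector [a, b, c, d, e, f, g] $ (4::7) = d"
  "vector [a, b, c, d, e, f, g] $ (5::7) = e" "vector [a, b, c, d, e, f, g] $ (6::7) = f"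
  "vector [a, b, c, d, e, f, g] $ (7::7) = g"
  unfolding vector_def by simp_all

text \<open>The multilinear extension of \<open>perm_symbol\<close> from basis vectors to arbitrary
  vectors. It allows a matrix to be moved into the slots one at a time.\<close>

definition det7 :: "real^7 \<Rightarrow> real^7 \<Rightarrow> real^7 \<Rightarrow> real^7 \<Rightarrow> real^7 \<Rightarrow> real^7 \<Rightarrow> real^7 \<Rightarrow> real" where
  "det7 a b c d e f g = det (vector [a, b, c, d, e, f, g] :: real^7^7)"

lemma linear_det_row:
  fixes r :: "'n::finite \<Rightarrow> real^'n"
  shows "linear (\<lambda>x. det (\<chi> i. if i = k then x else r i))"
proof (rule linearI)
  show "det (\<chi> i. if i = k then x + y else r i) =
      det (\<chi> i. if i = k then x else r i) + det (\<chi> i. if i = k then y else r i)" for x y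
    using det_row_add[of k "\<lambda>_. x" "\<lambda>_. y" r] by simp
  show "det (\<chi> i. if i = k then t *\<^sub>R x else r i) = t *\<^sub>R det (\<chi> i. if i = k then x else r i)" for t x
  proof -
    have "t *\<^sub>R x = t *s x" by (simp add: vec_eq_iff)
    then show ?thesis using det_row_mul[of k t "\<lambda>_. x" r] by (simp only: real_scaleR_def)
  qed
qed

lemma linear_det7:
  "linear (\<lambda>x. det7 x b c d e f g)" "linear (\<lambda>x. det7 a x c d e f g)" "linear (\<lambda>x. det7 a b x d e f g)"
  "linear (\<lambda>x. det7 a b c x e f g)" "linear (\<lambda>x. det7 a b c d x f g)" "linear (\<lambda>x. det7 a b c d e x g)"
  "linear (\<lambda>x. det7 a b c d e f x)"
proof -
  have *: "(\<lambda>x. det7 x b c d e f g) = (\<lambda>x. det (\<chi> i. if i = 1 then x else (vector [a,b,c,d,e,f,g] :: real^7^7) $ i))"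
    "(\<lambda>x. det7 a x c d e f g) = (\<lambda>x. det (\<chi> i. if i = 2 then x else (vector [a,b,c,d,e,f,g] :: real^7^7) $ i))"
    "(\<lambda>x. det7 a b x d e f g) = (\<lambda>x. det (\<chi> i. if i = 3 then x else (vector [a,b,c,d,e,f,g] :: real^7^7) $ i))"
    "(\<lambda>x. det7 a b c x e f g) = (\<lambda>x. det (\<chi> i. if i = 4 then x else (vector [a,b,c,d,e,f,g] :: real^7^7) $ i))"
    "(\<lambda>x. det7 a b c d x f g) = (\<lambda>x. det (\<chi> i. if i = 5 then x else (vector [a,b,c,d,e,f,g] :: real^7^7) $ i))"
    "(\<lambda>x. det7 a b c d e x g) = (\<lambda>x. det (\<chi> i. if i = 6 then x else (vector [a,b,c,d,e,f,g] :: real^7^7) $ i))"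
    "(\<lambda>x. det7 a b c d e f x) = (\<lambda>x. det (\<chi> i. if i = 7 then x else (vector [a,b,c,d,e,f,g] :: real^7^7) $ i))"
    unfolding det7_def
    by (intro ext arg_cong[where f = det]; simp only: vec_eq_iff[of
        "vector _"] forall_7 vec_lambda_beta vector_7 neq_7 if_True if_False simp_thms)+
  show "linear (\<lambda>x. det7 x b c d e f g)" "linear (\<lambda>x. det7 a x c d e f g)" "linear (\<lambda>x. det7 a b x d e f g)"
    "linear (\<lambda>x. det7 a b c x e f g)" "linear (\<lambda>x. det7 a b c d x f g)" "linear (\<lambda>x. det7 a b c d e x g)"
    "linear (\<lambda>x. det7 a b c d e f x)"
    unfolding * by (rule linear_det_row)+
qed
lemma det7_repeated:
  "det7 a a c d e f g = 0" "det7 a b b d e f g = 0" "det7 a b c c e f g = 0"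
  "det7 a b c d d f g = 0" "det7 a b c d e e g = 0" "det7 a b c d e f f = 0"
proof -
  have *: "det A = 0" if "A $ i = A $ j" "i \<noteq> j" for A :: "real^7^7" and i j
    using that by (intro det_identical_rows[of i j]) (simp_all add: row_def vec_eq_iff)
  show "det7 a a c d e f g = 0" unfolding det7_def by (rule *[of _ 1 2]) (simp_all add: vector_7)
  show "det7 a b b d e f g = 0" unfolding det7_def by (rule *[of _ 2 3]) (simp_all add: vector_7)
  show "det7 a b c c e f g = 0" unfolding det7_def by (rule *[of _ 3 4]) (simp_all add: vector_7)
  show "det7 a b c d d f g = 0" unfolding det7_def by (rule *[of _ 4 5]) (simp_all add: vector_7)
  show "det7 a b c d e e g = 0" unfolding det7_def by (rule *[of _ 5 6]) (simp_all add: vector_7)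
  show "det7 a b c d e f f = 0" unfolding det7_def by (rule *[of _ 6 7]) (simp_all add: vector_7)
qed

lemma bilinear_alternating_antisym:
  fixes B :: "real^7 \<Rightarrow> real^7 \<Rightarrow> real"
  assumes "\<And>y. linear (\<lambda>x. B x y)" "\<And>x. linear (\<lambda>y. B x y)" "\<And>x. B x x = 0"
  shows "B y x = - B x y"
proof -
  have "B (x + y) (x + y) = B x x + B x y + (B y x + B y y)"
    by (simp add: linear_add[OF assms(1)] linear_add[OF assms(2)])
  then show ?thesis using assms(3)[of x] assms(3)[of y] assms(3)[of "x + y"] by simp
qed

lemma det7_antisym:
  "det7 b a c d e f g = - det7 a b c d e f g" "det7 a c b d e f g = - det7 a b c d e f g"
  "det7 a b d c e f g = - det7 a b c d e f g" "det7 a b c e d f g = - det7 a b c d e f g"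
  "det7 a b c d f e g = - det7 a b c d e f g" "det7 a b c d e g f = - det7 a b c d e f g"
  by (rule bilinear_alternating_antisym; rule linear_det7 det7_repeated)+

lemma axis_nth_of_bool: "axis a (1::real) $ k = of_bool (k = a)"
  by (simp add: axis_def)

lemma perm_symbol_det7:
  "perm_symbol i j k l m n p =
     det7 (axis i 1) (axis j 1) (axis k 1) (axis l 1) (axis m 1) (axis n 1) (axis p 1)"
  unfolding perm_symbol_def det7_def ..

lemmas perm_symbol_antisym = det7_antisym[of "axis _ 1" "axis _ 1" "axis _ 1" "axis _ 1" "axis _ 1" "axis _ 1"
    "axis _ 1", folded perm_symbol_det7]

lemmas perm_symbol_repeated = det7_repeated[of "axis _ 1" "axis _ 1" "axis _ 1" "axis _ 1" "axis _ 1"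
    "axis _ 1", folded perm_symbol_det7]

lemma perm_symbol_id: "perm_symbol 1 2 3 4 5 6 7 = 1"
proof -
  have "(vector [axis 1 1, axis 2 1, axis 3 1, axis 4 1, axis 5 1, axis 6 1, axis 7 1] :: real^7^7) = mat 1"
    unfolding vec_eq_iff forall_7 vector_7 mat_def by (simp add: axis_def)
  then show ?thesis unfolding perm_symbol_def by simp
qed

lemma det7_rows:
  "det7 (L $ p1) (L $ p2) (L $ p3) (L $ p4) (L $ p5) (L $ p6) (L $ p7) =
     perm_symbol p1 p2 p3 p4 p5 p6 p7 * det L"
proof -
  have "(vector [L $ p1, L $ p2, L $ p3, L $ p4, L $ p5, L $ p6, L $ p7] :: real^7^7) =
    vector [axis p1 1, axis p2 1, axis p3 1, axis p4 1, axis p5 1, axis p6 1, axis p7 1] ** L"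
    unfolding vec_eq_iff forall_7[of "\<lambda>i. \<forall>j. _ i j"] vector_7 matrix_matrix_mult_def vec_lambda_beta
    by (simp add: axis_nth_of_bool sum_of_bool)
  then show ?thesis unfolding perm_symbol_def det7_def by (simp add: det_mul)
qed

lemma linear_sum_axis:
  fixes D :: "real^'n \<Rightarrow> real"
  assumes "linear D"
  shows "D x = (\<Sum>i\<in>UNIV. x $ i * D (axis i 1))"
proof -
  have "D x = D (\<Sum>i\<in>UNIV. x $ i *\<^sub>R axis i 1)"
    by (metis basis_expansion scalar_mult_eq_scaleR)
  also have "\<dots> = (\<Sum>i\<in>UNIV. x $ i * D (axis i 1))"
    by (simp add: linear_sum[OF assms] linear_scale[OF assms])
  finally show ?thesis .
qed

definition form3 :: "(7 \<Rightarrow> 7 \<Rightarrow> 7 \<Rightarrow> real) \<Rightarrow> real^7 \<Rightarrow> real^7 \<Rightarrow> real^7 \<Rightarrow> real" where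
  "form3 f x y z = (\<Sum>a\<in>UNIV. x $ a * (\<Sum>b\<in>UNIV. y $ b * (\<Sum>c\<in>UNIV. z $ c * f a b c)))"

definition form4 :: "(7 \<Rightarrow> 7 \<Rightarrow> 7 \<Rightarrow> 7 \<Rightarrow> real) \<Rightarrow> real^7 \<Rightarrow> real^7 \<Rightarrow> real^7 \<Rightarrow> real^7 \<Rightarrow> real" where
  "form4 f x y z t = (\<Sum>a\<in>UNIV. x $ a * form3 (f a) y z t)"

text \<open>The pull-back of \<open>f\<close> by \<open>L\<close>: the columns are the images of the
  coordinate vectors.\<close>

definition pull3 :: "real^7^7 \<Rightarrow> (7 \<Rightarrow> 7 \<Rightarrow> 7 \<Rightarrow> real) \<Rightarrow> 7 \<Rightarrow> 7 \<Rightarrow> 7 \<Rightarrow> real" where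
  "pull3 L f a b c = form3 f (column a L) (column b L) (column c L)"

definition pull4 :: "real^7^7 \<Rightarrow> (7 \<Rightarrow> 7 \<Rightarrow> 7 \<Rightarrow> 7 \<Rightarrow> real) \<Rightarrow> 7 \<Rightarrow> 7 \<Rightarrow> 7 \<Rightarrow> 7 \<Rightarrow> real" where
  "pull4 L f a b c d = form4 f (column a L) (column b L) (column c L) (column d L)"

lemma linear_form3:
  "linear (\<lambda>x. form3 f x y z)" "linear (\<lambda>y. form3 f x y z)" "linear (\<lambda>z. form3 f x y z)"
  unfolding form3_def
  by (rule linearI; simp add: algebra_simps sum.distrib sum_distrib_left)+

lemma linear_form4:
  "linear (\<lambda>x. form4 f x y z t)" "linear (\<lambda>y. form4 f x y z t)"
  "linear (\<lambda>z. form4 f x y z t)" "linear (\<lambda>t. form4 f x y z t)"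
  unfolding form4_def
  by (rule linearI; simp add: algebra_simps sum.distrib sum_distrib_left linear_add[OF linear_form3(1)]
      linear_add[OF linear_form3(2)] linear_add[OF linear_form3(3)] linear_scale[OF linear_form3(1)]
      linear_scale[OF linear_form3(2)] linear_scale[OF linear_form3(3)])+

lemma form3_axis: "form3 f (axis a 1) (axis b 1) (axis c 1) = f a b c"
  unfolding form3_def axis_nth_of_bool sum_of_bool ..

lemma form4_axis: "form4 f (axis a 1) (axis b 1) (axis c 1) (axis d 1) = f a b c d"
  unfolding form4_def axis_nth_of_bool sum_of_bool form3_axis ..

lemma form3_pull3: "form3 (pull3 L f) x y z = form3 f (L *v x) (L *v y) (L *v z)"
proof -
  have lin: "linear (\<lambda>x. form3 f (L *v x) y z)" "linear (\<lambda>x. form3 f y (L *v x) z)"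
    "linear (\<lambda>x. form3 f y z (L *v x))" for y z
    by (rule linear_compose[OF matrix_vector_mul_linear linear_form3(1), unfolded o_def]
        linear_compose[OF matrix_vector_mul_linear linear_form3(2), unfolded o_def]
        linear_compose[OF matrix_vector_mul_linear linear_form3(3), unfolded o_def])+
  have 1: "form3 f (L *v x) y z = (\<Sum>a\<in>UNIV. x $ a * form3 f (column a L) y z)"
    and 2: "form3 f y (L *v x) z = (\<Sum>a\<in>UNIV. x $ a * form3 f y (column a L) z)"
    and 3: "form3 f y z (L *v x) = (\<Sum>a\<in>UNIV. x $ a * form3 f y z (column a L))" for x y z
    by (subst linear_sum_axis[OF lin(1)] linear_sum_axis[OF lin(2)] linear_sum_axis[OF lin(3)],
        simp only: matrix_vector_mult_basis)+
  show ?thesis unfolding form3_def[of "pull3 L f"] pull3_def unfolding 1 unfolding 2 unfolding 3 ..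
qed

lemma form4_pull4: "form4 (pull4 L f) x y z t = form4 f (L *v x) (L *v y) (L *v z) (L *v t)"
proof -
  have lin: "linear (\<lambda>x. form4 f (L *v x) y z t)" "linear (\<lambda>x. form4 f y (L *v x) z t)"
    "linear (\<lambda>x. form4 f y z (L *v x) t)" "linear (\<lambda>x. form4 f y z t (L *v x))" for y z t
    by (rule linear_compose[OF matrix_vector_mul_linear linear_form4(1), unfolded o_def]
        linear_compose[OF matrix_vector_mul_linear linear_form4(2), unfolded o_def]
        linear_compose[OF matrix_vector_mul_linear linear_form4(3), unfolded o_def]
        linear_compose[OF matrix_vector_mul_linear linear_form4(4), unfolded o_def])+
  have 1: "form4 f (L *v x) y z t = (\<Sum>a\<in>UNIV. x $ a * form4 f (column a L) y z t)"
    and 2: "form4 f y (L *v x) z t = (\<Sum>a\<in>UNIV. x $ a * form4 f y (column a L) z t)"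
    and 3: "form4 f y z (L *v x) t = (\<Sum>a\<in>UNIV. x $ a * form4 f y z (column a L) t)"
    and 4: "form4 f y z t (L *v x) = (\<Sum>a\<in>UNIV. x $ a * form4 f y z t (column a L))" for x y z t
    by (subst linear_sum_axis[OF lin(1)] linear_sum_axis[OF lin(2)] linear_sum_axis[OF lin(3)] linear_sum_axis[OF
        lin(4)],
        simp only: matrix_vector_mult_basis)+
  show ?thesis unfolding form4_def[of "pull4 L f"] form3_def[of "pull4 L f _"] pull4_def
    unfolding 1 unfolding 2 unfolding 3 unfolding 4 ..
qed

lemma pull3_pull3: "pull3 A (pull3 B f) = pull3 (B ** A) f"
  by (intro ext) (simp add: pull3_def[of A] form3_pull3 pull3_def[of
      "B ** A"] matrix_vector_mult_basis[symmetric] matrix_vector_mul_assoc del: matrix_vector_mult_basis)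

lemma pull4_pull4: "pull4 A (pull4 B f) = pull4 (B ** A) f"
  by (intro ext) (simp add: pull4_def[of A] form4_pull4 pull4_def[of
      "B ** A"] matrix_vector_mult_basis[symmetric] matrix_vector_mul_assoc del: matrix_vector_mult_basis)

lemma positive3_iff_pull3: "positive3 f \<longleftrightarrow> (\<exists>L. invertible L \<and> f = pull3 L phi0)"
  unfolding positive3_def fun_eq_iff pull3_def form3_def column_def
  by (simp add: sum_distrib_left mult_ac)

text \<open>Linearity moves the matrix from the tensor into the slot: the basis vector in the slot
  becomes a row of \<open>L\<close>. Repeated for each slot, this proves \<open>sum_pull3\<close>
  and \<open>sum_pull2\<close>.\<close>

lemma sum_row_slot:
  fixes D :: "real^7 \<Rightarrow> real"
  assumes "linear D"
  shows "(\<Sum>i\<in>UNIV. D (axis i 1) * (\<Sum>p\<in>UNIV. L $ p $ i * Y p)) = (\<Sum>p\<in>UNIV. D (L $ p) * Y p)"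
  unfolding linear_sum_axis[OF assms, of "L $ _"]
  by (simp add: sum_distrib_left sum_distrib_right mult_ac, subst sum.swap, rule refl)

lemma sum_pull3:
  fixes D :: "real^7 \<Rightarrow> real^7 \<Rightarrow> real^7 \<Rightarrow> real"
  assumes "\<And>y z. linear (\<lambda>x. D x y z)" "\<And>x z. linear (\<lambda>y. D x y z)" "\<And>x y. linear (\<lambda>z. D x y z)"
  shows "(\<Sum>i\<in>UNIV. \<Sum>j\<in>UNIV. \<Sum>k\<in>UNIV. D (axis i 1) (axis j 1) (axis k 1) * pull3 L f i j k) =
    (\<Sum>p\<in>UNIV. \<Sum>q\<in>UNIV. \<Sum>r\<in>UNIV. D (L $ p) (L $ q) (L $ r) * f p q r)"
proof -
  have pull: "pull3 L f i j k = (\<Sum>r\<in>UNIV. L $ r $ k * (\<Sum>q\<in>UNIV. L $ q $ j * (\<Sum>p\<in>UNIV. L $ p $ i * f p q r)))" for i j k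
    unfolding pull3_def form3_def column_def vec_lambda_beta sum_distrib_left
    by (subst sum.swap, subst (2) sum.swap, subst sum.swap) (simp only: mult_ac)
  have "(\<Sum>i\<in>UNIV. \<Sum>j\<in>UNIV. \<Sum>k\<in>UNIV. D (axis i 1) (axis j 1) (axis k 1) * pull3 L f i j k) =
      (\<Sum>i\<in>UNIV. \<Sum>j\<in>UNIV. \<Sum>r\<in>UNIV. D (axis i 1) (axis j 1) (L $ r)
         * (\<Sum>q\<in>UNIV. L $ q $ j * (\<Sum>p\<in>UNIV. L $ p $ i * f p q r)))"
    unfolding pull sum_row_slot[OF assms(3)] ..
  also have "\<dots> = (\<Sum>i\<in>UNIV. \<Sum>r\<in>UNIV. \<Sum>j\<in>UNIV. D (axis i 1) (axis j 1) (L $ r)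
         * (\<Sum>q\<in>UNIV. L $ q $ j * (\<Sum>p\<in>UNIV. L $ p $ i * f p q r)))"
    by (intro sum.cong refl sum.swap)
  also have "\<dots> = (\<Sum>i\<in>UNIV. \<Sum>r\<in>UNIV. \<Sum>q\<in>UNIV. D (axis i 1) (L $ q) (L $ r)
         * (\<Sum>p\<in>UNIV. L $ p $ i * f p q r))"
    unfolding sum_row_slot[OF assms(2)] ..
  also have "\<dots> = (\<Sum>r\<in>UNIV. \<Sum>q\<in>UNIV. \<Sum>i\<in>UNIV. D (axis i 1) (L $ q) (L $ r)
         * (\<Sum>p\<in>UNIV. L $ p $ i * f p q r))"
    by (subst sum.swap) (intro sum.cong refl sum.swap)
  also have "\<dots> = (\<Sum>r\<in>UNIV. \<Sum>q\<in>UNIV. \<Sum>p\<in>UNIV. D (L $ p) (L $ q) (L $ r) * f p q r)"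
    unfolding sum_row_slot[OF assms(1)] ..
  also have "\<dots> = (\<Sum>r\<in>UNIV. \<Sum>p\<in>UNIV. \<Sum>q\<in>UNIV. D (L $ p) (L $ q) (L $ r) * f p q r)"
    by (intro sum.cong refl sum.swap)
  also have "\<dots> = (\<Sum>p\<in>UNIV. \<Sum>q\<in>UNIV. \<Sum>r\<in>UNIV. D (L $ p) (L $ q) (L $ r) * f p q r)"
    by (subst sum.swap) (intro sum.cong refl sum.swap)
  finally show ?thesis .
qed

lemma sum_pull2:
  fixes D :: "real^7 \<Rightarrow> real^7 \<Rightarrow> real"
  assumes "\<And>y. linear (\<lambda>x. D x y)" "\<And>x. linear (\<lambda>y. D x y)"
  shows "(\<Sum>i\<in>UNIV. \<Sum>j\<in>UNIV. D (axis i 1) (axis j 1) * (\<Sum>p\<in>UNIV. L $ p $ i * (\<Sum>q\<in>UNIV. L $ q $ j * f p q))) =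
    (\<Sum>p\<in>UNIV. \<Sum>q\<in>UNIV. D (L $ p) (L $ q) * f p q)"
proof -
  have pull: "(\<Sum>p\<in>UNIV. L $ p $ i * (\<Sum>q\<in>UNIV. L $ q $ j * f p q))
      = (\<Sum>q\<in>UNIV. L $ q $ j * (\<Sum>p\<in>UNIV. L $ p $ i * f p q))" for i j
    unfolding sum_distrib_left by (subst sum.swap) (simp only: mult_ac)
  have "(\<Sum>i\<in>UNIV. \<Sum>j\<in>UNIV. D (axis i 1) (axis j 1) * (\<Sum>p\<in>UNIV. L $ p $ i * (\<Sum>q\<in>UNIV. L $ q $ j * f p q))) =
      (\<Sum>i\<in>UNIV. \<Sum>q\<in>UNIV. D (axis i 1) (L $ q) * (\<Sum>p\<in>UNIV. L $ p $ i * f p q))"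
    unfolding pull sum_row_slot[OF assms(2)] ..
  also have "\<dots> = (\<Sum>q\<in>UNIV. \<Sum>p\<in>UNIV. D (L $ p) (L $ q) * f p q)"
    by (subst sum.swap) (simp only: sum_row_slot[OF assms(1)])
  also have "\<dots> = (\<Sum>p\<in>UNIV. \<Sum>q\<in>UNIV. D (L $ p) (L $ q) * f p q)"
    by (rule sum.swap)
  finally show ?thesis .
qed

text \<open>In the order of the type \<open>7\<close> the index \<open>7 = 0\<close> would be the least one.\<close>

definition idx7 :: "7 \<Rightarrow> nat" where
  "idx7 i = (if i = 1 then 1 else if i = 2 then 2 else if i = 3 then 3 else if i = 4 then 4
     else if i = 5 then 5 else if i = 6 then 6 else 7)"

lemma idx7_simps: "idx7 1 = 1" "idx7 2 = 2" "idx7 3 = 3" "idx7 4 = 4" "idx7 5 = 5" "idx7 6 = 6" "idx7 7 = 7"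
  unfolding idx7_def by (simp_all only: neq_7 if_True if_False simp_thms)

text \<open>As conditional rewrite rules these bubble-sort the indices; the guards on
  \<open>idx7\<close> make the rewriting terminate.\<close>

lemma perm_symbol_sort:
  "idx7 b < idx7 a \<Longrightarrow> perm_symbol a b c d e f g = - perm_symbol b a c d e f g"
  "idx7 c < idx7 b \<Longrightarrow> perm_symbol a b c d e f g = - perm_symbol a c b d e f g"
  "idx7 d < idx7 c \<Longrightarrow> perm_symbol a b c d e f g = - perm_symbol a b d c e f g"
  "idx7 e < idx7 d \<Longrightarrow> perm_symbol a b c d e f g = - perm_symbol a b c e d f g"
  "idx7 f < idx7 e \<Longrightarrow> perm_symbol a b c d e f g = - perm_symbol a b c d f e g"
  "idx7 g < idx7 f \<Longrightarrow> perm_symbol a b c d e f g = - perm_symbol a b c d e g f"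
  by (rule perm_symbol_antisym)+

lemmas perm_symbol_eval = perm_symbol_sort perm_symbol_repeated perm_symbol_id idx7_simps

section \<open>The Hodge dual and the metric of a positive 3-form\<close>

lemma idx7_inj: "idx7 i = idx7 j \<Longrightarrow> i = j"
proof -
  have "\<forall>i j. idx7 i = idx7 j \<longrightarrow> i = j"
    unfolding forall_7 by (simp add: idx7_simps)
  then show "idx7 i = idx7 j \<Longrightarrow> i = j" by blast
qed

text \<open>Repeated indices give zero by antisymmetry, and all other triples are sorted by
  inserting one index at a time. Of 343 components only 35 remain to be checked.\<close>

lemma alternating3_zeroI:
  fixes F :: "7 \<Rightarrow> 7 \<Rightarrow> 7 \<Rightarrow> real"
  assumes swap: "\<And>i j k. F j i k = - F i j k" "\<And>i j k. F i k j = - F i j k"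
    and sorted: "\<And>i j k. idx7 i < idx7 j \<Longrightarrow> idx7 j < idx7 k \<Longrightarrow> F i j k = 0"
  shows "F i j k = 0"
proof -
  have rep: "F i i k = 0" "F i k k = 0" for i k
    using swap(1)[of i i k] swap(2)[of i k k] by simp_all
  have sorted2: "F i j k = 0" if "idx7 j < idx7 k" for i j k
    using that sorted[of i j k] sorted[of j i k] sorted[of j k i] rep swap(1)[of i j k] swap(2)[of j i k]
        idx7_inj[of i j] idx7_inj[of i k]
    by (cases "idx7 i" "idx7 j" rule: linorder_cases; cases "idx7 i" "idx7 k" rule: linorder_cases) auto
  then show ?thesis
    using sorted2[of j k i] sorted2[of k j i] rep swap(2)[of i j k] idx7_inj[of j k]
    by (cases "idx7 j" "idx7 k" rule: linorder_cases) auto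
qed

text \<open>The first index is inserted at each possible place in a sorted tail; the tail itself is
  then sorted by \<open>alternating3_zeroI\<close>. Of 2401 components 35 remain.\<close>

lemma alternating4_zeroI:
  fixes F :: "7 \<Rightarrow> 7 \<Rightarrow> 7 \<Rightarrow> 7 \<Rightarrow> real"
  assumes swap: "\<And>i j k l. F j i k l = - F i j k l" "\<And>i j k l. F i k j l = - F i j k l" "\<And>i j k l. F i j l k =
      - F i j k l"
    and sorted: "\<And>i j k l. idx7 i < idx7 j \<Longrightarrow> idx7 j < idx7 k \<Longrightarrow> idx7 k < idx7 l \<Longrightarrow> F i j k l = 0"
  shows "F i j k l = 0"
proof -
  have rep: "F i i k l = 0" "F i k k l = 0" "F i k l l = 0" for i k l
    using swap(1)[of i i k l] swap(2)[of i k k l] swap(3)[of i k l l] by simp_all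
  have sorted3: "F i j k l = 0" if jk: "idx7 j < idx7 k" and kl: "idx7 k < idx7 l" for i j k l
  proof -
    consider "idx7 i < idx7 j" | "i = j" | "idx7 j < idx7 i" "idx7 i < idx7 k" | "i = k"
      | "idx7 k < idx7 i" "idx7 i < idx7 l" | "i = l" | "idx7 l < idx7 i"
      using idx7_inj by (meson linorder_less_linear)
    then show ?thesis
    proof cases
      case 1
      then show ?thesis using sorted jk kl by blast
    next
      case 2
      then show ?thesis using rep by simp
    next
      case 3
      then show ?thesis using sorted[of j i k l] swap(1)[of i j k l] kl by simp
    next
      case 4
      then show ?thesis using rep(2)[of j k l] swap(1)[of j k k l] by simp
    next
      case 5
      then show ?thesis using sorted[of j k i l] swap(1)[of i j k l] swap(2)[of j i k l] jk by simp
    next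
      case 6
      then show ?thesis using rep(3)[of j k l] swap(1)[of l j k l] swap(2)[of j l k l] by simp
    next
      case 7
      then show ?thesis
        using sorted[of j k l i] swap(1)[of i j k l] swap(2)[of j i k l] swap(3)[of j k i l] jk kl by simp
    qed
  qed
  show ?thesis
    using alternating3_zeroI[of "F i" j k l, OF swap(2) swap(3) sorted3] .
qed

lemma all_sorted3:
  "(\<forall>i j k. idx7 i < idx7 j \<longrightarrow> idx7 j < idx7 k \<longrightarrow> P i j k) \<longleftrightarrow>
     P 1 2 3 \<and> P 1 2 4 \<and> P 1 2 5 \<and> P 1 2 6 \<and> P 1 2 7 \<and> P 1 3 4 \<and> P 1 3 5 \<and>
     P 1 3 6 \<and> P 1 3 7 \<and> P 1 4 5 \<and> P 1 4 6 \<and> P 1 4 7 \<and> P 1 5 6 \<and> P 1 5 7 \<and>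
     P 1 6 7 \<and> P 2 3 4 \<and> P 2 3 5 \<and> P 2 3 6 \<and> P 2 3 7 \<and> P 2 4 5 \<and> P 2 4 6 \<and>
     P 2 4 7 \<and> P 2 5 6 \<and> P 2 5 7 \<and> P 2 6 7 \<and> P 3 4 5 \<and> P 3 4 6 \<and> P 3 4 7 \<and>
     P 3 5 6 \<and> P 3 5 7 \<and> P 3 6 7 \<and> P 4 5 6 \<and> P 4 5 7 \<and> P 4 6 7 \<and> P 5 6 7"
  unfolding forall_7 by (simp only: idx7_simps one_less_numeral_iff numeral_less_iff less_num_simps le_num_simps
      conj_assoc not_numeral_less_one less_irrefl simp_thms)

lemma all_sorted4:
  "(\<forall>i j k l. idx7 i < idx7 j \<longrightarrow> idx7 j < idx7 k \<longrightarrow> idx7 k < idx7 l \<longrightarrow> P i j k l) \<longleftrightarrow>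
     P 1 2 3 4 \<and> P 1 2 3 5 \<and> P 1 2 3 6 \<and> P 1 2 3 7 \<and> P 1 2 4 5 \<and> P 1 2 4 6 \<and> P 1 2 4 7 \<and>
     P 1 2 5 6 \<and> P 1 2 5 7 \<and> P 1 2 6 7 \<and> P 1 3 4 5 \<and> P 1 3 4 6 \<and> P 1 3 4 7 \<and> P 1 3 5 6 \<and>
     P 1 3 5 7 \<and> P 1 3 6 7 \<and> P 1 4 5 6 \<and> P 1 4 5 7 \<and> P 1 4 6 7 \<and> P 1 5 6 7 \<and> P 2 3 4 5 \<and>
     P 2 3 4 6 \<and> P 2 3 4 7 \<and> P 2 3 5 6 \<and> P 2 3 5 7 \<and> P 2 3 6 7 \<and> P 2 4 5 6 \<and> P 2 4 5 7 \<and>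
     P 2 4 6 7 \<and> P 2 5 6 7 \<and> P 3 4 5 6 \<and> P 3 4 5 7 \<and> P 3 4 6 7 \<and> P 3 5 6 7 \<and> P 4 5 6 7"
  unfolding forall_7 by (simp only: idx7_simps one_less_numeral_iff numeral_less_iff less_num_simps le_num_simps
      conj_assoc not_numeral_less_one less_irrefl simp_thms)

lemma sum_phi0_alternating:
  fixes X :: "7 \<Rightarrow> 7 \<Rightarrow> 7 \<Rightarrow> real"
  assumes swap: "\<And>i j k. X j i k = - X i j k" "\<And>i j k. X i k j = - X i j k"
  shows "(\<Sum>i\<in>UNIV. \<Sum>j\<in>UNIV. \<Sum>k\<in>UNIV. phi0 i j k * X i j k) =
    6 * (X 1 2 3 + X 1 4 5 + X 1 6 7 + X 2 4 6 - X 2 5 7 - X 3 4 7 - X 3 5 6)"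
proof -
  have sort: "idx7 j < idx7 i \<Longrightarrow> X i j k = - X j i k" "idx7 k < idx7 j \<Longrightarrow> X i j k = - X i k j" for i j k
    by (rule swap)+
  show ?thesis by (simp add: sum_7 phi0_table sort idx7_simps)
qed

text \<open>Moving three arguments past four takes twelve transpositions, an even number.\<close>

lemma perm_symbol_block_swap: "perm_symbol i5 i6 i7 i1 i2 i3 i4 = perm_symbol i1 i2 i3 i4 i5 i6 i7"
  using perm_symbol_antisym by (metis minus_minus)

text \<open>This identifies \<open>psi0\<close>, introduced by a contraction, with the Hodge dual.
  Both sides are alternating, so the 35 sorted quadruples suffice.\<close>

lemma hodge_phi0:
  "(\<Sum>i\<in>UNIV. \<Sum>j\<in>UNIV. \<Sum>k\<in>UNIV. phi0 i j k * perm_symbol i j k a b c d) = 6 * psi0 a b c d"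
proof -
  have 1: "(\<Sum>i\<in>UNIV. \<Sum>j\<in>UNIV. \<Sum>k\<in>UNIV. phi0 i j k * perm_symbol i j k a b c d) =
    6 * (perm_symbol 1 2 3 a b c d + perm_symbol 1 4 5 a b c d + perm_symbol 1 6 7 a b c d + perm_symbol 2 4 6 a b c d
     - perm_symbol 2 5 7 a b c d - perm_symbol 3 4 7 a b c d - perm_symbol 3 5 6 a b c d)" (is "_
         = 6 * ?H a b c d") for a b c d
    by (rule sum_phi0_alternating) (rule perm_symbol_antisym)+
  define Z where "Z a b c d = ?H a b c d - psi0 a b c d" for a b c d
  have "\<forall>a b c d. idx7 a < idx7 b \<longrightarrow> idx7 b < idx7 c \<longrightarrow> idx7 c < idx7 d \<longrightarrow> ?H a b c d - psi0 a b c d = 0"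
    unfolding all_sorted4 by (simp add: perm_symbol_eval psi0_table)
  then have sorted: "Z i j k l = 0" if "idx7 i < idx7 j" "idx7 j < idx7 k" "idx7 k < idx7 l" for i j k l
    using that unfolding Z_def by blast
  have "Z j i k l = - Z i j k l" "Z i k j l = - Z i j k l" "Z i j l k = - Z i j k l" for i j k l
    unfolding Z_def
    using perm_symbol_antisym(4)[of _ _ _ i j k l] psi0_antisym(1)[of j i k l]
      perm_symbol_antisym(5)[of _ _ _ i j k l] psi0_antisym(2)[of i k j l]
      perm_symbol_antisym(6)[of _ _ _ i j k l] psi0_antisym(3)[of i j l k] by simp_all
  then have "Z a b c d = 0"
    by (rule alternating4_zeroI[OF _ _ _ sorted])
  then show ?thesis unfolding 1 Z_def by simp
qed

text \<open>The constant is 6 * 4 * 6, from \<open>hodge_phi0\<close>,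
  \<open>phi0_psi0_contract\<close> and \<open>phi0_contract_pair\<close>. Divided by the 24 of
  \<open>wedge223\<close> and the 6 of the metric equation it becomes 1: the standard form induces
  the standard metric.\<close>

lemma wedge_phi0:
  "(\<Sum>i1\<in>UNIV. \<Sum>i2\<in>UNIV. \<Sum>i3\<in>UNIV. \<Sum>i4\<in>UNIV. \<Sum>i5\<in>UNIV. \<Sum>i6\<in>UNIV. \<Sum>i7\<in>UNIV.
     perm_symbol i1 i2 i3 i4 i5 i6 i7 * phi0 a i1 i2 * phi0 b i3 i4 * phi0 i5 i6 i7) = 144 * of_bool (a = b)"
proof -
  have 1: "(\<Sum>i5\<in>UNIV. \<Sum>i6\<in>UNIV. \<Sum>i7\<in>UNIV.
     perm_symbol i1 i2 i3 i4 i5 i6 i7 * phi0 a i1 i2 * phi0 b i3 i4 * phi0 i5 i6 i7)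
         = phi0 a i1 i2 * (6 * (psi0 i1 i2 i3 i4 * phi0 b i3 i4))" for i1 i2 i3 i4
  proof -
    have "(\<Sum>i5\<in>UNIV. \<Sum>i6\<in>UNIV. \<Sum>i7\<in>UNIV.
     perm_symbol i1 i2 i3 i4 i5 i6 i7 * phi0 a i1 i2 * phi0 b i3 i4 * phi0 i5 i6 i7) =
     phi0 a i1 i2 * phi0 b i3 i4 * (\<Sum>i5\<in>UNIV. \<Sum>i6\<in>UNIV. \<Sum>i7\<in>UNIV. phi0 i5 i6 i7 * perm_symbol i5 i6 i7 i1 i2 i3 i4)"
      unfolding perm_symbol_block_swap[of _ _ _ i1 i2 i3 i4] sum_distrib_left by (simp only: mult_ac)
    then show ?thesis unfolding hodge_phi0 by simp
  qed
  show ?thesis unfolding 1 sum_distrib_left[symmetric] phi0_psi0_contract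
    unfolding mult.left_commute[of "phi0 _ _ _"] sum_distrib_left[symmetric] phi0_contract_pair by simp
qed

lemma matrix_inv_unique:
  fixes A :: "real^'n^'n"
  assumes "A ** B = mat 1" "B ** A = mat 1"
  shows "matrix_inv A = B"
proof -
  have "A ** matrix_inv A = mat 1 \<and> matrix_inv A ** A = mat 1"
    unfolding matrix_inv_def by (rule someI[of _ B]) (simp add: assms)
  then have "matrix_inv A = matrix_inv A ** (A ** B)" by (simp add: assms)
  also have "\<dots> = B"
    using \<open>A ** matrix_inv A = mat 1 \<and> matrix_inv A ** A = mat 1\<close> by (simp add: matrix_mul_assoc)
  finally show ?thesis .
qed

lemma invertible_matrix_inv:
  fixes A :: "real^'n^'n"
  assumes "invertible A"
  shows "A ** matrix_inv A = mat 1" "matrix_inv A ** A = mat 1"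
  using assms matrix_inv_unique unfolding invertible_def by metis+

lemma invertible_if_positive:
  fixes A :: "real^'n^'n"
  assumes "\<And>u. u \<noteq> 0 \<Longrightarrow> u \<bullet> (A *v u) > 0"
  shows "invertible A"
  unfolding invertible_left_inverse matrix_left_invertible_ker
  using assms by (metis inner_zero_right less_irrefl)

lemma inner_transpose_mult: "x \<bullet> ((transpose L ** L) *v y) = (L *v x) \<bullet> (L *v (y :: real^'n))"
  unfolding matrix_vector_mul_assoc[symmetric] transpose_matrix_vector
  by (metis dot_lmul_matrix inner_commute)

lemma linear_sum_funs:
  fixes D :: "'b \<Rightarrow> 'a::real_vector \<Rightarrow> real"
  assumes "\<And>p. p \<in> I \<Longrightarrow> linear (D p)"
  shows "linear (\<lambda>x. \<Sum>p\<in>I. D p x)"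
  by (rule linearI) (simp_all add: linear_add[OF assms] linear_scale[OF assms] sum.distrib sum_distrib_left)

lemma linear_mult_const:
  fixes D :: "'a::real_vector \<Rightarrow> real"
  assumes "linear D"
  shows "linear (\<lambda>x. D x * c)" "linear (\<lambda>x. c * D x)"
  by (rule linearI; simp add: linear_add[OF assms] linear_scale[OF assms] algebra_simps)+

lemma linear_comp_mv: "linear D \<Longrightarrow> linear (\<lambda>x. D (L *v x :: real^'n))"
  using linear_compose[OF matrix_vector_mul_linear, of D L] by (simp add: o_def)

lemma quadrilinear_eq_form4:
  assumes "\<And>y z t. linear (\<lambda>x. W x y z t)" "\<And>x z t. linear (\<lambda>y. W x y z t)"
    "\<And>x y t. linear (\<lambda>z. W x y z t)" "\<And>x y z. linear (\<lambda>t. W x y z t)"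
  shows "W x y z t = form4 (\<lambda>a b c d. W (axis a 1) (axis b 1) (axis c 1) (axis d 1)) x y z t"
  unfolding form4_def form3_def linear_sum_axis[OF assms(4), of _ _ _ t, symmetric]
    linear_sum_axis[OF assms(3), of _ _ z, symmetric] linear_sum_axis[OF assms(2), of _ y, symmetric]
    linear_sum_axis[OF assms(1), of x, symmetric] ..

lemma hodge_phi0_form4:
  "(\<Sum>p\<in>UNIV. \<Sum>q\<in>UNIV. \<Sum>r\<in>UNIV. det7 (axis p 1) (axis q 1) (axis r 1) x y z t * phi0 p q r) = 6 * form4 psi0 x y z t"
  (is "?W x y z t = _")
proof -
  have "?W x y z t = form4 (\<lambda>a b c d. ?W (axis a 1) (axis b 1) (axis c 1) (axis d 1)) x y z t"
    by (rule quadrilinear_eq_form4; intro linear_sum_funs linear_mult_const linear_det7)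
  also have "(\<lambda>a b c d. ?W (axis a 1) (axis b 1) (axis c 1) (axis d 1)) = (\<lambda>a b c d. 6 * psi0 a b c d)"
    unfolding perm_symbol_det7[symmetric] hodge_phi0[symmetric] by (simp only: mult.commute)
  finally show ?thesis by (simp add: form4_def form3_def sum_distrib_left mult_ac)
qed

lemma det7_columns: "det7 (column i L) (column j L) (column k L) (column a L) (column b L) (column c L) (column d
    L) = det L * perm_symbol i j k a b c d"
proof -
  have "transpose L $ p = column p L" for p by (simp add: transpose_def column_def)
  then show ?thesis using det7_rows[of "transpose L" i j k a b c d] by simp
qed

text \<open>Naturality of the Hodge star. With \<open>K\<close> inverse to \<open>L\<close>, raising
  the indices turns the pulled-back form into \<open>pull3 (transpose K) phi0\<close>, while
  \<open>det L\<close> turns the permutation symbol into a determinant of columns of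
  \<open>L\<close>. In the three contracted slots \<open>K\<close> and \<open>L\<close> cancel; in
  the four free slots \<open>L\<close> survives.\<close>

lemma hodge3_pull3:
  assumes "invertible L"
  shows "hodge3 (transpose L ** L) (det L) (pull3 L phi0) = pull4 L psi0"
proof (intro ext)
  fix a b c d
  define K where "K = matrix_inv L"
  define M where "M = K ** transpose K"
  have K: "L ** K = mat 1" "K ** L = mat 1"
    using invertible_matrix_inv[OF assms] by (simp_all add: K_def)
  have KT: "transpose K ** transpose L = mat 1" "transpose L ** transpose K = mat 1"
    using K by (simp_all flip: matrix_transpose_mul add: transpose_mat)
  have "transpose L ** L ** M = transpose L ** (L ** K) ** transpose K" "M ** (transpose L ** L)
      = K ** (transpose K ** transpose L) ** L"
    unfolding M_def by (simp_all add: matrix_mul_assoc)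
  then have M: "matrix_inv (transpose L ** L) = M"
    by (intro matrix_inv_unique) (simp_all add: K KT)
  have MK: "M ** transpose L = K"
    unfolding M_def by (simp add: matrix_mul_assoc[symmetric] KT)
  have "L *v (M $ i) = (M ** transpose L) $ i" for i
    by (simp add: vec_eq_iff matrix_vector_mult_def matrix_matrix_mult_def transpose_def mult.commute)
  then have LM: "L *v (M $ i) = K $ i" for i unfolding MK .
  have inner: "(\<Sum>l\<in>UNIV. \<Sum>m\<in>UNIV. \<Sum>n\<in>UNIV.
      matrix_inv (transpose L ** L) $ i $ l * matrix_inv (transpose L ** L) $ j $ m * matrix_inv (transpose L ** L)
          $ k $ n * pull3 L phi0 l m n * e)
      = pull3 (transpose K) phi0 i j k * e" for i j k e
  proof -
    have "(\<Sum>l\<in>UNIV. \<Sum>m\<in>UNIV. \<Sum>n\<in>UNIV. M $ i $ l * M $ j $ m * M $ k $ n * pull3 L phi0 l m n * e)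
        = form3 (pull3 L phi0) (M $ i) (M $ j) (M $ k) * e"
      unfolding form3_def by (simp only: sum_distrib_left sum_distrib_right mult_ac)
    then show ?thesis unfolding M form3_pull3 LM by (simp add: pull3_def column_transpose row_def)
  qed
  define D where "D x y z = det7 (L *v x) (L *v y) (L *v z) (column a L) (column b L) (column c L) (column d L)"
      for x y z
  have D: "linear (\<lambda>x. D x y z)" "linear (\<lambda>x. D y x z)" "linear (\<lambda>x. D y z x)" for y z
    unfolding D_def by (rule linear_comp_mv linear_det7)+
  have LK: "L *v (transpose K $ p) = axis p 1" for p
  proof -
    have "L *v (transpose K $ p) = column p (L ** K)"
      by (simp add: vec_eq_iff matrix_vector_mult_def matrix_matrix_mult_def transpose_def column_def)
    then show ?thesis unfolding K by (simp add: column_def mat_def axis_def vec_eq_iff)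
  qed
  have "6 * hodge3 (transpose L ** L) (det L) (pull3 L phi0) a b c d =
    (\<Sum>i\<in>UNIV. \<Sum>j\<in>UNIV. \<Sum>k\<in>UNIV. D (axis i 1) (axis j 1) (axis k 1) * pull3 (transpose K) phi0 i j k)"
    unfolding hodge3_def inner D_def matrix_vector_mult_basis det7_columns by (simp add: mult_ac)
  also have "\<dots> = (\<Sum>p\<in>UNIV. \<Sum>q\<in>UNIV. \<Sum>r\<in>UNIV. D (transpose K $ p) (transpose K $ q) (transpose K $ r) * phi0 p q r)"
    by (rule sum_pull3) (rule D)+
  also have "\<dots> = 6 * pull4 L psi0 a b c d"
    unfolding D_def LK hodge_phi0_form4 pull4_def ..
  finally show "hodge3 (transpose L ** L) (det L) (pull3 L phi0) a b c d = pull4 L psi0 a b c d" by simp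
qed

lemma interior3_form3: "interior3 u f b c = form3 f u (axis b 1) (axis c 1)"
  unfolding interior3_def form3_def axis_nth_of_bool sum_of_bool ..

lemma interior3_pull3:
  "interior3 u (pull3 L f) b c = (\<Sum>p\<in>UNIV. L $ p $ b * (\<Sum>q\<in>UNIV. L $ q $ c * interior3 (L *v u) f p q))"
proof -
  have "interior3 u (pull3 L f) b c = form3 f (L *v u) (L *v axis b 1) (L *v axis c 1)"
    unfolding interior3_form3 form3_pull3 ..
  also have "\<dots> = (\<Sum>p\<in>UNIV. L $ p $ b * (\<Sum>q\<in>UNIV. L $ q $ c * form3 f (L *v u) (axis p 1) (axis q 1)))"
    unfolding matrix_vector_mult_basis unfolding linear_sum_axis[OF linear_form3(2), of _ _ "column b L"]
    unfolding linear_sum_axis[OF linear_form3(3), of _ _ _ "column c L"] by (simp add: column_def)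
  finally show ?thesis unfolding interior3_form3 .
qed

text \<open>The sum of \<open>wedge223\<close> for an arbitrary array \<open>D\<close>, bracketed so
  that the factors can be contracted from the inside, first the 3-form and then the 2-forms.\<close>

definition wedge_sum ::
  "(7 \<Rightarrow> 7 \<Rightarrow> 7 \<Rightarrow> 7 \<Rightarrow> 7 \<Rightarrow> 7 \<Rightarrow> 7 \<Rightarrow> real) \<Rightarrow> (7 \<Rightarrow> 7 \<Rightarrow> real) \<Rightarrow> (7 \<Rightarrow> 7 \<Rightarrow> real) \<Rightarrow> (7 \<Rightarrow> 7 \<Rightarrow> 7 \<Rightarrow> real) \<Rightarrow> real" where
  "wedge_sum D \<alpha> \<beta> \<gamma> = (\<Sum>i1\<in>UNIV. \<Sum>i2\<in>UNIV. \<alpha> i1 i2 * (\<Sum>i3\<in>UNIV. \<Sum>i4\<in>UNIV. \<beta> i3 i4 *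
     (\<Sum>i5\<in>UNIV. \<Sum>i6\<in>UNIV. \<Sum>i7\<in>UNIV. D i1 i2 i3 i4 i5 i6 i7 * \<gamma> i5 i6 i7)))"

lemma wedge223_eq_wedge_sum: "wedge223 \<alpha> \<beta> \<gamma> = wedge_sum perm_symbol \<alpha> \<beta> \<gamma> / 24"
  unfolding wedge223_def wedge_sum_def by (simp only: sum_distrib_left mult_ac)

lemma wedge223_phi0: "wedge223 (interior3 u phi0) (interior3 w phi0) phi0 = 6 * (u \<bullet> w)"
proof -
  define W where "W u w = wedge223 (interior3 u phi0) (interior3 w phi0) phi0" for u w
  have lin: "linear (\<lambda>u. interior3 u phi0 a b)" for a b
    unfolding interior3_form3 by (rule linear_form3)
  have W: "linear (\<lambda>u. W u w)" "linear (\<lambda>u. W w u)" for w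
    unfolding W_def wedge223_eq_wedge_sum wedge_sum_def divide_inverse
    by (intro linear_sum_funs linear_mult_const lin)+
  have "W (axis a 1) (axis b 1) = 6 * of_bool (a = b)" for a b
  proof -
    have "interior3 (axis a 1) phi0 = phi0 a" for a
      unfolding interior3_def axis_nth_of_bool sum_of_bool ..
    then show ?thesis unfolding W_def wedge223_def by (simp add: wedge_phi0)
  qed
  then have "W u w = (\<Sum>a\<in>UNIV. u $ a * (\<Sum>b\<in>UNIV. w $ b * (6 * of_bool (a = b))))"
    using linear_sum_axis[OF W(1), of u w] linear_sum_axis[OF W(2), of _ w] by simp
  also have "\<dots> = 6 * (u \<bullet> w)"
    unfolding mult.left_commute[of _ 6] sum_distrib_left[symmetric] sum_of_bool inner_vec_def inner_real_def ..
  finally show ?thesis unfolding W_def .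
qed

text \<open>Every slot of the permutation symbol absorbs a row of \<open>L\<close>, so the seven
  rows produce \<open>det L\<close>, and the two interior products become those with
  \<open>L *v u\<close> and \<open>L *v w\<close>. \<open>D3\<close> and \<open>D2\<close> are the
  partially contracted determinants.\<close>

lemma wedge223_pull3:
  "wedge223 (interior3 u (pull3 L phi0)) (interior3 w (pull3 L phi0)) (pull3 L phi0)
      = 6 * det L * ((L *v u) \<bullet> (L *v w))"
proof -
  define \<alpha> where "\<alpha> = interior3 (L *v u) phi0"
  define \<beta> where "\<beta> = interior3 (L *v w) phi0"
  have int: "interior3 u (pull3 L phi0) b c = (\<Sum>p\<in>UNIV. L $ p $ b * (\<Sum>q\<in>UNIV. L $ q $ c * \<alpha> p q))"
     "interior3 w (pull3 L phi0) b c = (\<Sum>p\<in>UNIV. L $ p $ b * (\<Sum>q\<in>UNIV. L $ q $ c * \<beta> p q))" for b c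
    unfolding \<alpha>_def \<beta>_def by (rule interior3_pull3)+
  define D3 where "D3 x1 x2 x3 x4 = (\<Sum>p\<in>UNIV. \<Sum>q\<in>UNIV. \<Sum>r\<in>UNIV. det7 x1 x2 x3 x4 (L $ p) (L $ q) (L $ r) * phi0 p q
      r)" for x1 x2 x3 x4
  define D2 where "D2 x1 x2 = (\<Sum>p\<in>UNIV. \<Sum>q\<in>UNIV. D3 x1 x2 (L $ p) (L $ q) * \<beta> p q)" for x1 x2
  have D3: "linear (\<lambda>x. D3 x y z t)" "linear (\<lambda>x. D3 y x z t)" "linear (\<lambda>x. D3 y z x t)"
      "linear (\<lambda>x. D3 y z t x)" for y z t
    unfolding D3_def by (intro linear_sum_funs linear_mult_const linear_det7)+
  have D2: "linear (\<lambda>x. D2 x y)" "linear (\<lambda>x. D2 y x)" for y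
    unfolding D2_def by (intro linear_sum_funs linear_mult_const D3)+
  have 3: "(\<Sum>i5\<in>UNIV. \<Sum>i6\<in>UNIV. \<Sum>i7\<in>UNIV. perm_symbol i1 i2 i3 i4 i5 i6 i7 * pull3 L phi0 i5 i6 i7) =
     D3 (axis i1 1) (axis i2 1) (axis i3 1) (axis i4 1)" for i1 i2 i3 i4
    unfolding D3_def perm_symbol_det7 by (rule sum_pull3) (rule linear_det7)+
  have 2: "(\<Sum>i3\<in>UNIV. \<Sum>i4\<in>UNIV. interior3 w (pull3 L phi0) i3 i4 * D3 x y (axis i3 1) (axis i4 1)) = D2 x y" for x y
    unfolding D2_def int mult.commute[of _ "D3 _ _ _ _"] by (rule sum_pull2) (rule D3)+
  have 1: "(\<Sum>i3\<in>UNIV. \<Sum>i4\<in>UNIV. interior3 u (pull3 L phi0) i3 i4 * D2 (axis i3 1) (axis i4 1)) =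
     (\<Sum>p\<in>UNIV. \<Sum>q\<in>UNIV. D2 (L $ p) (L $ q) * \<alpha> p q)"
    unfolding int mult.commute[of _ "D2 _ _"] by (rule sum_pull2) (rule D2)+
  have "wedge_sum perm_symbol (interior3 u (pull3 L phi0)) (interior3 w (pull3 L phi0)) (pull3 L phi0) =
      (\<Sum>p\<in>UNIV. \<Sum>q\<in>UNIV. D2 (L $ p) (L $ q) * \<alpha> p q)"
    unfolding wedge_sum_def 3 2 1 ..
  also have "\<dots> = det L * wedge_sum perm_symbol \<alpha> \<beta> phi0"
    unfolding D2_def D3_def det7_rows wedge_sum_def by (simp only: sum_distrib_left sum_distrib_right mult_ac)
  finally show ?thesis
    using wedge223_phi0[of "L *v u" "L *v w"] unfolding wedge223_eq_wedge_sum \<alpha>_def \<beta>_def by simp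
qed

lemma det_scaleR: "det (c *\<^sub>R A :: real^7^7) = c ^ 7 * det A"
proof -
  have "c *\<^sub>R A = mat c ** A"
  proof -
    have "(\<Sum>k\<in>UNIV. (if i = k then c else 0) * A $ k $ j) = c * A $ i $ j" for i j
    proof -
      have "(if i = k then c else 0) * A $ k $ j = (if i = k then c * A $ k $ j else 0)" for k by simp
      then show ?thesis by simp
    qed
    then show ?thesis by (simp add: vec_eq_iff matrix_matrix_mult_def mat_def)
  qed
  moreover have "det (mat c :: real^7^7) = c ^ 7"
    by (subst det_diagonal) (simp_all add: mat_def)
  ultimately show ?thesis by (simp add: det_mul)
qed

text \<open>The metric equation gives
  \<open>vol *\<^sub>R G = det L *\<^sub>R (transpose L ** L)\<close>. Its determinant, combined
  with \<open>vol\<^sup>2 = det G\<close>, gives equal ninth powers of \<open>vol\<close> and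
  \<open>det L\<close>; since 9 is odd, the sign is determined too.\<close>

lemma metric_volume_unique:
  assumes "\<And>u w. (u \<bullet> (G *v w)) * vol = wedge223 (interior3 u f) (interior3 w f) f / 6"
    and "vol\<^sup>2 = det G" and f: "f = pull3 L phi0" and vol: "vol \<noteq> 0"
  shows "G = transpose L ** L" "vol = det L"
proof -
  have "(axis i 1 \<bullet> (G *v axis j 1)) * vol = det L * ((L *v axis i 1) \<bullet> (L *v axis j 1))" for i j
    unfolding assms(1) f wedge223_pull3 by simp
  then have "G $ i $ j * vol = det L * (transpose L ** L) $ i $ j" for i j
    unfolding matrix_vector_mult_basis inner_axis'
        by (simp add: column_def inner_vec_def matrix_matrix_mult_def transpose_def)
  then have GL: "vol *\<^sub>R G = det L *\<^sub>R (transpose L ** L)"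
    by (simp add: vec_eq_iff mult.commute)
  have "vol ^ 7 * vol\<^sup>2 = det L ^ 7 * (det L)\<^sup>2"
    using arg_cong[OF GL, of det] unfolding det_scaleR det_mul det_transpose assms(2) by (simp add: power2_eq_square)
  then have "vol ^ 9 = det L ^ 9"
    by (simp flip: power_add)
  then show "vol = det L"
    using odd_real_root_power_cancel[of 9] by (metis odd_numeral)
  then show "G = transpose L ** L"
    using GL vol by simp
qed

section \<open>Transitivity on directions\<close>

text \<open>A unit vector \<open>e\<^sub>i\<close> splits its orthogonal complement into three complex lines. Opposite rotations of
  two of them lie in \<open>SU(3)\<close> and hence preserve \<open>phi0\<close>.\<close>

definition rot2 :: "7 \<Rightarrow> 7 \<Rightarrow> 7 \<Rightarrow> 7 \<Rightarrow> real \<Rightarrow> real \<Rightarrow> real^7^7" where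
  "rot2 p q a b c s = (\<chi> i j. if i = p \<and> j = p \<or> i = q \<and> j = q \<or> i = a \<and> j = a \<or> i = b \<and> j = b then c
     else if i = p \<and> j = q \<or> i = b \<and> j = a then s else if i = q \<and> j = p \<or> i = a \<and> j = b then - s
     else of_bool (i = j))"

lemma form3_antisym:
  assumes "\<And>a b c. f b a c = - f a b c" "\<And>a b c. f a c b = - f a b c"
  shows "form3 f y x z = - form3 f x y z" "form3 f x z y = - form3 f x y z"
proof -
  have "y $ a * (x $ b * (\<Sum>c\<in>UNIV. z $ c * f a b c)) = - (x $ b * (y $ a * (\<Sum>c\<in>UNIV. z $ c * f b a c)))" for a b
    unfolding assms(1)[of a b] by (simp add: sum_negf)
  then have "form3 f y x z = - (\<Sum>a\<in>UNIV. \<Sum>b\<in>UNIV. x $ b * (y $ a * (\<Sum>c\<in>UNIV. z $ c * f b a c)))"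
    unfolding form3_def sum_distrib_left[of "y $ _"] sum_distrib_left[of "x $ _"] by (simp add: sum_negf)
  also have "\<dots> = - form3 f x y z"
    unfolding form3_def sum_distrib_left[of "y $ _"] sum_distrib_left[of "x $ _"] by (subst sum.swap) (rule refl)
  finally show "form3 f y x z = - form3 f x y z" .
  have *: "(\<Sum>b\<in>UNIV. z $ b * (\<Sum>c\<in>UNIV. y $ c * f a b c)) = - (\<Sum>b\<in>UNIV. y $ b * (\<Sum>c\<in>UNIV. z $ c * f a b c))" for a
  proof -
    have "z $ b * (y $ c * f a b c) = - (y $ c * (z $ b * f a c b))" for b c
      unfolding assms(2)[of a b c] by simp
    then have "(\<Sum>b\<in>UNIV. z $ b * (\<Sum>c\<in>UNIV. y $ c * f a b c)) = - (\<Sum>b\<in>UNIV. \<Sum>c\<in>UNIV. y $ c * (z $ b * f a c b))"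
      unfolding sum_distrib_left by (simp add: sum_negf)
    then show ?thesis unfolding sum_distrib_left by (subst (asm) sum.swap)
  qed
  show "form3 f x z y = - form3 f x y z"
    unfolding form3_def * by (simp only: mult_minus_right sum_negf)
qed

lemma form4_antisym:
  assumes "\<And>a b c d. f b a c d = - f a b c d" "\<And>a b c d. f a c b d = - f a b c d" "\<And>a b c d. f a b d c = - f a b c d"
  shows "form4 f y x z t = - form4 f x y z t" "form4 f x z y t = - form4 f x y z t" "form4 f x y t z =
      - form4 f x y z t"
proof -
  
  have *: "form3 (f a) z y t = - form3 (f a) y z t" "form3 (f a) y t z = - form3 (f a) y z t" for a y z t
    by (rule form3_antisym[where f = "f a", OF assms(2,3)])+
  show "form4 f x z y t = - form4 f x y z t"
    unfolding form4_def *(1)[of _ z y] by (simp only: mult_minus_right sum_negf)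
  show "form4 f x y t z = - form4 f x y z t"
    unfolding form4_def *(2)[of _ y t z] by (simp only: mult_minus_right sum_negf)
  have "y $ a * (x $ b * (\<Sum>c\<in>UNIV. z $ c * (\<Sum>d\<in>UNIV. t $ d * f a b c d))) =
      - (x $ b * (y $ a * (\<Sum>c\<in>UNIV. z $ c * (\<Sum>d\<in>UNIV. t $ d * f b a c d))))" for a b
    unfolding assms(1)[of a b] by (simp add: sum_negf)
  then have "form4 f y x z t = - (\<Sum>a\<in>UNIV. \<Sum>b\<in>UNIV. x $ b * (y $ a * (\<Sum>c\<in>UNIV. z $ c * (\<Sum>d\<in>UNIV. t $ d * f b a c d))))"
    unfolding form4_def form3_def sum_distrib_left[of "y $ _"] sum_distrib_left[of "x $ _"] by (simp add: sum_negf)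
  also have "\<dots> = - form4 f x y z t"
    unfolding form4_def form3_def sum_distrib_left[of "y $ _"] sum_distrib_left[of "x $ _"]
        by (subst sum.swap) (rule refl)
  finally show "form4 f y x z t = - form4 f x y z t" .
qed

lemmas form3_phi0_antisym = form3_antisym[of phi0, OF phi0_antisym]
lemmas form4_psi0_antisym = form4_antisym[of psi0, OF psi0_antisym]

lemma pull3_phi0_antisym:
  "pull3 L phi0 j i k = - pull3 L phi0 i j k" "pull3 L phi0 i k j = - pull3 L phi0 i j k"
  unfolding pull3_def by (rule form3_phi0_antisym)+

lemma pull4_psi0_antisym:
  "pull4 L psi0 j i k l = - pull4 L psi0 i j k l" "pull4 L psi0 i k j l = - pull4 L psi0 i j k l"
  "pull4 L psi0 i j l k = - pull4 L psi0 i j k l"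
  unfolding pull4_def by (rule form4_psi0_antisym(1), rule form4_psi0_antisym(2), rule form4_psi0_antisym(3))

lemmas form3_linear_simps =
  linear_form3[THEN linear_add] linear_form3[THEN linear_diff] linear_form3[THEN linear_scale]

lemma rot2_column:
  assumes "distinct [p, q, a, b]"
  shows "column p (rot2 p q a b c s) = c *\<^sub>R axis p 1 - s *\<^sub>R axis q 1"
    "column q (rot2 p q a b c s) = s *\<^sub>R axis p 1 + c *\<^sub>R axis q 1"
    "column a (rot2 p q a b c s) = c *\<^sub>R axis a 1 + s *\<^sub>R axis b 1"
    "column b (rot2 p q a b c s) = c *\<^sub>R axis b 1 - s *\<^sub>R axis a 1"
    "i \<noteq> p \<Longrightarrow> i \<noteq> q \<Longrightarrow> i \<noteq> a \<Longrightarrow> i \<noteq> b \<Longrightarrow> column i (rot2 p q a b c s) = axis i 1"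
  using assms by (auto simp: vec_eq_iff column_def rot2_def axis_def)

text \<open>The six tuples list two of the three complex lines \<open>p q\<close> and
  \<open>a b\<close> belonging to the fixed vectors with index 1, 1, 2, 2, 6, 3 in this order. In
  each tuple both lines have the same orientation relative to the fixed vector, so the rotation
  angles are opposite and the complex volume form is kept.\<close>

lemma pull3_rot2:
  assumes "(p, q, a, b) \<in> {(2,3,6,7), (4,5,6,7), (4,6,3,1), (5,7,1,3), (2,4,5,3), (1,2,7,4)}" and "c\<^sup>2 + s\<^sup>2 = 1"
  shows "pull3 (rot2 p q a b c s) phi0 = phi0"
proof (intro ext)
  fix i j k
  have cs: "c * c + s * s = 1" using assms(2) by (simp add: power2_eq_square)
  have all: "\<forall>i j k. idx7 i < idx7 j \<longrightarrow> idx7 j < idx7 k \<longrightarrow> pull3 (rot2 p q a b c s) phi0 i j k = phi0 i j k"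
    unfolding all_sorted3 using assms(1) unfolding insert_iff empty_iff prod.inject
    by (elim disjE conjE FalseE; simp add: phi0_table pull3_def form3_linear_simps form3_axis rot2_column neq_7
        del: eq_numeral_iff_iszero; insert cs; (simp add: algebra_simps)?)
  define Z where "Z i j k = pull3 (rot2 p q a b c s) phi0 i j k - phi0 i j k" for i j k
  have "Z j i k = - Z i j k" "Z i k j = - Z i j k" for i j k
    unfolding Z_def pull3_phi0_antisym(1)[of _ j i] phi0_antisym(1)[of j i] pull3_phi0_antisym(2)[of _ i k j]
        phi0_antisym(2)[of i k j]
    by simp_all
  moreover have "idx7 i < idx7 j \<Longrightarrow> idx7 j < idx7 k \<Longrightarrow> Z i j k = 0" for i j k
    using all unfolding Z_def by simp
  ultimately have "Z i j k = 0"
    by (rule alternating3_zeroI)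
  then show "pull3 (rot2 p q a b c s) phi0 i j k = phi0 i j k" unfolding Z_def by simp
qed

lemma rot2_mult:
  assumes "(p, q, a, b) \<in> {(2,3,6,7), (4,5,6,7), (4,6,3,1), (5,7,1,3), (2,4,5,3), (1,2,7,4)}"
  shows "(rot2 p q a b c s *v x) $ p = c * x $ p + s * x $ q" "(rot2 p q a b c s *v x) $ q = - s * x $ p + c * x $ q"
    "(rot2 p q a b c s *v x) $ a = c * x $ a - s * x $ b" "(rot2 p q a b c s *v x) $ b = s * x $ a + c * x $ b"
    "i \<noteq> p \<Longrightarrow> i \<noteq> q \<Longrightarrow> i \<noteq> a \<Longrightarrow> i \<noteq> b \<Longrightarrow> (rot2 p q a b c s *v x) $ i = x $ i"
proof -
  show "(rot2 p q a b c s *v x) $ p = c * x $ p + s * x $ q" "(rot2 p q a b c s *v x) $ q = - s * x $ p + c * x $ q"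
    "(rot2 p q a b c s *v x) $ a = c * x $ a - s * x $ b" "(rot2 p q a b c s *v x) $ b = s * x $ a + c * x $ b"
    using assms unfolding insert_iff empty_iff prod.inject
    by (elim disjE conjE FalseE; simp add: rot2_def matrix_vector_mult_def sum_7 neq_7 del: eq_numeral_iff_iszero)+
  show "i \<noteq> p \<Longrightarrow> i \<noteq> q \<Longrightarrow> i \<noteq> a \<Longrightarrow> i \<noteq> b \<Longrightarrow> (rot2 p q a b c s *v x) $ i = x $ i"
    by (simp add: rot2_def matrix_vector_mult_def sum_of_bool)
qed

lemma rot2_kill:
  assumes "(p, q, a, b) \<in> {(2,3,6,7), (4,5,6,7), (4,6,3,1), (5,7,1,3), (2,4,5,3), (1,2,7,4)}"
  obtains R where "pull3 R phi0 = phi0" "(R *v x) $ q = 0"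
    "\<And>i. i \<noteq> p \<Longrightarrow> i \<noteq> q \<Longrightarrow> i \<noteq> a \<Longrightarrow> i \<noteq> b \<Longrightarrow> (R *v x) $ i = x $ i"
    "x $ a = 0 \<Longrightarrow> x $ b = 0 \<Longrightarrow> (R *v x) $ a = 0 \<and> (R *v x) $ b = 0"
proof -
  obtain c s where cs: "c\<^sup>2 + s\<^sup>2 = 1" "- s * x $ p + c * x $ q = 0"
  proof (cases "(x $ p)\<^sup>2 + (x $ q)\<^sup>2 = 0")
    case True
    then show ?thesis using that[of 1 0] by (simp add: sum_power2_eq_zero_iff)
  next
    case False
    define n where "n = sqrt ((x $ p)\<^sup>2 + (x $ q)\<^sup>2)"
    have n: "n\<^sup>2 = (x $ p)\<^sup>2 + (x $ q)\<^sup>2" "n \<noteq> 0" using False by (simp_all add: n_def)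
    show ?thesis
    proof (rule that[of "x $ p / n" "x $ q / n"])
      show "(x $ p / n)\<^sup>2 + (x $ q / n)\<^sup>2 = 1"
        unfolding power_divide add_divide_distrib[symmetric] n(1)[symmetric] using n(2) by simp
    qed simp
  qed
  show ?thesis
    by (rule that[of "rot2 p q a b c s"]) (use pull3_rot2[OF assms cs(1)] rot2_mult[OF assms,
        where c = c and s = s and x = x] cs(2) in simp_all)
qed

lemma G2_transitive:
  obtains R r where "pull3 R phi0 = phi0" "R *v x = r *\<^sub>R axis 1 1"
proof -
  define reach where "reach y \<longleftrightarrow> (\<exists>R. pull3 R phi0 = phi0 \<and> R *v x = y)" for y
  have step: "\<exists>z. reach z \<and> z $ q = 0 \<and> (\<forall>i. i \<noteq> p \<and> i \<noteq> q \<and> i \<noteq> a \<and> i \<noteq> b \<longrightarrow> z $ i = y $ i)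
      \<and> (y $ a = 0 \<and> y $ b = 0 \<longrightarrow> z $ a = 0 \<and> z $ b = 0)"
    if y: "reach y" and tup: "(p, q, a, b) \<in> {(2,3,6,7), (4,5,6,7), (4,6,3,1), (5,7,1,3), (2,4,5,3), (1,2,7,4)}"
        for y p q a b
  proof -
    obtain R0 where R0: "pull3 R0 phi0 = phi0" "R0 *v x = y" using y unfolding reach_def by blast
    obtain R where R: "pull3 R phi0 = phi0" "(R *v y) $ q = 0"
      "\<And>i. i \<noteq> p \<Longrightarrow> i \<noteq> q \<Longrightarrow> i \<noteq> a \<Longrightarrow> i \<noteq> b \<Longrightarrow> (R *v y) $ i = y $ i"
      "y $ a = 0 \<Longrightarrow> y $ b = 0 \<Longrightarrow> (R *v y) $ a = 0 \<and> (R *v y) $ b = 0"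
      using rot2_kill[OF tup, of y] by metis
    have "pull3 (R ** R0) phi0 = phi0" unfolding pull3_pull3[symmetric] R(1) R0(1) ..
    then have "reach (R *v y)" unfolding reach_def using R0(2) by (metis matrix_vector_mul_assoc)
    then show ?thesis using R by blast
  qed
  have "pull3 (mat 1) phi0 = phi0"
    by (intro ext) (simp add: pull3_def column_def mat_def form3_axis[unfolded axis_def])
  then have y0: "reach x" unfolding reach_def using matrix_vector_mul_lid by blast
  obtain y1 where y1: "reach y1" "y1 $ 3 = 0" using step[OF y0, of 2 3 6 7] by auto
  obtain y2 where y2: "reach y2" "y2 $ 5 = 0" using step[OF y1(1), of 4 5 6 7] by auto
  obtain y3 where y3: "reach y3" "y3 $ 6 = 0" using step[OF y2(1), of 4 6 3 1] by auto
  obtain y4 where y4: "reach y4" "y4 $ 7 = 0" "y4 $ 6 = 0"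
  proof -
    obtain z where z: "reach z" "z $ 7 = 0" "\<forall>i. i \<noteq> 5 \<and> i \<noteq> 7 \<and> i \<noteq> 1 \<and> i \<noteq> 3 \<longrightarrow> z $ i = y3 $ i"
      using step[OF y3(1), of 5 7 1 3] by blast
    then have "z $ 6 = 0" using y3(2) by simp
    then show ?thesis using z that by blast
  qed
  \<comment> \<open>From here on the second pair \<open>a b\<close> of each rotation consists of
    coordinates that are already zero and stay so. Hence coordinates 3, 5, 4, 2 can be removed in
    this order without losing earlier zeros.\<close>
  obtain y5 where y5: "reach y5" "y5 $ 3 = 0" "y5 $ 6 = 0" "y5 $ 7 = 0"
    using step[OF y4(1), of 2 3 6 7] y4(2,3) by auto
  obtain y6 where y6: "reach y6" "y6 $ 5 = 0" "y6 $ 3 = 0" "y6 $ 6 = 0" "y6 $ 7 = 0"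
    using step[OF y5(1), of 4 5 6 7] y5(2-) by auto
  obtain y7 where y7: "reach y7" "y7 $ 4 = 0" "y7 $ 5 = 0" "y7 $ 3 = 0" "y7 $ 6 = 0" "y7 $ 7 = 0"
    using step[OF y6(1), of 2 4 5 3] y6(2-) by auto
  obtain y8 where y8: "reach y8" "y8 $ 2 = 0" "y8 $ 4 = 0" "y8 $ 5 = 0" "y8 $ 3 = 0" "y8 $ 6 = 0" "y8 $ 7 = 0"
    using step[OF y7(1), of 1 2 7 4] y7(2-) by auto
  have "y8 = (y8 $ 1) *\<^sub>R axis 1 1"
    unfolding vec_eq_iff forall_7 using y8(2-) by (simp add: axis_def)
  then show ?thesis using y8(1) that unfolding reach_def by metis
qed

section \<open>The deformed 3-form at a point\<close>

text \<open>The wedge product of a 1-form and a 3-form. The argument type is left open so that it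
  applies to basis indices and to vectors.\<close>

definition wedge13 :: "('a \<Rightarrow> real) \<Rightarrow> ('a \<Rightarrow> 'a \<Rightarrow> 'a \<Rightarrow> real) \<Rightarrow> 'a \<Rightarrow> 'a \<Rightarrow> 'a \<Rightarrow> 'a \<Rightarrow> real" where
  "wedge13 e f x y z t = e x * f y z t - e y * f x z t + e z * f x y t - e t * f x y z"

definition phi0_deformed :: "real \<Rightarrow> 7 \<Rightarrow> 7 \<Rightarrow> 7 \<Rightarrow> real" where
  "phi0_deformed r i j k = phi0 i j k + r * psi0 i j k 1"

text \<open>In the complex coordinates on the complement of \<open>e\<^sub>1\<close>, the deformation multiplies the complex volume
  form by \<open>1 - i r\<close>. The linear map realises this by rotating only the line spanned by \<open>e\<^sub>2\<close> and \<open>e\<^sub>3\<close>, with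
  \<open>k ^ 3 = 1 + r\<^sup>2\<close>.\<close>

definition stretch :: "real \<Rightarrow> real \<Rightarrow> real^7^7" where
  "stretch k r = (\<chi> i j. if i = 1 \<and> j = 1 \<or> i = 2 \<and> j = 2 \<or> i = 3 \<and> j = 3 then 1 / k
     else if i = 2 \<and> j = 3 then r / k else if i = 3 \<and> j = 2 then - r / k
     else of_bool (i = j) * sqrt k)"

lemma stretch_column:
  "column 1 (stretch k r) = (1 / k) *\<^sub>R axis 1 1"
  "column 2 (stretch k r) = (1 / k) *\<^sub>R axis 2 1 - (r / k) *\<^sub>R axis 3 1"
  "column 3 (stretch k r) = (r / k) *\<^sub>R axis 2 1 + (1 / k) *\<^sub>R axis 3 1"
  "column 4 (stretch k r) = sqrt k *\<^sub>R axis 4 1" "column 5 (stretch k r) = sqrt k *\<^sub>R axis 5 1"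
  "column 6 (stretch k r) = sqrt k *\<^sub>R axis 6 1" "column 7 (stretch k r) = sqrt k *\<^sub>R axis 7 1"
  by (auto simp: vec_eq_iff column_def stretch_def axis_def)

lemmas form4_linear_simps =
  linear_form4[THEN linear_add] linear_form4[THEN linear_diff] linear_form4[THEN linear_scale]

lemma phi0_deformed_antisym: "phi0_deformed r j i k = - phi0_deformed r i j k" "phi0_deformed r i k j =
    - phi0_deformed r i j k"
  unfolding phi0_deformed_def phi0_antisym(1)[of j i] phi0_antisym(2)[of i k j] psi0_antisym(1)[of j i]
      psi0_antisym(2)[of i k j]
  by simp_all

text \<open>Since \<open>(1 + r\<^sup>2) / k\<^sup>2 = k\<close>, lengths in all three complex lines
  are scaled by \<open>sqrt k\<close>. The Kaehler form therefore gains the factor \<open>k\<close>,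
  which the factor \<open>1 / k\<close> on \<open>e\<^sub>1\<close> cancels, and the complex volume
  form gains \<open>k\<close> times \<open>(1 - i r) / k\<close>.\<close>

lemma pull3_stretch:
  assumes k: "k > 0" "k ^ 3 = 1 + r\<^sup>2"
  shows "pull3 (stretch k r) phi0 = phi0_deformed r"
proof (intro ext)
  fix i j l
  have kr: "k * (k * k) = 1 + r * r" and nz: "k \<noteq> 0" "1 + r * r \<noteq> 0"
    using k by (simp_all add: power2_eq_square power3_eq_cube mult.assoc add_pos_nonneg less_imp_neq[symmetric])
  have all: "\<forall>i j l. idx7 i < idx7 j \<longrightarrow> idx7 j < idx7 l \<longrightarrow> pull3 (stretch k r) phi0 i j l = phi0_deformed r i j l"
    unfolding all_sorted3
    by (simp add: phi0_table psi0_table phi0_deformed_def pull3_def form3_linear_simps form3_axis stretch_column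
        neq_7 del: eq_numeral_iff_iszero)
      (insert kr nz k, simp add: field_simps)
  define Z where "Z i j l = pull3 (stretch k r) phi0 i j l - phi0_deformed r i j l" for i j l
  have "Z j i l = - Z i j l" "Z i l j = - Z i j l" for i j l
    unfolding Z_def pull3_phi0_antisym(1)[of _ j i] phi0_deformed_antisym(1)[of _ j i] pull3_phi0_antisym(2)[of _ i
        l j] phi0_deformed_antisym(2)[of _ i l j]
    by simp_all
  moreover have "idx7 i < idx7 j \<Longrightarrow> idx7 j < idx7 l \<Longrightarrow> Z i j l = 0" for i j l
    using all unfolding Z_def by simp
  ultimately have "Z i j l = 0"
    by (rule alternating3_zeroI)
  then show "pull3 (stretch k r) phi0 i j l = phi0_deformed r i j l" unfolding Z_def by simp
qed

lemma wedge13_antisym: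
  assumes "\<And>x y z. f y x z = - f x y z" "\<And>x y z. f x z y = - f x y z"
  shows "wedge13 e f y x z t = - wedge13 e f x y z t" "wedge13 e f x z y t = - wedge13 e f x y z t"
    "wedge13 e f x y t z = - wedge13 e f x y z t"
  unfolding wedge13_def assms(1)[of y x] assms(1)[of z y] assms(2)[of _ z y] assms(2)[of _ t z]
  by (simp_all add: algebra_simps)

lemma pull4_stretch:
  assumes k: "k > 0" "k ^ 3 = 1 + r\<^sup>2"
  shows "pull4 (stretch k r) psi0 i j l m =
    ((1 + r\<^sup>2) * psi0 i j l m + wedge13 (\<lambda>i. r * of_bool (i = 1)) (phi0_deformed r) i j l m) / k"
proof -
  have kr: "k * (k * k) = 1 + r * r" and nz: "k \<noteq> 0" "1 + r * r \<noteq> 0"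
    using k by (simp_all add: power2_eq_square power3_eq_cube mult.assoc add_pos_nonneg less_imp_neq[symmetric])
  define P where "P i j l m = ((1 + r\<^sup>2) * psi0 i j l m + wedge13 (\<lambda>i. r * of_bool (i
      = 1)) (phi0_deformed r) i j l m) / k" for i j l m
  have all: "\<forall>i j l m. idx7 i < idx7 j \<longrightarrow> idx7 j < idx7 l \<longrightarrow> idx7 l < idx7 m
      \<longrightarrow> pull4 (stretch k r) psi0 i j l m = P i j l m"
    unfolding all_sorted4
    by (simp add: psi0_table phi0_table P_def wedge13_def phi0_deformed_def pull4_def form4_linear_simps form4_axis
        stretch_column neq_7 del: eq_numeral_iff_iszero)
      (insert kr nz k, simp add: field_simps power2_eq_square)
  define Z where "Z i j l m = pull4 (stretch k r) psi0 i j l m - P i j l m" for i j l m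
  have w: "wedge13 e (phi0_deformed r) j i l m = - wedge13 e (phi0_deformed r) i j l m"
     "wedge13 e (phi0_deformed r) i l j m = - wedge13 e (phi0_deformed r) i j l m"
     "wedge13 e (phi0_deformed r) i j m l = - wedge13 e (phi0_deformed r) i j l m" for e i j l m
    by (rule wedge13_antisym; rule phi0_deformed_antisym)+
  have "Z j i l m = - Z i j l m" "Z i l j m = - Z i j l m" "Z i j m l = - Z i j l m" for i j l m
    unfolding Z_def P_def pull4_psi0_antisym(1)[of _ j i] psi0_antisym(1)[of j i] w(1)[of _ j i]
      pull4_psi0_antisym(2)[of _ i l j] psi0_antisym(2)[of i l j] w(2)[of _ i l j]
      pull4_psi0_antisym(3)[of _ i j m l] psi0_antisym(3)[of i j m l] w(3)[of _ i j m l]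
    by (simp_all add: divide_inverse algebra_simps)
  moreover have "idx7 i < idx7 j \<Longrightarrow> idx7 j < idx7 l \<Longrightarrow> idx7 l < idx7 m \<Longrightarrow> Z i j l m = 0" for i j l m
    using all unfolding Z_def by simp
  ultimately have "Z i j l m = 0"
    by (rule alternating4_zeroI)
  then show ?thesis unfolding Z_def P_def by simp
qed

lemma linear_wedge13:
  assumes "linear e" "\<And>y z. linear (\<lambda>x. f x y z)" "\<And>x z. linear (\<lambda>y. f x y z)" "\<And>x y. linear (\<lambda>z. f x y z)"
  shows "linear (\<lambda>x. wedge13 e f x y z t)" "linear (\<lambda>y. wedge13 e f x y z t)"
    "linear (\<lambda>z. wedge13 e f x y z t)" "linear (\<lambda>t. wedge13 e f x y z t)"
  unfolding wedge13_def
  by (intro linear_compose_add linear_compose_sub linear_mult_const assms)+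

lemma form4_pull4_stretch:
  assumes k: "k > 0" "k ^ 3 = 1 + r\<^sup>2"
  shows "form4 (pull4 (stretch k r) psi0) x y z t =
    ((1 + r\<^sup>2) * form4 psi0 x y z t + wedge13 (\<lambda>x. r * x $ 1) (form3 (phi0_deformed r)) x y z t) / k"
    (is "_ = ?W x y z t")
proof -
  have "linear (\<lambda>x::real^7. x $ 1)" by (simp add: linear_iff)
  then have e: "linear (\<lambda>x::real^7. r * x $ 1)" by (rule linear_mult_const)
  have "?W x y z t = form4 (\<lambda>a b c d. ?W (axis a 1) (axis b 1) (axis c 1) (axis d 1)) x y z t"
    unfolding divide_inverse
    by (rule quadrilinear_eq_form4; intro linear_mult_const linear_compose_add linear_form4 linear_wedge13 e
        linear_form3)
  also have "(\<lambda>a b c d. ?W (axis a 1) (axis b 1) (axis c 1) (axis d 1)) = pull4 (stretch k r) psi0"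
    unfolding fun_eq_iff pull4_stretch[OF assms] form4_axis wedge13_def form3_axis axis_nth_of_bool by simp
  finally show ?thesis ..
qed

text \<open>The map from \<open>G2_transitive\<close> preserves \<open>phi0\<close>, so composing
  with it aligns \<open>v\<close> with \<open>e\<^sub>1\<close> and leaves the pulled-back form
  unchanged. Metric, volume and dual then follow from their uniqueness.\<close>

lemma G2_adapted:
  assumes "positive3 f" "vol\<^sup>2 = det G" "\<And>u. u \<noteq> 0 \<Longrightarrow> u \<bullet> (G *v u) > 0"
    and "\<And>u w. (u \<bullet> (G *v w)) * vol = wedge223 (interior3 u f) (interior3 w f) f / 6"
  obtains L r where "f = pull3 L phi0" "G = transpose L ** L" "hodge3 G vol f = pull4 L psi0" "invertible L"
    "vol = det L" "L *v v = r *\<^sub>R axis 1 1"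
proof -
  obtain L0 where L0: "f = pull3 L0 phi0" using assms(1) unfolding positive3_iff_pull3 by blast
  obtain R r where R: "pull3 R phi0 = phi0" "R *v (L0 *v v) = r *\<^sub>R axis 1 1" using G2_transitive .
  define L where "L = R ** L0"
  have f: "f = pull3 L phi0" unfolding L_def pull3_pull3[symmetric] R(1) L0 ..
  have "invertible G" by (rule invertible_if_positive) (rule assms(3))
  then have "vol \<noteq> 0" using assms(2) by (auto simp: invertible_det_nz)
  note G = metric_volume_unique[OF assms(4,2) f this]
  have L: "invertible L" using \<open>vol \<noteq> 0\<close> unfolding G(2) invertible_det_nz .
  show ?thesis
    using that[OF f G(1) _ L G(2)] hodge3_pull3[OF L] R(2) unfolding f G
    by (simp add: L_def matrix_vector_mul_assoc)
qed

text \<open>In the adapted frame \<open>f'\<close> is the pull-back of \<open>phi0\<close> by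
  \<open>stretch k r ** L\<close>. By \<open>metric_volume_unique\<close> this map also determines
  \<open>G'\<close> and \<open>vol'\<close>, so naturality of the Hodge star applies a second
  time.\<close>

lemma deformed_hodge:
  assumes f: "f = pull3 L phi0" "G = transpose L ** L" "hodge3 G vol f = pull4 L psi0" "L *v v = r *\<^sub>R axis 1 1"
    and f': "f' = (\<lambda>b c d. f b c d + (\<Sum>e\<in>UNIV. v $ e * hodge3 G vol f b c d e))"
    and G': "vol'\<^sup>2 = det G'" "\<And>u. u \<noteq> 0 \<Longrightarrow> u \<bullet> (G' *v u) > 0"
      "\<And>u w. (u \<bullet> (G' *v w)) * vol' = wedge223 (interior3 u f') (interior3 w f') f' / 6"
  shows "form4 (hodge3 G' vol' f') x y z t =
    ((1 + v \<bullet> (G *v v)) * form4 (hodge3 G vol f) x y z t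
        + wedge13 (\<lambda>x. v \<bullet> (G *v x)) (form3 f') x y z t) / root 3 (1 + v \<bullet> (G *v v))"
proof -
  have vG: "v \<bullet> (G *v x) = r * (L *v x) $ 1" for x
  proof -
    have "v \<bullet> (G *v x) = (L *v v) \<bullet> (L *v x)"
      unfolding f(2) by (rule inner_transpose_mult)
    then show ?thesis unfolding f(4) by (simp add: inner_axis')
  qed
  then have h: "1 + v \<bullet> (G *v v) = 1 + r\<^sup>2" unfolding vG f(4) by (simp add: power2_eq_square)
  define k where "k = root 3 (1 + r\<^sup>2)"
  have k: "k > 0" "k ^ 3 = 1 + r\<^sup>2" unfolding k_def by (simp_all add: add_pos_nonneg)
  have "f' b c d = pull3 L (phi0_deformed r) b c d" for b c d
  proof -
    have "(\<Sum>e\<in>UNIV. v $ e * hodge3 G vol f b c d e) = form4 (pull4 L psi0) (axis b 1) (axis c 1) (axis d 1) v"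
      unfolding linear_sum_axis[OF linear_form4(4), of _ _ _ _ v] form4_axis f(3) ..
    also have "\<dots> = r * form4 psi0 (column b L) (column c L) (column d L) (axis 1 1)"
      unfolding form4_pull4 f(4) by (simp add: form4_linear_simps matrix_vector_mult_basis)
    finally show ?thesis
      unfolding f' f(1) pull3_def phi0_deformed_def form3_def form4_def axis_nth_of_bool sum_of_bool
      by (simp add: algebra_simps sum.distrib sum_distrib_left)
  qed
  then have f'': "f' = pull3 L (phi0_deformed r)" by blast
  then have f3: "f' = pull3 (stretch k r ** L) phi0"
    unfolding pull3_stretch[OF k, symmetric] pull3_pull3 .
  have "invertible G'" by (rule invertible_if_positive) (rule G'(2))
  then have "vol' \<noteq> 0" using G'(1) by (auto simp: invertible_det_nz)
  note G3 = metric_volume_unique[OF G'(3,1) f3 this]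
  have "invertible (stretch k r ** L)" using \<open>vol' \<noteq> 0\<close> unfolding G3(2) invertible_det_nz .
  note H = hodge3_pull3[OF this]
  show ?thesis
    unfolding G3 unfolding f3 H unfolding pull4_pull4[symmetric] form4_pull4[of L] form4_pull4_stretch[OF k]
    unfolding h unfolding k_def[symmetric] f(3) form4_pull4[of L] wedge13_def vG f3[symmetric] f'' form3_pull3 ..
qed

section \<open>Second derivatives\<close>

abbreviation second_difference :: "('a::real_normed_vector \<Rightarrow> real) \<Rightarrow> 'a \<Rightarrow> 'a \<Rightarrow> 'a \<Rightarrow> real \<Rightarrow> real" where
  "second_difference f q x y t \<equiv> f (q + t *\<^sub>R x + t *\<^sub>R y) - f (q + t *\<^sub>R x) - f (q + t *\<^sub>R y) + f q"

text \<open>The mean value theorem along \<open>x\<close>, applied to the difference of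
  \<open>f\<close> in direction \<open>y\<close>, leaves a difference of two values of the
  derivative in direction \<open>x\<close>. Hence only that one derivative has to be differentiable,
  and only at \<open>q\<close>.\<close>

lemma mixed_second_difference:
  fixes f :: "'a::real_normed_vector \<Rightarrow> real"
  assumes S: "open S" "q \<in> S" and f: "\<And>p. p \<in> S \<Longrightarrow> (f has_derivative f' p) (at p)"
    and D: "((\<lambda>p. f' p x) has_derivative D) (at q)"
  shows "((\<lambda>t. second_difference f q x y t / t\<^sup>2) \<longlongrightarrow> D y) (at_right 0)"
proof (rule tendstoI)
  fix e :: real assume e: "e > 0"
  \<comment> \<open>Two error terms arise, each at most
    \<open>(e / c) * t * (norm x + norm y)\<close>; the summand 1 makes \<open>c\<close> positive
    and the final estimate strict.\<close>
  define c where "c = 2 * (norm x + norm y) + 1"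
  have c: "c > 0" unfolding c_def by (intro add_nonneg_pos) auto
  have lin: "linear D" using D has_derivative_linear by blast
  obtain d1 where d1: "d1 > 0" and est: "\<And>p. norm (p - q) < d1 \<Longrightarrow> \<bar>f' p x - f' q x - D (p - q)\<bar> \<le> (e / c) * norm (p - q)"
    using D e c unfolding has_derivative_at_alt real_norm_def by (meson divide_pos_pos)
  obtain d2 where d2: "d2 > 0" "ball q d2 \<subseteq> S" using S openE by blast
  define d where "d = min d1 d2 / c"
  have d: "d > 0" unfolding d_def using d1 d2 c by simp
  have "dist (second_difference f q x y t / t\<^sup>2) (D y) < e" if t: "0 < t" "t < d" for t
  proof -
    define \<psi> where "\<psi> s = f (q + s *\<^sub>R x + t *\<^sub>R y) - f (q + s *\<^sub>R x)" for s
    have small: "norm (s *\<^sub>R x + u *\<^sub>R y) \<le> t * (norm x + norm y)" if "0 \<le> s" "s \<le> t" "0 \<le> u" "u \<le> t" for s u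
    proof -
      have "norm (s *\<^sub>R x + u *\<^sub>R y) \<le> s * norm x + u * norm y"
        using norm_triangle_ineq[of "s *\<^sub>R x" "u *\<^sub>R y"] that by simp
      also have "\<dots> \<le> t * norm x + t * norm y"
        using that by (intro add_mono mult_right_mono) auto
      finally show ?thesis by (simp add: algebra_simps)
    qed
    have tc: "t * (norm x + norm y) < min d1 d2"
    proof -
      have "t * (norm x + norm y) \<le> t * c" unfolding c_def using t
          by (intro mult_left_mono) (auto simp: add_nonneg_nonneg)
      also have "\<dots> < min d1 d2" using t(2) c unfolding d_def by (simp add: field_simps)
      finally show ?thesis .
    qed
    have inS: "q + s *\<^sub>R x + u *\<^sub>R y \<in> S" if "0 \<le> s" "s \<le> t" "0 \<le> u" "u \<le> t" for s u
    proof -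
      have "dist q (q + s *\<^sub>R x + u *\<^sub>R y) = norm (s *\<^sub>R x + u *\<^sub>R y)"
        by (metis add.assoc add_diff_cancel_left' dist_norm dist_commute)
      then show ?thesis using small[OF that] tc d2(2) by (auto simp: subset_iff)
    qed
    have der: "(\<psi> has_real_derivative f' (q + s *\<^sub>R x + t *\<^sub>R y) x - f' (q + s *\<^sub>R x) x) (at s)" if s: "0 \<le> s" "s
        \<le> t" for s
    proof -
      have "((\<lambda>s. f (q + s *\<^sub>R x + u *\<^sub>R y)) has_real_derivative f' (q + s *\<^sub>R x + u *\<^sub>R y) x) (at s)"
          if "0 \<le> u" "u \<le> t" for u
      proof -
        have 1: "((\<lambda>s. q + s *\<^sub>R x + u *\<^sub>R y) has_derivative (\<lambda>h. h *\<^sub>R x)) (at s)"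
          by (auto intro!: derivative_eq_intros)
        have "((\<lambda>s. f (q + s *\<^sub>R x + u *\<^sub>R y)) has_derivative (\<lambda>h. f' (q + s *\<^sub>R x + u *\<^sub>R y) (h *\<^sub>R x))) (at s)"
          using has_derivative_compose[OF 1 f[OF inS[OF s that]]] .
        moreover have "linear (f' (q + s *\<^sub>R x + u *\<^sub>R y))"
          using f[OF inS[OF s that]] has_derivative_linear by blast
        ultimately show ?thesis
          unfolding has_field_derivative_def by (simp add: linear_scale mult_commute_abs)
      qed
      from DERIV_diff[OF this[of t] this[of 0]] show ?thesis using t unfolding \<psi>_def by simp
    qed
    obtain s where s: "0 < s" "s < t" "\<psi> t - \<psi> 0 = (t - 0) * (f' (q + s *\<^sub>R x + t *\<^sub>R y) x - f' (q + s *\<^sub>R x) x)"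
      using MVT2[of 0 t \<psi> "\<lambda>s. f' (q + s *\<^sub>R x + t *\<^sub>R y) x - f' (q + s *\<^sub>R x) x"] der t by auto
    have b1: "\<bar>f' (q + s *\<^sub>R x + t *\<^sub>R y) x - f' q x - (s * D x + t * D y)\<bar> \<le> (e / c) * (t * (norm x + norm y))"
    proof -
      have n: "norm (q + s *\<^sub>R x + t *\<^sub>R y - q) \<le> t * (norm x + norm y)" using small[of s t] s t
          by (simp add: algebra_simps)
      have "\<bar>f' (q + s *\<^sub>R x + t *\<^sub>R y) x - f' q x - D (q + s *\<^sub>R x + t *\<^sub>R y - q)\<bar> \<le> (e / c) * norm (q + s *\<^sub>R x
          + t *\<^sub>R y - q)"
      proof (rule est)
        show "norm (q + s *\<^sub>R x + t *\<^sub>R y - q) < d1" using n tc by linarith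
      qed
      also have "\<dots> \<le> (e / c) * (t * (norm x + norm y))" using n e c by (intro mult_left_mono) auto
      also have "D (q + s *\<^sub>R x + t *\<^sub>R y - q) = s * D x + t * D y"
      proof -
        have "q + s *\<^sub>R x + t *\<^sub>R y - q = s *\<^sub>R x + t *\<^sub>R y" by simp
        then show ?thesis by (simp only: linear_add[OF lin] linear_scale[OF lin] real_scaleR_def)
      qed
      finally show ?thesis .
    qed
    have b2: "\<bar>f' (q + s *\<^sub>R x) x - f' q x - s * D x\<bar> \<le> (e / c) * (t * (norm x + norm y))"
    proof -
      have n: "norm (q + s *\<^sub>R x - q) \<le> t * (norm x + norm y)" using small[of s 0] s t by simp
      have "\<bar>f' (q + s *\<^sub>R x) x - f' q x - D (q + s *\<^sub>R x - q)\<bar> \<le> (e / c) * norm (q + s *\<^sub>R x - q)"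
      proof (rule est)
        show "norm (q + s *\<^sub>R x - q) < d1" using n tc by linarith
      qed
      also have "\<dots> \<le> (e / c) * (t * (norm x + norm y))" using n e c by (intro mult_left_mono) auto
      also have "D (q + s *\<^sub>R x - q) = s * D x" by (simp add: linear_scale[OF lin])
      finally show ?thesis .
    qed
    have "\<bar>(f' (q + s *\<^sub>R x + t *\<^sub>R y) x - f' (q + s *\<^sub>R x) x) - t * D y\<bar> \<le> 2 * ((e / c) * (t * (norm x + norm y)))"
      using b1 b2 by linarith
    also have "\<dots> = t * (e * (2 * (norm x + norm y) / c))" by simp
    also have "\<dots> < t * e"
      using t e c unfolding c_def by (intro mult_strict_left_mono) (auto simp: field_simps)
    finally have *: "\<bar>(f' (q + s *\<^sub>R x + t *\<^sub>R y) x - f' (q + s *\<^sub>R x) x) - t * D y\<bar> < t * e" .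
    have e: "second_difference f q x y t =
        t * (f' (q + s *\<^sub>R x + t *\<^sub>R y) x - f' (q + s *\<^sub>R x) x)"
      using s(3) unfolding \<psi>_def by simp
    have "second_difference f q x y t / t\<^sup>2 - D y
        = ((f' (q + s *\<^sub>R x + t *\<^sub>R y) x - f' (q + s *\<^sub>R x) x) - t * D y) / t"
      unfolding e using t by (simp add: field_simps power2_eq_square)
    moreover have "\<bar>((f' (q + s *\<^sub>R x + t *\<^sub>R y) x - f' (q + s *\<^sub>R x) x) - t * D y) / t\<bar> < e"
      using * t by (simp add: abs_divide pos_divide_less_eq mult.commute)
    ultimately show ?thesis
      unfolding dist_real_def by metis
  qed
  then show "\<forall>\<^sub>F t in at_right 0. dist (second_difference f q x y t / t\<^sup>2) (D y) < e"
    unfolding eventually_at_right_field using d by blast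
qed

text \<open>The second difference is symmetric in \<open>x\<close> and \<open>y\<close>, so both
  iterated derivatives are its limit. This is the source of every use of
  \<open>d(d\<omega>) = 0\<close>.\<close>

lemma second_derivative_symmetric:
  fixes f :: "'a::real_normed_vector \<Rightarrow> real"
  assumes "open S" "q \<in> S" "\<And>p. p \<in> S \<Longrightarrow> (f has_derivative f' p) (at p)"
    and "((\<lambda>p. f' p x) has_derivative D1) (at q)" "((\<lambda>p. f' p y) has_derivative D2) (at q)"
  shows "D1 y = D2 x"
proof (rule tendsto_unique[OF trivial_limit_at_right_real])
  show "((\<lambda>t. second_difference f q x y t / t\<^sup>2) \<longlongrightarrow> D1 y) (at_right 0)"
    by (rule mixed_second_difference[OF assms(1-4)])
  have "(\<lambda>t. second_difference f q y x t / t\<^sup>2) =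
    (\<lambda>t. second_difference f q x y t / t\<^sup>2)"
    by (simp add: algebra_simps)
  then show "((\<lambda>t. second_difference f q x y t / t\<^sup>2) \<longlongrightarrow> D2 x) (at_right 0)"
    using mixed_second_difference[OF assms(1-3,5), of x] by simp
qed

definition twice_differentiable_on :: "('a::real_normed_vector) set \<Rightarrow> ('a \<Rightarrow> real) \<Rightarrow> bool" where
  "twice_differentiable_on S f \<longleftrightarrow> (\<exists>f'. \<forall>p\<in>S. (f has_derivative f' p) (at p) \<and> (\<forall>x. (\<lambda>p. f' p x) differentiable (at p)))"

lemma twice_differentiable_onD:
  assumes "twice_differentiable_on S f" "open S" "q \<in> S" "\<And>p. p \<in> S \<Longrightarrow> (f has_derivative f' p) (at p)"
  shows "(\<lambda>p. f' p x) differentiable (at q)"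
proof -
  obtain f'' where f'': "\<And>p. p \<in> S \<Longrightarrow> (f has_derivative f'' p) (at p)" "\<And>p x. p \<in> S
      \<Longrightarrow> (\<lambda>p. f'' p x) differentiable (at p)"
    using assms(1) unfolding twice_differentiable_on_def by blast
  then have "f'' p = f' p" if "p \<in> S" for p using assms(4) that has_derivative_unique by blast
  then show ?thesis
    using f''(2)[OF assms(3), of x] has_derivative_transform_within_open[OF _ assms(2,3), of "\<lambda>p. f'' p x" _ UNIV
        "\<lambda>p. f' p x"]
    unfolding differentiable_def by metis
qed

lemma twice_differentiable_on_const: "twice_differentiable_on S (\<lambda>_. c)"
  unfolding twice_differentiable_on_def by (intro exI[of _ "\<lambda>_ _. 0"]) simp

lemma twice_differentiable_on_mult:
  assumes "twice_differentiable_on S f" "twice_differentiable_on S h"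
  shows "twice_differentiable_on S (\<lambda>p. f p * h p)"
proof -
  obtain f' h' where *: "\<And>p. p \<in> S \<Longrightarrow> (f has_derivative f' p) (at p)" "\<And>p x. p \<in> S \<Longrightarrow> (\<lambda>p. f' p x) differentiable (at p)"
    "\<And>p. p \<in> S \<Longrightarrow> (h has_derivative h' p) (at p)" "\<And>p x. p \<in> S \<Longrightarrow> (\<lambda>p. h' p x) differentiable (at p)"
    using assms unfolding twice_differentiable_on_def by metis
  show ?thesis
    unfolding twice_differentiable_on_def
  proof (intro exI ballI conjI allI)
    fix p x assume p: "p \<in> S"
    show "((\<lambda>p. f p * h p) has_derivative (\<lambda>x. f p * h' p x + f' p x * h p)) (at p)"
      by (rule has_derivative_mult) (use * p in auto)
    show "(\<lambda>p. f p * h' p x + f' p x * h p) differentiable (at p)"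
    proof -
      have "f differentiable (at p)" "h differentiable (at p)"
        using *(1,3)[OF p] unfolding differentiable_def by blast+
      then show ?thesis by (intro differentiable_add differentiable_mult *(2)[OF p] *(4)[OF p])
    qed
  qed
qed

lemma twice_differentiable_on_sum:
  assumes "finite I" "\<And>i. i \<in> I \<Longrightarrow> twice_differentiable_on S (f i)"
  shows "twice_differentiable_on S (\<lambda>p. \<Sum>i\<in>I. f i p)"
proof -
  obtain f' where *: "\<And>i p. i \<in> I \<Longrightarrow> p \<in> S \<Longrightarrow> (f i has_derivative f' i p) (at p)" "\<And>i p x. i \<in> I \<Longrightarrow> p \<in> S
      \<Longrightarrow> (\<lambda>p. f' i p x) differentiable (at p)"
    using assms(2) unfolding twice_differentiable_on_def by metis
  show ?thesis
    unfolding twice_differentiable_on_def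
  proof (intro exI ballI conjI allI)
    fix p x assume p: "p \<in> S"
    show "((\<lambda>p. \<Sum>i\<in>I. f i p) has_derivative (\<lambda>x. \<Sum>i\<in>I. f' i p x)) (at p)"
      by (rule has_derivative_sum) (use * p in auto)
    show "(\<lambda>p. \<Sum>i\<in>I. f' i p x) differentiable (at p)"
      using * p assms(1) by (intro differentiable_sum) auto
  qed
qed

lemma frechet_derivative_partial:
  assumes "f differentiable (at q)"
  shows "frechet_derivative f (at q) x = (\<Sum>a\<in>UNIV. x $ a * partial a f q)"
  unfolding partial_def
  by (rule linear_sum_axis) (use assms linear_frechet_derivative in blast)

lemma smooth_on_differentiable: "smooth_on S f \<Longrightarrow> q \<in> S \<Longrightarrow> f differentiable (at q)"
  unfolding smooth_on_def by (metis C_k_on.simps(2))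

lemma smooth_on_has_derivative:
  "smooth_on S f \<Longrightarrow> q \<in> S \<Longrightarrow> (f has_derivative (\<lambda>x. \<Sum>a\<in>UNIV. x $ a * partial a f q)) (at q)"
  using smooth_on_differentiable frechet_derivative_partial frechet_derivative_works by (metis (no_types, lifting) ext)

lemma smooth_on_partial: "smooth_on S f \<Longrightarrow> smooth_on S (partial a f)"
  unfolding smooth_on_def by (metis C_k_on.simps(2))

lemma smooth_on_twice_differentiable: "smooth_on S f \<Longrightarrow> twice_differentiable_on S f"
  unfolding twice_differentiable_on_def
  by (intro exI[of _ "\<lambda>q x. \<Sum>a\<in>UNIV. x $ a * partial a f q"] ballI conjI allI smooth_on_has_derivative
      differentiable_sum differentiable_mult)
    (auto intro: smooth_on_differentiable smooth_on_partial)

lemma differentiable_det: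
  fixes A :: "'a::real_normed_vector \<Rightarrow> real^'n^'n"
  assumes "\<And>i j. (\<lambda>p. A p $ i $ j) differentiable (at q)"
  shows "(\<lambda>p. det (A p)) differentiable (at q)"
proof -
  have prod: "(\<lambda>p. \<Prod>i\<in>I. A p $ i $ \<pi> i) differentiable (at q)" if "finite I" for I \<pi>
    using that by (induction I) (auto intro!: differentiable_mult assms)
  show ?thesis
    unfolding det_def
    by (auto intro!: differentiable_sum differentiable_mult prod differentiable_const simp: finite_permutations)
qed

text \<open>The product rule for a form with a moving argument. Expanding the argument in the basis
  reduces it to derivatives of \<open>A\<close> on fixed vectors, so \<open>A\<close> needs no
  derivative as a map into a space of linear maps.\<close>

lemma has_derivative_linear_slot:
  fixes A :: "'a::real_normed_vector \<Rightarrow> real^'n \<Rightarrow> real" and w :: "'a \<Rightarrow> real^'n"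
  assumes "\<And>p. linear (A p)" "\<And>y. ((\<lambda>p. A p y) has_derivative (\<lambda>x. A' x y)) (at q)" "(w has_derivative w') (at q)"
  shows "((\<lambda>p. A p (w p)) has_derivative (\<lambda>x. A' x (w q) + A q (w' x))) (at q)"
proof -
  have 1: "A p y = (\<Sum>i\<in>UNIV. y $ i * A p (axis i 1))" for p y by (rule linear_sum_axis[OF assms(1)])
  have 2: "A' x y = (\<Sum>i\<in>UNIV. y $ i * A' x (axis i 1))" for x y
  proof -
    have "((\<lambda>p. \<Sum>i\<in>UNIV. y $ i * A p (axis i 1)) has_derivative (\<lambda>x. \<Sum>i\<in>UNIV. y $ i * A' x (axis i 1))) (at q)"
      by (intro has_derivative_sum has_derivative_mult_right assms(2))
    moreover have "(\<lambda>p. \<Sum>i\<in>UNIV. y $ i * A p (axis i 1)) = (\<lambda>p. A p y)"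
      using 1[of _ y] by simp
    ultimately have "((\<lambda>p. A p y) has_derivative (\<lambda>x. \<Sum>i\<in>UNIV. y $ i * A' x (axis i 1))) (at q)"
      by simp
    then show ?thesis using fun_cong[OF has_derivative_unique[OF assms(2)[of y]]] by blast
  qed
  have w: "((\<lambda>p. w p $ i) has_derivative (\<lambda>x. w' x $ i)) (at q)" for i
    by (rule bounded_linear.has_derivative[OF bounded_linear_vec_nth assms(3)])
  have "((\<lambda>p. \<Sum>i\<in>UNIV. w p $ i * A p (axis i 1)) has_derivative
      (\<lambda>x. \<Sum>i\<in>UNIV. w q $ i * A' x (axis i 1) + w' x $ i * A q (axis i 1))) (at q)"
    by (intro has_derivative_sum has_derivative_mult w assms(2))
  then show ?thesis unfolding 1[of _ "w _", symmetric] sum.distrib 2[of _ "w q", symmetric] 1[of _ "w' _", symmetric] .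
qed

section \<open>Structures with torsion in the class W1\<close>

lemma quadrilinear_eqI:
  assumes "\<And>y z t. linear (\<lambda>x. W x y z t)" "\<And>x z t. linear (\<lambda>y. W x y z t)"
    "\<And>x y t. linear (\<lambda>z. W x y z t)" "\<And>x y z. linear (\<lambda>t. W x y z t)"
    and "\<And>a b c d. W (axis a 1) (axis b 1) (axis c 1) (axis d 1) = f a b c d"
  shows "W x y z t = form4 f x y z t"
  using quadrilinear_eq_form4[of W, OF assms(1-4)] assms(5) by simp

lemma linear_inner_left: "linear (\<lambda>x. x \<bullet> (c :: 'a::real_inner))"
  by (simp add: linear_iff inner_add_left)

lemma linear_inner_right: "linear (\<lambda>x. (c :: 'a::real_inner) \<bullet> x)"
  by (simp add: linear_iff inner_add_right)

definition cross0 :: "real^7 \<Rightarrow> real^7 \<Rightarrow> real^7" where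
  "cross0 x y = (\<chi> m. form3 phi0 x y (axis m 1))"

lemma cross0_inner: "cross0 x y \<bullet> z = form3 phi0 x y z"
  unfolding linear_sum_axis[OF linear_form3(3), of _ x y z] cross0_def inner_vec_def
  by (simp add: mult.commute)

lemma linear_cross0: "linear (\<lambda>x. cross0 x y)" "linear (\<lambda>y. cross0 x y)"
  unfolding cross0_def by (simp_all add: linear_iff vec_eq_iff form3_linear_simps)

lemma psi0_cross0:
  "form4 psi0 x y z t = form3 phi0 x y (cross0 z t) - (x \<bullet> z) * (y \<bullet> t) + (x \<bullet> t) * (y \<bullet> z)"
proof -
  have lc: "linear (\<lambda>z. form3 phi0 x y (cross0 z t))" "linear (\<lambda>t. form3 phi0 x y (cross0 z t))" for x y z t
    using linear_compose[OF linear_cross0(1) linear_form3(3)] linear_compose[OF linear_cross0(2) linear_form3(3)]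
    by (simp_all add: o_def)
  have "form3 phi0 x y (cross0 z t) - (x \<bullet> z) * (y \<bullet> t) + (x \<bullet> t) * (y \<bullet> z) = form4 psi0 x y z t"
  proof (intro quadrilinear_eqI)
    have cyc: "phi0 c d m = phi0 m c d" for c d m
      using phi0_antisym(1)[of m c d] phi0_antisym(2)[of c m d] by linarith
    have F3: "form3 phi0 (axis a 1) (axis b 1) w = (\<Sum>m\<in>UNIV. w $ m * phi0 a b m)" for a b w
      by (subst linear_sum_axis[OF linear_form3(3)]) (simp only: form3_axis)
    have e: "axis i (1::real) \<bullet> axis j 1 = of_bool (i = j)" for i j :: 7
      by (simp add: inner_axis_axis)
    show "form3 phi0 (axis a 1) (axis b 1) (cross0 (axis c 1) (axis d 1))
        - axis a 1 \<bullet> axis c (1::real) * (axis b 1 \<bullet> axis d (1::real)) +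
        axis a 1 \<bullet> axis d (1::real) * (axis b 1 \<bullet> axis c (1::real)) = psi0 a b c d" for a b c d
      unfolding F3 psi0_def e cross0_def vec_lambda_beta form3_axis cyc[of c d] of_bool_conj
          by (simp only: mult.commute)
  qed (intro linear_compose_add linear_compose_sub linear_mult_const(1)[of "\<lambda>x. x \<bullet> _"]  linear_mult_const(2)[of
      "\<lambda>x. x \<bullet> _"]
      linear_mult_const(1)[of "\<lambda>x. _ \<bullet> x"]  linear_mult_const(2)[of
          "\<lambda>x. _ \<bullet> x"] linear_inner_left linear_inner_right linear_form3 lc)+
  then show ?thesis ..
qed

text \<open>One structure with \<open>\<nabla>\<phi> = \<tau>\<psi>\<close> in a coordinate domain.
  Smoothness is assumed of \<phi> and \<open>g\<close> only; the regularity of \<tau> is a result,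
  see \<open>\<tau>_has_derivative_0\<close>.\<close>

locale nearly_parallel_G2 =
  fixes S :: "(real^7) set" and \<phi> :: "real^7 \<Rightarrow> 7 \<Rightarrow> 7 \<Rightarrow> 7 \<Rightarrow> real" and g :: "real^7 \<Rightarrow> real^7^7"
    and vol \<tau> :: "real^7 \<Rightarrow> real"
  assumes open_S: "open S"
    and smooth_phi: "\<And>i j k. smooth_on S (\<lambda>q. \<phi> q i j k)"
    and smooth_g: "\<And>i j. smooth_on S (\<lambda>q. g q $ i $ j)"
    and g_transpose: "\<And>q. q \<in> S \<Longrightarrow> transpose (g q) = g q"
    and g_pos: "\<And>q u. q \<in> S \<Longrightarrow> u \<noteq> 0 \<Longrightarrow> u \<bullet> (g q *v u) > 0"
    and positive: "\<And>q. q \<in> S \<Longrightarrow> positive3 (\<phi> q)"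
    and vol_square: "\<And>q. q \<in> S \<Longrightarrow> (vol q)\<^sup>2 = det (g q)"
    and g_vol: "\<And>q u w. q \<in> S \<Longrightarrow>
      (u \<bullet> (g q *v w)) * vol q = wedge223 (interior3 u (\<phi> q)) (interior3 w (\<phi> q)) (\<phi> q) / 6"
    and torsion: "\<And>q a b c d. q \<in> S \<Longrightarrow>
      nabla3 g \<phi> q a b c d = \<tau> q * hodge3 (g q) (vol q) (\<phi> q) a b c d"
begin

text \<open>\<open>F\<close>, \<open>G\<close>, \<open>H\<close> are \<open>\<phi>\<close>, \<open>g\<close>, \<open>\<psi>\<close> as multilinear forms and \<open>P\<close> is the cross product. The corrected connection
  form \<open>B\<close> acts on all of them as the derivative does.\<close>

definition F where "F q = form3 (\<phi> q)"
definition H where "H q = form4 (hodge3 (g q) (vol q) (\<phi> q))"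
definition G where "G q x y = x \<bullet> (g q *v y)"
definition P where "P q x y = matrix_inv (g q) *v (\<chi> c. F q x y (axis c 1))"
definition \<Gamma> where "\<Gamma> q x y = (\<chi> e. \<Sum>a\<in>UNIV. \<Sum>b\<in>UNIV. x $ a * (y $ b * christoffel g q e a b))"
definition B where "B q x y = \<Gamma> q x y + (\<tau> q / 3) *\<^sub>R P q x y"

lemma linear_F: "linear (\<lambda>x. F q x y z)" "linear (\<lambda>y. F q x y z)" "linear (\<lambda>z. F q x y z)"
  unfolding F_def by (rule linear_form3)+

lemma linear_H: "linear (\<lambda>x. H q x y z t)" "linear (\<lambda>y. H q x y z t)" "linear (\<lambda>z. H q x y z t)"
    "linear (\<lambda>t. H q x y z t)"
  unfolding H_def by (rule linear_form4)+

lemma linear_G: "linear (\<lambda>x. G q x y)" "linear (\<lambda>y. G q x y)"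
  unfolding G_def by (simp_all add: linear_iff inner_add_left inner_add_right matrix_vector_right_distrib
      matrix_vector_mult_scaleR)

lemma linear_P: "linear (\<lambda>x. P q x y)" "linear (\<lambda>y. P q x y)"
proof -
  have "linear (\<lambda>x. (\<chi> c. F q x y (axis c 1)) :: real^7)" "linear (\<lambda>y. (\<chi> c. F q x y (axis c 1)) :: real^7)"
    unfolding F_def by (simp_all add: linear_iff vec_eq_iff form3_linear_simps)
  then show "linear (\<lambda>x. P q x y)" "linear (\<lambda>y. P q x y)"
    unfolding P_def using linear_compose[OF _ matrix_vector_mul_linear[of "matrix_inv (g q)"]] by (simp_all add: o_def)
qed

lemma linear_\<Gamma>: "linear (\<lambda>x. \<Gamma> q x y)" "linear (\<lambda>y. \<Gamma> q x y)"
  unfolding \<Gamma>_def by (simp_all add: linear_iff vec_eq_iff algebra_simps sum.distrib sum_distrib_left)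

lemma linear_B: "linear (\<lambda>x. B q x y)" "linear (\<lambda>y. B q x y)"
  unfolding B_def
  by (intro linear_compose_add linear_\<Gamma> linear_compose_scale_right linear_P)+

lemmas linear_simps =
  linear_F[THEN linear_add] linear_F[THEN linear_diff] linear_F[THEN linear_scale]
  linear_H[THEN linear_add] linear_H[THEN linear_diff] linear_H[THEN linear_scale]
  linear_G[THEN linear_add] linear_G[THEN linear_diff] linear_G[THEN linear_scale]

lemma adapted:
  assumes "q \<in> S"
  obtains L r where "\<phi> q = pull3 L phi0" "g q = transpose L ** L" "hodge3 (g q) (vol q) (\<phi> q) = pull4 L psi0"
      "invertible L"
    "L *v v = r *\<^sub>R axis 1 1"
  using G2_adapted[of "\<phi> q" "vol q" "g q", OF positive vol_square g_pos g_vol] assms by metis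

lemma matrix_inv_g: "q \<in> S \<Longrightarrow> g q ** matrix_inv (g q) = mat 1" "q \<in> S \<Longrightarrow> matrix_inv (g q) ** g q = mat 1"
proof -
  assume q: "q \<in> S"
  have "invertible (g q)" by (rule invertible_if_positive) (rule g_pos[OF q])
  then show "g q ** matrix_inv (g q) = mat 1" "matrix_inv (g q) ** g q = mat 1" by (rule invertible_matrix_inv)+
qed

lemma G_sym: "q \<in> S \<Longrightarrow> G q x y = G q y x"
  unfolding G_def by (metis dot_lmul_matrix g_transpose inner_commute transpose_matrix_vector)

lemma G_P: assumes "q \<in> S" shows "G q (P q x y) z = F q x y z" "G q z (P q x y) = F q x y z"
proof -
  have "G q z (P q x y) = z \<bullet> (\<chi> c. F q x y (axis c 1))"
    unfolding G_def P_def by (simp add: matrix_vector_mul_assoc matrix_inv_g[OF assms])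
  also have "\<dots> = F q x y z"
    unfolding linear_sum_axis[OF linear_F(3), of _ _ _ z] by (simp add: inner_vec_def)
  finally show "G q z (P q x y) = F q x y z" .
  then show "G q (P q x y) z = F q x y z" using G_sym[OF assms] by simp
qed

lemma F_antisym: "q \<in> S \<Longrightarrow> F q x y z = - F q y x z" "q \<in> S \<Longrightarrow> F q x y z = - F q x z y"
  unfolding F_def by (metis adapted form3_pull3 form3_phi0_antisym)+

lemma H_antisym: "q \<in> S \<Longrightarrow> H q x y z t = - H q y x z t" "q \<in> S \<Longrightarrow> H q x y z t = - H q x z y t"
  "q \<in> S \<Longrightarrow> H q x y z t = - H q x y t z"
  unfolding H_def by (metis adapted form4_pull4 form4_psi0_antisym)+

lemma H_eq_F_P:
  assumes "q \<in> S"
  shows "H q x y z t = F q x y (P q z t) - G q x z * G q y t + G q x t * G q y z"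
proof -
  obtain L r where L: "\<phi> q = pull3 L phi0" "g q = transpose L ** L" "hodge3 (g q) (vol q) (\<phi> q) = pull4 L psi0"
      "invertible L"
    using adapted[OF assms] by metis
  have G: "G q x y = (L *v x) \<bullet> (L *v y)" for x y
    unfolding G_def L(2) by (rule inner_transpose_mult)
  have F: "F q x y z = form3 phi0 (L *v x) (L *v y) (L *v z)" for x y z
    unfolding F_def L(1) form3_pull3 ..
  have "L *v P q z t = cross0 (L *v z) (L *v t)"
  proof (rule vector_eq_rdot[THEN iffD1, rule_format])
    fix u
    have u: "L *v (matrix_inv L *v u) = u"
      using invertible_matrix_inv[OF L(4)] by (simp add: matrix_vector_mul_assoc)
    have "(L *v P q z t) \<bullet> (L *v (matrix_inv L *v u)) = F q z t (matrix_inv L *v u)"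
      unfolding G[symmetric] by (rule G_P[OF assms])
    then show "(L *v P q z t) \<bullet> u = cross0 (L *v z) (L *v t) \<bullet> u"
      unfolding F u cross0_inner .
  qed
  then show ?thesis
    unfolding H_def L(3) form4_pull4 F G psi0_cross0 by simp
qed

text \<open>Each of the three terms is \<open>H q x y z t\<close> up to products of values of
  \<open>G\<close>, and these products cancel. The factor 3 is the origin of
  \<open>\<tau> / 3\<close> in \<open>B\<close>.\<close>

lemma F_P_cyclic: "q \<in> S \<Longrightarrow> F q (P q x y) z t + F q y (P q x z) t + F q y z (P q x t) = 3 * H q x y z t"
proof -
  assume q: "q \<in> S"
  note F = F_antisym[OF q] and H = H_antisym[OF q] and G = G_sym[OF q]
  have "F q (P q x y) z t = H q z t x y + G q z x * G q t y - G q z y * G q t x"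
    using H_eq_F_P[OF q, of z t x y] F(1)[of z "P q x y" t] F(2)[of z t "P q x y"] by linarith
  moreover have "F q y (P q x z) t = - (H q y t x z + G q y x * G q t z - G q y z * G q t x)"
    using H_eq_F_P[OF q, of y t x z] F(2)[of y t "P q x z"] by linarith
  moreover have "F q y z (P q x t) = H q y z x t + G q y x * G q z t - G q y t * G q z x"
    using H_eq_F_P[OF q, of y z x t] by linarith
  moreover have "H q z t x y = H q x y z t"
    using H(2)[of z t x y] H(1)[of z x t y] H(3)[of x z t y] H(2)[of x z y t] by linarith
  moreover have "H q y t x z = - H q x y z t"
    using H(2)[of y t x z] H(1)[of y x t z] H(3)[of x y t z] by linarith
  moreover have "H q y z x t = H q x y z t"
    using H(2)[of y z x t] H(1)[of y x z t] by linarith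
  ultimately show ?thesis
    unfolding G[of z x] G[of t y] G[of z y] G[of t x] G[of t z] G[of y x] by (simp add: mult.commute)
qed

text \<open>The values of \<open>H\<close> at disjoint pairs \<open>xy\<close>, \<open>zt\<close> are related by \<open>rel\<close>; the alternating sum around the
  5-cycle \<open>xy, zt, ux, yz, tu\<close> of consecutively disjoint pairs isolates one value.\<close>

lemma H_P:
  assumes q: "q \<in> S"
  shows "H q (P q x y) z t u = G q x z * F q y t u + G q x t * F q z y u + G q x u * F q z t y
    - G q y z * F q x t u - G q y t * F q z x u - G q y u * F q z t x"
proof -
  note F = F_antisym[OF q] and G = G_sym[OF q]
  have rel: "H q (P q x y) z t u + H q (P q z t) u x y = - F q z t x * G q u y + F q z t y * G q u x
      + G q z u * F q x y t - F q x y z * G q t u" for x y z t u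
  proof -
    have "H q (P q x y) z t u = - H q z t u (P q x y)"
      using H_antisym(1)[OF q, of "P q x y" z t u] H_antisym(2)[OF q, of z "P q x y" t u] H_antisym(3)[OF q, of z t
          "P q x y" u] H_antisym(3)[OF q, of z t u "P q x y"] by linarith
    also have "\<dots> = - F q z t (P q u (P q x y)) + G q z u * F q x y t - F q x y z * G q t u"
      using H_eq_F_P[OF q, of z t u "P q x y"] by (simp add: G_P[OF q])
    also have "F q z t (P q u (P q x y)) = F q u (P q x y) (P q z t)"
      using G_P(1)[OF q, where x = z and y = t and z = "P q u (P q x y)"]
        G_P(2)[OF q, where x = u and y = "P q x y" and z = "P q z t"] by simp
    also have "\<dots> = F q (P q z t) u (P q x y)"
      using F(2)[of u "P q x y" "P q z t"] F(1)[of u "P q z t" "P q x y"] by linarith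
    also have "\<dots> = H q (P q z t) u x y + F q z t x * G q u y - F q z t y * G q u x"
      using H_eq_F_P[OF q, of "P q z t" u x y] by (simp add: G_P[OF q])
    finally show ?thesis by simp
  qed
  have c: "F q b c a = F q a b c" "F q b a c = - F q a b c" for a b c
    using F(1)[of b a c] F(2)[of b c a] by linarith+
  have sort: "F q z t x = F q x z t" "F q z t y = F q y z t" "F q u x z = F q x z u" "F q u x t = F q x t u"
    "F q y z x = F q x y z" "F q u x y = F q x y u" "F q t u y = F q y t u" "F q t u z = F q z t u" "F q t u x
        = F q x t u"
    "F q z y u = - F q y z u" "F q z x u = - F q x z u"
    by (rule c(1) c(1)[symmetric] c(2))+
  have "2 * H q (P q x y) z t u =
      (H q (P q x y) z t u + H q (P q z t) u x y) - (H q (P q z t) u x y + H q (P q u x) y z t)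
      + (H q (P q u x) y z t + H q (P q y z) t u x) - (H q (P q y z) t u x + H q (P q t u) x y z)
      + (H q (P q t u) x y z + H q (P q x y) z t u)" by simp
  also have "H q (P q z t) u x y + H q (P q u x) y z t = - F q u x z * G q y t + F q u x t * G q y z
      + G q u y * F q z t x - F q z t u * G q x y"
    by (rule rel)
  also have "H q (P q u x) y z t + H q (P q y z) t u x = - F q y z u * G q t x + F q y z x * G q t u
      + G q y t * F q u x z - F q u x y * G q z t"
    by (rule rel)
  also have "H q (P q y z) t u x + H q (P q t u) x y z = - F q t u y * G q x z + F q t u z * G q x y
      + G q t x * F q y z u - F q y z t * G q u x"
    by (rule rel)
  also have "H q (P q t u) x y z + H q (P q x y) z t u = - F q x y t * G q z u + F q x y u * G q z t
      + G q x z * F q t u y - F q t u x * G q y z"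
    by (rule rel)
  also note rel[of x y z t u]
  finally show ?thesis
    unfolding sort G[of u y] G[of u x] G[of t x] G[of t y] by (simp add: algebra_simps)
qed
end

text \<open>For an array \<open>A\<close> whose first argument is a direction of differentiation and
  which is alternating in the others, \<open>alt4\<close> and \<open>alt5\<close> form the exterior
  derivative of a 3-form and of a 4-form.\<close>

definition alt4 :: "('a \<Rightarrow> 'a \<Rightarrow> 'a \<Rightarrow> 'a \<Rightarrow> real) \<Rightarrow> 'a \<Rightarrow> 'a \<Rightarrow> 'a \<Rightarrow> 'a \<Rightarrow> real" where
  "alt4 A x y z t = A x y z t - A y x z t + A z x y t - A t x y z"

definition alt5 :: "('a \<Rightarrow> 'a \<Rightarrow> 'a \<Rightarrow> 'a \<Rightarrow> 'a \<Rightarrow> real) \<Rightarrow> 'a \<Rightarrow> 'a \<Rightarrow> 'a \<Rightarrow> 'a \<Rightarrow> 'a \<Rightarrow> real" where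
  "alt5 A x y z t u = A x y z t u - A y x z t u + A z x y t u - A t x y z u + A u x y z t"

lemma form3_swap: "form3 f x z y = form3 (\<lambda>a b c. f a c b) x y z"
proof -
  have "(\<Sum>b\<in>UNIV. z $ b * (\<Sum>c\<in>UNIV. y $ c * f a b c)) = (\<Sum>c\<in>UNIV. y $ c * (\<Sum>b\<in>UNIV. z $ b * f a b c))" for a
    unfolding sum_distrib_left by (subst sum.swap) (simp only: mult.left_commute)
  then show ?thesis unfolding form3_def by simp
qed

lemma form3_plus: "form3 f x y z + form3 h x y z = form3 (\<lambda>a b c. f a b c + h a b c) x y z"
  unfolding form3_def by (simp add: sum.distrib algebra_simps)

lemma partial_cong:
  assumes "open S" "q \<in> S" "\<And>p. p \<in> S \<Longrightarrow> f p = h p"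
  shows "partial a f q = partial a h q"
proof -
  have "(h has_derivative D) (at q)" if "(f has_derivative D) (at q)" for D
    by (rule has_derivative_transform_within_open[OF that assms])
  moreover have "(f has_derivative D) (at q)" if "(h has_derivative D) (at q)" for D
    by (rule has_derivative_transform_within_open[OF that assms(1,2)]) (rule assms(3)[symmetric])
  ultimately have "(f has_derivative D) (at q) \<longleftrightarrow> (h has_derivative D) (at q)" for D by blast
  then show ?thesis unfolding partial_def frechet_derivative_def by simp
qed

lemma differentiable_vec:
  fixes f :: "'a::real_normed_vector \<Rightarrow> real^'n"
  assumes "\<And>k. (\<lambda>p. f p $ k) differentiable (at q)"
  shows "f differentiable (at q)"
proof -
  have "f = (\<lambda>p. \<Sum>k\<in>UNIV. (f p $ k) *\<^sub>R axis k 1)"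
  proof
    show "f p = (\<Sum>k\<in>UNIV. (f p $ k) *\<^sub>R axis k 1)" for p
      using basis_expansion[of "f p"] by (simp add: scalar_mult_eq_scaleR)
  qed
  moreover have "(\<lambda>p. \<Sum>k\<in>UNIV. (f p $ k) *\<^sub>R (axis k 1 :: real^'n)) differentiable (at q)"
    by (intro differentiable_sum ballI differentiable_scaleR assms differentiable_const) simp
  ultimately show ?thesis by simp
qed

section \<open>Parallel forms and their exterior derivatives\<close>

context nearly_parallel_G2
begin

lemma g_sym: "q \<in> S \<Longrightarrow> g q $ a $ b = g q $ b $ a"
  using arg_cong[OF g_transpose, of q "\<lambda>M. M $ b $ a"] by (simp add: transpose_def)

lemma christoffel_sym: "q \<in> S \<Longrightarrow> christoffel g q e a b = christoffel g q e b a"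
proof -
  assume q: "q \<in> S"
  have "partial d (\<lambda>r. g r $ a $ b) q = partial d (\<lambda>r. g r $ b $ a) q" for d
    by (rule partial_cong[OF open_S q]) (rule g_sym)
  then show ?thesis unfolding christoffel_def by (simp add: add.commute)
qed

lemma \<Gamma>_sym: "q \<in> S \<Longrightarrow> \<Gamma> q x y = \<Gamma> q y x"
proof -
  assume q: "q \<in> S"
  have "(\<Sum>a\<in>UNIV. \<Sum>b\<in>UNIV. x $ a * (y $ b * christoffel g q e a b))
      = (\<Sum>a\<in>UNIV. \<Sum>b\<in>UNIV. y $ a * (x $ b * christoffel g q e a b))" for e
    by (subst sum.swap) (simp only: christoffel_sym[OF q, of e] mult.left_commute)
  then show ?thesis unfolding \<Gamma>_def by simp
qed

lemma P_antisym: "q \<in> S \<Longrightarrow> P q y x = - P q x y"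
proof -
  assume q: "q \<in> S"
  have "(\<chi> c. F q y x (axis c 1)) = - (\<chi> c. F q x y (axis c (1::real)) :: real^7)"
    unfolding F_antisym(1)[OF q, of y x] by (simp add: vec_eq_iff)
  then show ?thesis unfolding P_def by (simp add: linear_neg[OF matrix_vector_mul_linear])
qed

lemma B_commute: "q \<in> S \<Longrightarrow> B q y x = B q x y - (2 * \<tau> q / 3) *\<^sub>R P q x y"
  unfolding B_def by (simp add: P_antisym[of q y x] \<Gamma>_sym[of q y x] algebra_simps scaleR_2[symmetric])

lemma has_derivative_G_\<Gamma>:
  assumes q: "q \<in> S"
  shows "((\<lambda>p. G p y z) has_derivative (\<lambda>x. G q (\<Gamma> q x y) z + G q y (\<Gamma> q x z))) (at q)"
proof -
  define dg where "dg a i j = partial a (\<lambda>r. g r $ i $ j) q" for a i j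
  \<comment> \<open>The Christoffel symbols of the first kind, that is with the upper index
    lowered.\<close>
  define K where "K a b d = (dg a b d + dg b a d - dg d a b) / 2" for a b d
  have dg_sym: "dg a i j = dg a j i" for a i j
    unfolding dg_def by (rule partial_cong[OF open_S q]) (rule g_sym)
  have "((\<lambda>p. g p $ i $ j) has_derivative (\<lambda>x. \<Sum>a\<in>UNIV. x $ a * dg a i j)) (at q)" for i j
    unfolding dg_def by (rule smooth_on_has_derivative[OF smooth_g q])
  then have "((\<lambda>p. \<Sum>i\<in>UNIV. y $ i * (\<Sum>j\<in>UNIV. z $ j * g p $ i $ j)) has_derivative
      (\<lambda>x. \<Sum>i\<in>UNIV. y $ i * (\<Sum>j\<in>UNIV. z $ j * (\<Sum>a\<in>UNIV. x $ a * dg a i j)))) (at q)"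
    by (intro has_derivative_sum has_derivative_mult_right)
  moreover have "(\<Sum>i\<in>UNIV. y $ i * (\<Sum>j\<in>UNIV. z $ j * g p $ i $ j)) = G p y z" for p
    unfolding G_def by (simp add: inner_vec_def matrix_vector_mult_def mult.commute)
  moreover have "(\<Sum>i\<in>UNIV. y $ i * (\<Sum>j\<in>UNIV. z $ j * (\<Sum>a\<in>UNIV. x $ a * dg a i j))) = G q (\<Gamma> q x y) z
      + G q y (\<Gamma> q x z)" for x
  proof -
    have G\<Gamma>: "G q z (\<Gamma> q x y) = form3 K x y z" for x y z
    proof -
      define W where "W = (\<chi> d. \<Sum>a\<in>UNIV. x $ a * (\<Sum>b\<in>UNIV. y $ b * K a b d))"
      have ch: "christoffel g q e a b = (\<Sum>d\<in>UNIV. matrix_inv (g q) $ e $ d * K a b d)" for e a b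
        unfolding christoffel_def K_def dg_def by (simp add: sum_divide_distrib)
      have "\<Gamma> q x y = matrix_inv (g q) *v W"
      proof (unfold vec_eq_iff, rule allI)
        fix e
        have "\<Gamma> q x y $ e = (\<Sum>a\<in>UNIV. \<Sum>b\<in>UNIV. \<Sum>d\<in>UNIV. x $ a * (y $ b * (matrix_inv (g q) $ e $ d * K a b d)))"
          unfolding \<Gamma>_def ch by (simp add: sum_distrib_left)
        also have "\<dots> = (\<Sum>a\<in>UNIV. \<Sum>d\<in>UNIV. \<Sum>b\<in>UNIV. x $ a * (y $ b * (matrix_inv (g q) $ e $ d * K a b d)))"
          by (intro sum.cong refl sum.swap)
        also have "\<dots> = (\<Sum>d\<in>UNIV. \<Sum>a\<in>UNIV. \<Sum>b\<in>UNIV. x $ a * (y $ b * (matrix_inv (g q) $ e $ d * K a b d)))"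
          by (rule sum.swap)
        also have "\<dots> = (matrix_inv (g q) *v W) $ e"
          unfolding W_def matrix_vector_mult_def by (simp add: sum_distrib_left mult_ac)
        finally show "\<Gamma> q x y $ e = (matrix_inv (g q) *v W) $ e" .
      qed
      then have "G q z (\<Gamma> q x y) = z \<bullet> W"
        unfolding G_def by (simp add: matrix_vector_mul_assoc matrix_inv_g[OF q])
      also have "\<dots> = (\<Sum>d\<in>UNIV. \<Sum>a\<in>UNIV. \<Sum>b\<in>UNIV. z $ d * (x $ a * (y $ b * K a b d)))"
        unfolding W_def by (simp add: inner_vec_def sum_distrib_left)
      also have "\<dots> = (\<Sum>a\<in>UNIV. \<Sum>d\<in>UNIV. \<Sum>b\<in>UNIV. z $ d * (x $ a * (y $ b * K a b d)))"
        by (rule sum.swap)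
      also have "\<dots> = (\<Sum>a\<in>UNIV. \<Sum>b\<in>UNIV. \<Sum>d\<in>UNIV. z $ d * (x $ a * (y $ b * K a b d)))"
        by (intro sum.cong refl sum.swap)
      also have "\<dots> = form3 K x y z"
        unfolding form3_def by (simp add: sum_distrib_left mult_ac)
      finally show ?thesis .
    qed
    have "G q (\<Gamma> q x y) z + G q y (\<Gamma> q x z) = form3 K x y z + form3 K x z y"
      using G\<Gamma>[of z x y] G\<Gamma>[of y x z] G_sym[OF q] by simp
    also have "\<dots> = form3 dg x y z"
      unfolding form3_swap[of K x z y] form3_plus by (simp add: K_def dg_sym field_simps)
    also have "\<dots> = (\<Sum>a\<in>UNIV. \<Sum>i\<in>UNIV. \<Sum>j\<in>UNIV. x $ a * (y $ i * (z $ j * dg a i j)))"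
      unfolding form3_def by (simp add: sum_distrib_left)
    also have "\<dots> = (\<Sum>i\<in>UNIV. \<Sum>a\<in>UNIV. \<Sum>j\<in>UNIV. x $ a * (y $ i * (z $ j * dg a i j)))"
      by (rule sum.swap)
    also have "\<dots> = (\<Sum>i\<in>UNIV. \<Sum>j\<in>UNIV. \<Sum>a\<in>UNIV. x $ a * (y $ i * (z $ j * dg a i j)))"
      by (intro sum.cong refl sum.swap)
    also have "\<dots> = (\<Sum>i\<in>UNIV. y $ i * (\<Sum>j\<in>UNIV. z $ j * (\<Sum>a\<in>UNIV. x $ a * dg a i j)))"
      by (simp add: sum_distrib_left mult_ac)
    finally show ?thesis ..
  qed
  ultimately show ?thesis by simp
qed

lemma has_derivative_F_\<Gamma>:
  assumes q: "q \<in> S"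
  shows "((\<lambda>p. F p y z t) has_derivative
    (\<lambda>x. \<tau> q * H q x y z t + F q (\<Gamma> q x y) z t + F q y (\<Gamma> q x z) t + F q y z (\<Gamma> q x t))) (at q)"
proof -
  define d\<phi> where "d\<phi> a b c d = partial a (\<lambda>r. \<phi> r b c d) q" for a b c d
  define W where "W x y z t = (\<Sum>b\<in>UNIV. y $ b * (\<Sum>c\<in>UNIV. z $ c * (\<Sum>d\<in>UNIV. t $ d * (\<Sum>a\<in>UNIV. x $ a * d\<phi> a b c
      d))))" for x y z t :: "real^7"
  define V where "V x y z t = \<tau> q * H q x y z t + F q (\<Gamma> q x y) z t + F q y (\<Gamma> q x z) t + F q y z (\<Gamma> q x t)" for x y z t
  have "((\<lambda>p. \<phi> p b c d) has_derivative (\<lambda>x. \<Sum>a\<in>UNIV. x $ a * d\<phi> a b c d)) (at q)" for b c d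
    unfolding d\<phi>_def by (rule smooth_on_has_derivative[OF smooth_phi q])
  then have "((\<lambda>p. F p y z t) has_derivative (\<lambda>x. W x y z t)) (at q)"
    unfolding F_def form3_def W_def by (intro has_derivative_sum has_derivative_mult_right)
  moreover have "W x y z t = form4 d\<phi> x y z t" for x
    by (rule quadrilinear_eqI; (unfold W_def axis_nth_of_bool sum_of_bool)?)
      (simp_all add: linear_iff algebra_simps sum.distrib sum_distrib_left)
  moreover have "V x y z t = form4 d\<phi> x y z t" for x
  proof (rule quadrilinear_eqI)
    show "linear (\<lambda>x. V x y z t)" "linear (\<lambda>x. V y x z t)" "linear (\<lambda>x. V y z x t)" "linear (\<lambda>x. V y z t x)" for y z t
      unfolding V_def linear_iff
      by (simp_all add: linear_simps linear_add[OF linear_\<Gamma>(1)] linear_add[OF linear_\<Gamma>(2)]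
          linear_scale[OF linear_\<Gamma>(1)] linear_scale[OF linear_\<Gamma>(2)] algebra_simps)
    fix a b c d
    have \<Gamma>: "\<Gamma> q (axis a 1) (axis b 1) $ e = christoffel g q e a b" for a b e
      unfolding \<Gamma>_def vec_lambda_beta axis_nth_of_bool sum_distrib_left[symmetric] sum_of_bool ..
    have "F q (\<Gamma> q (axis a 1) (axis b 1)) (axis c 1) (axis d 1) = (\<Sum>e\<in>UNIV. christoffel g q e a b * \<phi> q e c d)"
      "F q (axis b 1) (\<Gamma> q (axis a 1) (axis c 1)) (axis d 1) = (\<Sum>e\<in>UNIV. christoffel g q e a c * \<phi> q b e d)"
      "F q (axis b 1) (axis c 1) (\<Gamma> q (axis a 1) (axis d 1)) = (\<Sum>e\<in>UNIV. christoffel g q e a d * \<phi> q b c e)"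
      unfolding F_def \<Gamma>[symmetric]
      by (subst linear_sum_axis[OF linear_form3(1)] linear_sum_axis[OF linear_form3(2)] linear_sum_axis[OF
          linear_form3(3)],
          simp only: form3_axis)+
    moreover have "H q (axis a 1) (axis b 1) (axis c 1) (axis d 1) = hodge3 (g q) (vol q) (\<phi> q) a b c d"
      unfolding H_def form4_axis ..
    ultimately show "V (axis a 1) (axis b 1) (axis c 1) (axis d 1) = d\<phi> a b c d"
      using torsion[OF q, of a b c d] unfolding V_def d\<phi>_def nabla3_def by simp
  qed
  ultimately show ?thesis unfolding V_def by simp
qed

text \<open>A parallel form evaluated on constant vectors has as derivative along \<open>x\<close>
  the sum over its arguments with \<open>B q x\<close> applied to one of them.
  \<open>has_derivative_F\<close> and \<open>has_derivative_H\<close> confirm this for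
  \<open>DF\<close> and \<open>DH\<close>.\<close>

definition DF where "DF q x y z t = F q (B q x y) z t + F q y (B q x z) t + F q y z (B q x t)"
definition DH where "DH q x y z t u = H q (B q x y) z t u + H q y (B q x z) t u + H q y z (B q x t) u
    + H q y z t (B q x u)"

lemma DF_eq: "q \<in> S \<Longrightarrow> DF q x y z t = \<tau> q * H q x y z t + F q (\<Gamma> q x y) z t + F q y (\<Gamma> q x z) t + F q y z (\<Gamma> q x t)"
  using arg_cong[OF F_P_cyclic[of q x y z t], of "\<lambda>a. \<tau> q / 3 * a"] unfolding DF_def B_def
  by (simp add: linear_simps algebra_simps)

lemma has_derivative_F: "q \<in> S \<Longrightarrow> ((\<lambda>p. F p y z t) has_derivative (\<lambda>x. DF q x y z t)) (at q)"
  unfolding DF_eq by (rule has_derivative_F_\<Gamma>)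

text \<open>Passing from \<open>\<Gamma>\<close> to \<open>B\<close> changes nothing, because the
  correction by the cross product is skew with respect to the metric.\<close>

lemma has_derivative_G: "q \<in> S \<Longrightarrow> ((\<lambda>p. G p y z) has_derivative (\<lambda>x. G q (B q x y) z + G q y (B q x z))) (at q)"
proof -
  assume q: "q \<in> S"
  have "G q (B q x y) z + G q y (B q x z) = G q (\<Gamma> q x y) z + G q y (\<Gamma> q x z)" for x
    using F_antisym(2)[OF q, of x y z] unfolding B_def by (simp add: linear_simps G_P[OF q])
  then show ?thesis using has_derivative_G_\<Gamma>[OF q] by simp
qed

text \<open>The vector \<open>P p y z\<close> solves a linear system with matrix \<open>g p\<close>.
  Cramer's rule writes its components as quotients of determinants with differentiable entries, so
  the matrix inverse need not be differentiated.\<close>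

lemma differentiable_P:
  assumes q: "q \<in> S"
  shows "(\<lambda>p. P p y z) differentiable (at q)"
proof (rule differentiable_vec)
  fix k
  define b where "b p = (\<chi> c. F p y z (axis c 1))" for p
  let ?c = "\<lambda>p. det (\<chi> i j. if j = k then b p $ i else g p $ i $ j) / det (g p)"
  have dF: "(\<lambda>p. F p y z t) differentiable (at q)" for t
    using has_derivative_F[OF q] unfolding differentiable_def by blast
  have dg: "(\<lambda>p. g p $ i $ j) differentiable (at q)" for i j
    using smooth_on_differentiable[OF smooth_g q] .
  have det: "det (g p) \<noteq> 0" if "p \<in> S" for p
    using matrix_inv_g[OF that] invertible_det_nz unfolding invertible_def by metis
  have "P p y z $ k = ?c p" if p: "p \<in> S" for p
  proof -
    have "g p *v P p y z = b p"
      unfolding P_def b_def by (simp add: matrix_vector_mul_assoc matrix_inv_g[OF p])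
    then show ?thesis unfolding cramer[OF det[OF p]] by simp
  qed
  moreover have "?c differentiable (at q)"
  proof (intro differentiable_divide differentiable_det det[OF q] dg)
    show "(\<lambda>p. (\<chi> i j. if j = k then b p $ i else g p $ i $ j) $ i $ j) differentiable (at q)" for i j
      by (cases "j = k") (simp_all add: b_def dF dg)
  qed
  ultimately obtain D where D: "(?c has_derivative D) (at q)"
    and eq: "\<And>p. p \<in> S \<Longrightarrow> P p y z $ k = ?c p"
    unfolding differentiable_def by blast
  show "(\<lambda>p. P p y z $ k) differentiable (at q)"
    using has_derivative_transform_within_open[OF D open_S q eq[symmetric]] unfolding differentiable_def by blast
qed

lemma G_nondegenerate: "q \<in> S \<Longrightarrow> (\<And>u. G q x u = G q y u) \<Longrightarrow> x = y"
proof (rule ccontr)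
  assume q: "q \<in> S" and eq: "\<And>u. G q x u = G q y u" and "x \<noteq> y"
  then have "G q (x - y) (x - y) > 0" unfolding G_def using g_pos by simp
  then show False using eq[of "x - y"] by (simp add: linear_diff[OF linear_G(1)])
qed

text \<open>Differentiating \<open>G p (P p y z) u = F p y z u\<close>, in which both
  \<open>G\<close> and \<open>F\<close> are parallel, forces \<open>P\<close> to be parallel by
  nondegeneracy of the metric.\<close>

lemma has_derivative_P:
  assumes q: "q \<in> S"
  shows "((\<lambda>p. P p y z) has_derivative (\<lambda>x. P q (B q x y) z + P q y (B q x z) - B q x (P q y z))) (at q)"
proof -
  obtain P' where P': "((\<lambda>p. P p y z) has_derivative P') (at q)"
    using differentiable_P[OF q] unfolding differentiable_def by blast
  have "P' x = P q (B q x y) z + P q y (B q x z) - B q x (P q y z)" for x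
  proof (rule G_nondegenerate[OF q])
    fix u
    have 1: "((\<lambda>p. G p (P p y z) u) has_derivative
       (\<lambda>x. (G q (B q x (P q y z)) u + G q (P q y z) (B q x u)) + G q (P' x) u)) (at q)"
      by (rule has_derivative_linear_slot[OF linear_G(1) has_derivative_G[OF q] P'])
    have 2: "((\<lambda>p. G p (P p y z) u) has_derivative (\<lambda>x. DF q x y z u)) (at q)"
      by (rule has_derivative_transform_within_open[OF has_derivative_F[OF q] open_S q]) (simp add: G_P)
    have "G q (B q x (P q y z)) u + G q (P q y z) (B q x u) + G q (P' x) u = DF q x y z u"
      using fun_cong[OF has_derivative_unique[OF 1 2]] .
    then show "G q (P' x) u = G q (P q (B q x y) z + P q y (B q x z) - B q x (P q y z)) u"
      unfolding DF_def by (simp add: linear_simps G_P[OF q])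
  qed
  then have "P' = (\<lambda>x. P q (B q x y) z + P q y (B q x z) - B q x (P q y z))" by blast
  then show ?thesis using P' by simp
qed

lemma has_derivative_H:
  assumes q: "q \<in> S"
  shows "((\<lambda>p. H p y z t u) has_derivative (\<lambda>x. DH q x y z t u)) (at q)"
proof -
  have "((\<lambda>p. F p y z (P p t u)) has_derivative
      (\<lambda>x. DF q x y z (P q t u) + F q y z (P q (B q x t) u + P q t (B q x u) - B q x (P q t u)))) (at q)"
    by (rule has_derivative_linear_slot[OF linear_F(3) has_derivative_F[OF q] has_derivative_P[OF q]])
  moreover have "((\<lambda>p. G p y t * G p z u) has_derivative (\<lambda>x. G q y t * (G q (B q x z) u + G q z (B q x u))
     + (G q (B q x y) t + G q y (B q x t)) * G q z u)) (at q)" for y z t u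
    by (rule has_derivative_mult[OF has_derivative_G[OF q] has_derivative_G[OF q]])
  ultimately have "((\<lambda>p. F p y z (P p t u) - G p y t * G p z u + G p y u * G p z t) has_derivative
     (\<lambda>x. DF q x y z (P q t u) + F q y z (P q (B q x t) u + P q t (B q x u) - B q x (P q t u))
       - (G q y t * (G q (B q x z) u + G q z (B q x u)) + (G q (B q x y) t + G q y (B q x t)) * G q z u)
       + (G q y u * (G q (B q x z) t + G q z (B q x t)) + (G q (B q x y) u + G q y (B q x u)) * G q z t))) (at q)"
    by (intro has_derivative_add has_derivative_diff)
  moreover have "DF q x y z (P q t u) + F q y z (P q (B q x t) u + P q t (B q x u) - B q x (P q t u))
       - (G q y t * (G q (B q x z) u + G q z (B q x u)) + (G q (B q x y) t + G q y (B q x t)) * G q z u)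
       + (G q y u * (G q (B q x z) t + G q z (B q x t)) + (G q (B q x y) u + G q y (B q x u)) * G q z t)
           = DH q x y z t u" for x
    unfolding DH_def DF_def H_eq_F_P[OF q] by (simp add: linear_simps algebra_simps)
  ultimately have "((\<lambda>p. F p y z (P p t u) - G p y t * G p z u
      + G p y u * G p z t) has_derivative (\<lambda>x. DH q x y z t u)) (at q)"
    by simp
  then show ?thesis
    by (rule has_derivative_transform_within_open[OF _ open_S q]) (simp add: H_eq_F_P)
qed

text \<open>Used with \<open>w\<close> a value of the connection: once it stands in the first slot,
  the terms of an alternating sum can be matched and cancelled.\<close>

lemma F_slot: "q \<in> S \<Longrightarrow> F q y w t = - F q w y t" "q \<in> S \<Longrightarrow> F q y z w = F q w y z"
  using F_antisym[of q] by (metis minus_minus)+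

lemma H_slot: "q \<in> S \<Longrightarrow> H q y w t u = - H q w y t u" "q \<in> S \<Longrightarrow> H q y z w u = H q w y z u" "q \<in> S
    \<Longrightarrow> H q y z t w = - H q w y z t"
  using H_antisym[of q] by (metis minus_minus)+

text \<open>The identity \<open>d\<phi> = 4\<tau>\<psi>\<close>: the terms with
  \<open>\<Gamma>\<close> cancel by its symmetry, and the four terms with \<open>H\<close> agree
  after sorting.\<close>

lemma alt4_DF: "q \<in> S \<Longrightarrow> alt4 (DF q) x y z t = 4 * \<tau> q * H q x y z t"
proof -
  assume q: "q \<in> S"
  note s1 = F_slot(1)[OF q, of _ "\<Gamma> q _ _"] and s2 = F_slot(2)[OF q, of _ _ "\<Gamma> q _ _"]
  have "H q y x z t = - H q x y z t" "H q z x y t = H q x y z t" "H q t x y z = - H q x y z t"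
    using H_antisym(1)[OF q, of x y z t] H_slot(2)[OF q, of x y z t] H_slot(3)[OF q, of x y z t] by linarith+
  then show ?thesis
    unfolding alt4_def DF_eq[OF q] s1 s2
    by (simp add: \<Gamma>_sym[OF q, of y x] \<Gamma>_sym[OF q, of z x] \<Gamma>_sym[OF q, of t x] \<Gamma>_sym[OF q, of z y] \<Gamma>_sym[OF q, of t
        y] \<Gamma>_sym[OF q, of t z] algebra_simps)
qed

text \<open>The identity \<open>d\<psi> = 0\<close>. Alternation leaves only the antisymmetric part
  of \<open>B\<close>, a multiple of \<open>P\<close>; by \<open>H_P\<close> the ten remaining terms
  become products of \<open>G\<close> and \<open>F\<close>, which cancel.\<close>

lemma alt5_DH: 
  assumes q: "q \<in> S"
  shows "alt5 (DH q) x y z t u = 0"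
proof -
  note s1 = H_slot(1)[OF q, of _ "B q _ _"] and s2 = H_slot(2)[OF q, of _ _ "B q _ _"] and s3
      = H_slot(3)[OF q, of _ _ _ "B q _ _"]
  note Bc = B_commute[OF q, of y x] B_commute[OF q, of z x] B_commute[OF q, of t x] B_commute[OF q, of u x] 
    B_commute[OF q, of z y] B_commute[OF q, of t y] B_commute[OF q, of u y] 
    B_commute[OF q, of t z] B_commute[OF q, of u z] B_commute[OF q, of u t] 
  note Gc = G_sym[OF q, of y x] G_sym[OF q, of z x] G_sym[OF q, of t x] G_sym[OF q, of u x] 
    G_sym[OF q, of z y] G_sym[OF q, of t y] G_sym[OF q, of u y] G_sym[OF q, of t z] G_sym[OF q, of u z] G_sym[OF q,
        of u t] 
  have c: "F q a b c = F q b c a" "F q a b c = F q c a b" "- F q a b c = F q b a c" "- F q a b c = F q a c b"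
     "- F q a b c = F q c b a" for a b c
    using F_slot(2)[OF q, of a b c] F_slot(2)[OF q, of b c a] F_antisym(1)[OF q, of a b c] F_antisym(2)[OF q, of a b c]
      F_antisym(1)[OF q, of c b a] by linarith+
  note cs = c[of x y z, symmetric] c[of x y t, symmetric] c[of x y u, symmetric] c[of x z t, symmetric] c[of x z u,
      symmetric]
    c[of x t u, symmetric] c[of y z t, symmetric] c[of y z u, symmetric] c[of y t u, symmetric] c[of z t u, symmetric]
  have "alt5 (DH q) x y z t u = (2 * \<tau> q / 3) * (H q (P q x y) z t u - H q (P q x z) y t u + H q (P q x t) y z u
      - H q (P q x u) y z t
     + H q (P q y z) x t u - H q (P q y t) x z u + H q (P q y u) x z t + H q (P q z t) x y u - H q (P q z u) x y t
         + H q (P q t u) x y z)"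
    unfolding alt5_def DH_def s1 s2 s3 unfolding Bc by (simp add: linear_simps algebra_simps)
  also have "\<dots> = 0"
    unfolding H_P[OF q] cs Gc by (simp add: algebra_simps)
  finally show ?thesis .
qed

section \<open>Local constancy of the torsion function\<close>

lemma differentiable_DF: "q \<in> S \<Longrightarrow> (\<lambda>p. DF p x y z t) differentiable (at q)"
proof -
  assume q: "q \<in> S"
  have "twice_differentiable_on S (\<lambda>p. F p y z t)"
    unfolding F_def form3_def
    by (intro twice_differentiable_on_sum twice_differentiable_on_mult twice_differentiable_on_const
        smooth_on_twice_differentiable smooth_phi finite)
  then show ?thesis by (rule twice_differentiable_onD[OF _ open_S q has_derivative_F])
qed

definition adapted_frame :: "real^7 \<Rightarrow> (7 \<Rightarrow> real^7) \<Rightarrow> bool" where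
  "adapted_frame q E \<longleftrightarrow>
    (\<forall>i j k. F q (E i) (E j) (E k) = phi0 i j k) \<and> (\<forall>i j. G q (E i) (E j) = of_bool (i = j)) \<and>
    (\<forall>i j k l. H q (E i) (E j) (E k) (E l) = psi0 i j k l) \<and> (\<forall>x. x = (\<Sum>i\<in>UNIV. G q (E i) x *\<^sub>R E i))"

lemma adapted_frameD:
  assumes "adapted_frame q E"
  shows "F q (E i) (E j) (E k) = phi0 i j k" "G q (E i) (E j) = of_bool (i = j)"
    "H q (E i) (E j) (E k) (E l) = psi0 i j k l" "(\<Sum>i\<in>UNIV. G q (E i) x *\<^sub>R E i) = x"
  using assms unfolding adapted_frame_def by metis+

lemma exists_adapted_frame:
  assumes q: "q \<in> S"
  obtains E r where "adapted_frame q E" "v = r *\<^sub>R E 1"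
proof -
  obtain L r where L: "\<phi> q = pull3 L phi0" "g q = transpose L ** L" "hodge3 (g q) (vol q) (\<phi> q) = pull4 L psi0"
      "invertible L"
    "L *v v = r *\<^sub>R axis 1 1"
    using adapted[OF q] by metis
  define K where "K = matrix_inv L"
  have K: "L *v (K *v x) = x" "K *v (L *v x) = x" for x
    using invertible_matrix_inv[OF L(4)] by (simp_all add: K_def matrix_vector_mul_assoc)
  have G: "G q x y = (L *v x) \<bullet> (L *v y)" for x y
    unfolding G_def L(2) by (rule inner_transpose_mult)
  show ?thesis
  proof (rule that[of "\<lambda>i. K *v axis i 1" r]; (unfold adapted_frame_def, intro conjI allI)?)
    show "F q (K *v axis i 1) (K *v axis j 1) (K *v axis k 1) = phi0 i j k" for i j k
      unfolding F_def L(1) form3_pull3 K form3_axis ..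
    show "H q (K *v axis i 1) (K *v axis j 1) (K *v axis k 1) (K *v axis l 1) = psi0 i j k l" for i j k l
      unfolding H_def L(3) form4_pull4 K form4_axis ..
    show "G q (K *v axis i 1) (K *v axis j 1) = of_bool (i = j)" for i j
      unfolding G K by (simp add: inner_axis_axis)
    show "v = r *\<^sub>R (K *v axis 1 1)"
      using arg_cong[OF L(5), of "(*v) K"] unfolding K by (simp add: matrix_vector_mult_scaleR)
    show "x = (\<Sum>i\<in>UNIV. G q (K *v axis i 1) x *\<^sub>R (K *v axis i 1))" for x
    proof -
      have "K *v (L *v x) = K *v (\<Sum>i\<in>UNIV. (L *v x) $ i *\<^sub>R axis i 1)"
        using basis_expansion[of "L *v x"] by (simp add: scalar_mult_eq_scaleR)
      also have "\<dots> = (\<Sum>i\<in>UNIV. (L *v x) $ i *\<^sub>R (K *v axis i 1))"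
        by (simp add: linear_sum[OF matrix_vector_mul_linear] matrix_vector_mult_scaleR)
      finally show ?thesis unfolding G K by (simp add: inner_axis')
    qed
  qed
qed

text \<open>Near \<open>q\<close> the function \<tau> is a quotient of a component of
  \<open>d\<phi>\<close> and one of \<open>4\<psi>\<close>, hence differentiable. Then
  \<open>d(d\<phi>) = 0\<close> and \<open>d\<psi> = 0\<close> give
  \<open>d\<tau> \<and> \<psi> = 0\<close>, and wedging with \<psi> is injective on 1-forms.\<close>

lemma \<tau>_has_derivative_0:
  assumes q: "q \<in> S"
  shows "(\<tau> has_derivative (\<lambda>_. 0)) (at q)"
proof -
  obtain E and r :: real where "adapted_frame q E" "0 = r *\<^sub>R E 1"
    using exists_adapted_frame[OF q] by blast
  note E = adapted_frameD(3,4)[OF this(1)]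
  have "\<exists>D. ((\<lambda>p. DF p x y z t) has_derivative D) (at q)" for x y z t
    using differentiable_DF[OF q] unfolding differentiable_def .
  then obtain D2 where D2: "\<And>x y z t. ((\<lambda>p. DF p x y z t) has_derivative D2 x y z t) (at q)" by metis
  have D2_sym: "D2 x y z t w = D2 w y z t x" for x y z t w
    by (rule second_derivative_symmetric[OF open_S q has_derivative_F D2 D2])
  have alt: "((\<lambda>p. alt4 (DF p) y z t u) has_derivative (\<lambda>x. alt4 (\<lambda>y z t u. D2 y z t u x) y z t u)) (at q)" for y z t u
    unfolding alt4_def by (intro has_derivative_add has_derivative_diff D2)
  \<comment> \<open>This component of \<psi> is 1 at \<open>q\<close>, so it stays nonzero nearby
    and can serve as a denominator. The vectors of the frame are kept constant.\<close>
  define Q where "Q p = H p (E 4) (E 5) (E 6) (E 7)" for p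
  have Q: "(Q has_derivative (\<lambda>x. DH q x (E 4) (E 5) (E 6) (E 7))) (at q)"
    unfolding Q_def by (rule has_derivative_H[OF q])
  have Qq: "Q q = 1" unfolding Q_def E by (simp only: psi0_table)
  have "isCont Q q" using Q has_derivative_continuous by blast
  then have "\<forall>\<^sub>F p in at q. Q p \<noteq> 0"
    using Qq unfolding isCont_def by (intro tendsto_imp_eventually_ne) auto
  then have ev: "\<forall>\<^sub>F p in at q. alt4 (DF p) (E 4) (E 5) (E 6) (E 7) / (4 * Q p) = \<tau> p"
    using eventually_at_in_open'[OF open_S q]
    by eventually_elim (simp add: alt4_DF Q_def)
  have at_q: "alt4 (DF q) (E 4) (E 5) (E 6) (E 7) / (4 * Q q) = \<tau> q"
    using Qq by (simp add: alt4_DF[OF q] Q_def)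
  have "(\<lambda>p. alt4 (DF p) (E 4) (E 5) (E 6) (E 7)) differentiable (at q)"
    using alt unfolding differentiable_def by blast
  moreover have "(\<lambda>p. 4 * Q p) differentiable (at q)"
    using Q by (intro differentiable_mult differentiable_const) (auto simp: differentiable_def)
  ultimately have "(\<lambda>p. alt4 (DF p) (E 4) (E 5) (E 6) (E 7) / (4 * Q p)) differentiable (at q)"
    by (rule differentiable_divide) (simp add: Qq)
  then obtain \<tau>' where "((\<lambda>p. alt4 (DF p) (E 4) (E 5) (E 6) (E 7) / (4 * Q p)) has_derivative \<tau>') (at q)"
    unfolding differentiable_def by blast
  then have \<tau>': "(\<tau> has_derivative \<tau>') (at q)"
    by (rule has_derivative_transform_eventually[OF _ ev at_q UNIV_I])
  have lin: "linear \<tau>'" using \<tau>' has_derivative_linear by blast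
  have zero: "alt5 (\<lambda>x y z t u. \<tau>' x * H q y z t u) x y z t u = 0" for x y z t u
  proof -
    have "((\<lambda>p. 4 * (\<tau> p * H p y z t u)) has_derivative (\<lambda>x. 4 * (\<tau> q * DH q x y z t u
        + \<tau>' x * H q y z t u))) (at q)" for y z t u
      by (intro has_derivative_mult_right has_derivative_mult \<tau>' has_derivative_H[OF q])
    then have "((\<lambda>p. alt4 (DF p) y z t u) has_derivative (\<lambda>x. 4 * (\<tau> q * DH q x y z t u
        + \<tau>' x * H q y z t u))) (at q)" for y z t u
      by (rule has_derivative_transform_within_open[OF _ open_S q]) (simp add: alt4_DF)
    then have eq: "alt4 (\<lambda>y z t u. D2 y z t u x) y z t u = 4 * (\<tau> q * DH q x y z t u
        + \<tau>' x * H q y z t u)" for x y z t u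
      by (rule has_derivative_unique[OF alt, THEN fun_cong])
    have "alt5 (\<lambda>x y z t u. alt4 (\<lambda>y z t u. D2 y z t u x) y z t u) x y z t u = 0"
      unfolding alt5_def alt4_def
      by (simp add: D2_sym[of y _ _ _ x] D2_sym[of z _ _ _ x] D2_sym[of t _ _ _ x] D2_sym[of u _ _ _ x]
         D2_sym[of z _ _ _ y] D2_sym[of t _ _ _ y] D2_sym[of u _ _ _ y] D2_sym[of t _ _ _ z] D2_sym[of u _ _ _ z]
             D2_sym[of u _ _ _ t])
    then have "4 * (\<tau> q * alt5 (DH q) x y z t u + alt5 (\<lambda>x y z t u. \<tau>' x * H q y z t u) x y z t u) = 0"
      unfolding eq alt5_def by (simp add: algebra_simps)
    then show ?thesis by (simp add: alt5_DH[OF q])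
  qed
  have "\<tau>' (E i) = 0" for i
  proof -
    \<comment> \<open>The supports of the components of \<open>psi0\<close> are the complements of
      the lines of a Fano plane, and two of them share exactly two indices. So with a support and
      one further index only one of the five terms is nonzero.\<close>
    have "\<forall>i. \<tau>' (E i) = 0"
      unfolding forall_7
      using zero[of "E 1" "E 4" "E 5" "E 6" "E 7"] zero[of "E 2" "E 4" "E 5" "E 6" "E 7"] zero[of "E 3" "E 4" "E 5"
          "E 6" "E 7"]
       zero[of "E 4" "E 2" "E 3" "E 6" "E 7"] zero[of "E 5" "E 2" "E 3" "E 6" "E 7"]
       zero[of "E 6" "E 2" "E 3" "E 4" "E 5"] zero[of "E 7" "E 2" "E 3" "E 4" "E 5"]
      unfolding alt5_def E(1) by (simp only: psi0_table mult_zero_right mult_1_right mult_minus1_right diff_0_right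
          diff_0 add_0_right add_0_left neg_equal_0_iff_equal minus_zero diff_zero)
    then show ?thesis by blast
  qed
  then have "\<tau>' x = 0" for x
    using arg_cong[OF E(2)[of x, symmetric], of \<tau>'] by (simp add: linear_sum[OF lin] linear_scale[OF lin])
  then have "\<tau>' = (\<lambda>_. 0)" by blast
  then show ?thesis using \<tau>' by simp
qed
end

section \<open>Solving for the derivative of the vector field\<close>

text \<open>The components of \<open>k\<close> times the deformed dual form when \<open>v\<close> is
  \<open>r\<close> times the first frame vector.\<close>

definition Xi0 :: "real \<Rightarrow> 7 \<Rightarrow> 7 \<Rightarrow> 7 \<Rightarrow> 7 \<Rightarrow> real" where
  "Xi0 r i j k l = (1 + r * r) * psi0 i j k l + wedge13 (\<lambda>i. r * of_bool (i = 1)) (phi0_deformed r) i j k l"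

definition wedge23 :: "('a \<Rightarrow> 'a \<Rightarrow> real) \<Rightarrow> ('a \<Rightarrow> 'a \<Rightarrow> 'a \<Rightarrow> real) \<Rightarrow> 'a \<Rightarrow> 'a \<Rightarrow> 'a \<Rightarrow> 'a \<Rightarrow> 'a \<Rightarrow> real" where
  "wedge23 w f x y z t u = w x y * f z t u - w x z * f y t u + w x t * f y z u - w x u * f y z t
     + w y z * f x t u - w y t * f x z u + w y u * f x z t + w z t * f x y u - w z u * f x y t + w t u * f x y z"

text \<open>The sum over the six shuffles of an array that is antisymmetric in its first and in its
  last pair. This is what the torsion of \<open>B\<close> leaves of the exterior derivative of a
  3-form.\<close>

definition wedge22 :: "('a \<Rightarrow> 'a \<Rightarrow> 'a \<Rightarrow> 'a \<Rightarrow> real) \<Rightarrow> 'a \<Rightarrow> 'a \<Rightarrow> 'a \<Rightarrow> 'a \<Rightarrow> real" where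
  "wedge22 A x y z t = A x y z t - A x z y t + A x t y z + A y z x t - A y t x z + A z t x y"

text \<open>One block of twelve off-diagonal unknowns. The first eight equations come from
  \<open>d\<phi>'\<close>, the last four from \<open>d\<psi>'\<close>. Eliminating all unknowns but
  \<open>a\<close> and \<open>b\<close> leaves a 2 by 2 system with determinant
  \<open>(3 + r\<^sup>2)\<^sup>2 + 4 r\<^sup>2\<close>, which is positive.\<close>

lemma torsion_triple:
  fixes r a b c d :: real
  assumes "b - e46 + e57 = 0" "b + e64 - e75 = 0" "- a + e47 + e56 = 0" "- a - e65 - e74 = 0"
    "c + e47 - e65 = 0" "- d - e46 - e75 = 0" "- d + e57 + e64 = 0" "- c - e56 + e74 = 0"
    and "3 * r * (1 + r * r) * a - 3 * (1 + r * r) * b + r * (1 + 3 * (r * r)) * c + (3 + r * r) * d + 3 * (1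
        + r * r) * (e46 - e64) = 0"
    and "- (3 * (1 + r * r) * a) - 3 * r * (1 + r * r) * b + (3 + r * r) * c - r * (1 + 3 * (r * r)) * d + 3 * (1
        + r * r) * (e47 - e74) = 0"
    and "- (3 * (1 + r * r) * a) - 3 * r * (1 + r * r) * b + (3 + r * r) * c - r * (1 + 3 * (r * r)) * d + 3 * (1
        + r * r) * (e56 - e65) = 0"
    and "- (3 * r * (1 + r * r) * a) + 3 * (1 + r * r) * b - r * (1 + 3 * (r * r)) * c - (3 + r * r) * d + 3 * (1
        + r * r) * (e57 - e75) = 0"
  shows "a = 0 \<and> b = 0 \<and> c = 0 \<and> d = 0 \<and> e46 = 0 \<and> e47 = 0 \<and> e56 = 0 \<and> e57 = 0 \<and> e64 = 0 \<and> e65 = 0 \<and> e74 = 0 \<and> e75 = 0"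
proof -
  have h: "1 + r * r \<noteq> 0" "3 + r * r \<noteq> 0" by (smt (verit) zero_le_square)+
  have "3 * (1 + r * r) * (e46 - e64 + (e57 - e75)) = 0"
    using assms(9,12) by (simp add: algebra_simps)
  then have 1: "e46 - e64 + (e57 - e75) = 0" using h by simp
  have "3 * (1 + r * r) * ((e47 - e74) - (e56 - e65)) = 0"
    using assms(10,11) by (simp add: algebra_simps)
  then have 2: "(e47 - e74) - (e56 - e65) = 0" using h by simp
  have s: "c = - a" "d = - b" "e46 - e64 = b" "e47 - e74 = a" using assms(1-8) 1 2 by linarith+
  have 3: "2 * r * a = (3 + r * r) * b" using assms(9) unfolding s by (simp add: algebra_simps)
  have 4: "(3 + r * r) * a = - 2 * r * b" using assms(10) unfolding s by (simp add: algebra_simps)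
  have "((3 + r * r) * (3 + r * r) + 4 * (r * r)) * b = 0"
    using arg_cong[OF 3, of "\<lambda>x. (3 + r * r) * x"] arg_cong[OF 4, of "\<lambda>x. 2 * r * x"] by (simp add: algebra_simps)
  moreover have "(3 + r * r) * (3 + r * r) + 4 * (r * r) \<noteq> 0"
    by (smt (verit) zero_le_square mult_pos_pos)
  ultimately have b: "b = 0" by simp
  then have a: "a = 0" using 4 h by simp
  show ?thesis using a b s assms(1-8) 1 2 by linarith
qed

text \<open>The three uses of \<open>torsion_triple\<close> are permuted by the automorphism
  \<open>2 \<rightarrow> 4 \<rightarrow> 6 \<rightarrow> 2\<close>, \<open>3 \<rightarrow> 5 \<rightarrow> 7 \<rightarrow> 3\<close> of \<open>phi0\<close>.\<close>

lemma torsion_equations_solved: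
  fixes N :: "7 \<Rightarrow> 7 \<Rightarrow> real"
  assumes E1: "\<And>i j k l. (2 * t / 3) * wedge22 (\<lambda>i j k l. \<Sum>m\<in>UNIV. phi0 i j m * phi0_deformed r m k l) i j k l
      + alt4 (\<lambda>i j k l. \<Sum>m\<in>UNIV. N i m * psi0 j k l m) i j k l = 4 * b * Xi0 r i j k l"
    and E2: "\<And>i j k l m. 3 * (1 + r * r) * wedge23 (\<lambda>i j. N i j - N j i
        + (2 * t / 3) * (r * phi0 i j 1)) (phi0_deformed r) i j k l m
      + alt5 (\<lambda>i j k l m. 2 * r * N i 1 * (3 * (1 + r * r) * psi0 j k l m - Xi0 r j k l m)) i j k l m
      - 12 * (1 + r * r) * b * alt5 (\<lambda>i j k l m. r * of_bool (i = 1) * Xi0 r j k l m) i j k l m = 0"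
  shows "N i j = (t - b * (1 + r * r)) * of_bool (i = j) + 4 * b * (r * r) * of_bool (i = 1 \<and> j = 1) + (4 * b
      - 2 * t) / 3 * (r * phi0 1 i j)"
proof -
  note eval = wedge22_def alt4_def Xi0_def wedge13_def phi0_deformed_def phi0_contract phi0_table psi0_table sum_7 neq_7
  have E1s: "\<forall>i j k l. idx7 i < idx7 j \<longrightarrow> idx7 j < idx7 k \<longrightarrow> idx7 k < idx7 l
      \<longrightarrow> (2 * t / 3) * wedge22 (\<lambda>i j k l. \<Sum>m\<in>UNIV. phi0 i j m * phi0_deformed r m k l) i j k l
      + alt4 (\<lambda>i j k l. \<Sum>m\<in>UNIV. N i m * psi0 j k l m) i j k l = 4 * b * Xi0 r i j k l"
    using E1 by blast
  note e1 = E1s[unfolded all_sorted4, simplified eval, simplified]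
  note eval2 = wedge23_def alt5_def Xi0_def wedge13_def phi0_deformed_def phi0_table psi0_table neq_7
  have z1: "N 1 2 = 0 \<and> N 1 3 = 0 \<and> N 2 1 = 0 \<and> N 3 1 = 0 \<and> N 4 6 = 0 \<and> N 4 7 = 0 \<and> N 5 6 = 0 \<and> N 5 7 = 0 \<and> N 6 4
      = 0 \<and> N 6 5 = 0 \<and> N 7 4 = 0 \<and> N 7 5 = 0"
    by (rule torsion_triple[where r = r]; (use e1 in \<open>elim conjE; linarith\<close>)?)
      (use E2[of 1 2 3 4 6, simplified eval2, simplified] E2[of 1 2 3 4 7, simplified eval2, simplified]
          E2[of 1 2 3 5 6, simplified eval2, simplified] E2[of 1 2 3 5 7, simplified eval2, simplified]
          in \<open>simp_all add: algebra_simps\<close>)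
  have z2: "N 1 4 = 0 \<and> N 1 5 = 0 \<and> N 4 1 = 0 \<and> N 5 1 = 0 \<and> N 6 2 = 0 \<and> N 6 3 = 0 \<and> N 7 2 = 0 \<and> N 7 3 = 0 \<and> N 2 6
      = 0 \<and> N 2 7 = 0 \<and> N 3 6 = 0 \<and> N 3 7 = 0"
    by (rule torsion_triple[where r = r]; (use e1 in \<open>elim conjE; linarith\<close>)?)
      (use E2[of 1 2 4 5 6, simplified eval2, simplified] E2[of 1 3 4 5 6, simplified eval2, simplified]
          E2[of 1 2 4 5 7, simplified eval2, simplified] E2[of 1 3 4 5 7, simplified eval2, simplified]
          in \<open>simp_all add: algebra_simps\<close>)
  have z3: "N 1 6 = 0 \<and> N 1 7 = 0 \<and> N 6 1 = 0 \<and> N 7 1 = 0 \<and> N 2 4 = 0 \<and> N 2 5 = 0 \<and> N 3 4 = 0 \<and> N 3 5 = 0 \<and> N 4 2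
      = 0 \<and> N 4 3 = 0 \<and> N 5 2 = 0 \<and> N 5 3 = 0"
    by (rule torsion_triple[where r = r]; (use e1 in \<open>elim conjE; linarith\<close>)?)
      (use E2[of 1 2 4 6 7, simplified eval2, simplified] E2[of 1 2 5 6 7, simplified eval2, simplified]
          E2[of 1 3 4 6 7, simplified eval2, simplified] E2[of 1 3 5 6 7, simplified eval2, simplified]
          in \<open>simp_all add: algebra_simps\<close>)
  have w: "4 * b * (1 + r * r) = 4 * b + 4 * (b * (r * r))" "b * (1 + r * r) = b + b * (r * r)" "4 * b * (r * r)
      = 4 * (b * (r * r))" "4 * b * r = 4 * (b * r)"
    by (simp_all add: algebra_simps)
  have diag: "N 1 1 = t - b * (1 + r * r) + 4 * b * (r * r)" "N 2 2 = t - b * (1 + r * r)" "N 3 3 = t - b * (1 + r * r)"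
    "N 4 4 = t - b * (1 + r * r)" "N 5 5 = t - b * (1 + r * r)" "N 6 6 = t - b * (1 + r * r)" "N 7 7 = t - b * (1
        + r * r)"
    using e1 unfolding w by (elim conjE; linarith)+
  have h: "1 + r * r \<noteq> 0" by (smt (verit) zero_le_square)
  have sum: "N 2 3 - N 3 2 + (N 4 5 - N 5 4) = (16 * (b * r) - 8 * (r * t)) / 3"
    "N 2 3 - N 3 2 + (N 6 7 - N 7 6) = (16 * (b * r) - 8 * (r * t)) / 3"
    "N 4 5 - N 5 4 + (N 6 7 - N 7 6) = (16 * (b * r) - 8 * (r * t)) / 3"
  proof -
    have "X = (16 * (b * r) - 8 * (r * t)) / 3"
      if "(3 + 3 * (r * r)) * (4 * (r * t) / 3 + X) + 2 * r * N 1 1 * (2 + 2 * (r * r)) = (12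
          + 12 * (r * r)) * b * (r * (1 + r * r))" for X
    proof -
      have "(1 + r * r) * (3 * X - (16 * (b * r) - 8 * (r * t))) = 0"
        using that unfolding diag(1) by (simp add: field_simps)
      then show ?thesis using h by simp
    qed
    note X = this
    show "N 2 3 - N 3 2 + (N 4 5 - N 5 4) = (16 * (b * r) - 8 * (r * t)) / 3"
      by (rule X) (use E2[of 1 2 3 4 5, simplified eval2, simplified] in \<open>simp add: algebra_simps\<close>)
    show "N 2 3 - N 3 2 + (N 6 7 - N 7 6) = (16 * (b * r) - 8 * (r * t)) / 3"
      by (rule X) (use E2[of 1 2 3 6 7, simplified eval2, simplified] in \<open>simp add: algebra_simps\<close>)
    show "N 4 5 - N 5 4 + (N 6 7 - N 7 6) = (16 * (b * r) - 8 * (r * t)) / 3"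
      by (rule X) (use E2[of 1 4 5 6 7, simplified eval2, simplified] in \<open>simp add: algebra_simps\<close>)
  qed
  \<comment> \<open>The first equation makes \<open>N\<close> antisymmetric on each of the three
    lines; the three pairwise sums just found then fix each entry.\<close>
  have off: "N 2 3 = (4 * b - 2 * t) / 3 * r" "N 3 2 = - ((4 * b - 2 * t) / 3 * r)"
    "N 4 5 = (4 * b - 2 * t) / 3 * r" "N 5 4 = - ((4 * b - 2 * t) / 3 * r)"
    "N 6 7 = (4 * b - 2 * t) / 3 * r" "N 7 6 = - ((4 * b - 2 * t) / 3 * r)"
  proof -
    have c: "(4 * b - 2 * t) / 3 * r = (4 * (b * r) - 2 * (r * t)) / 3" by (simp add: algebra_simps)
    have q: "N 2 3 + N 4 5 + N 6 7 = 4 * (b * r) - 2 * (r * t)" "N 5 4 - N 2 3 + N 7 6 = 2 * (r * t) - 4 * (b * r)"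
      "N 3 2 - N 4 5 + N 7 6 = 2 * (r * t) - 4 * (b * r)" "N 3 2 + N 5 4 - N 6 7 = 2 * (r * t) - 4 * (b * r)"
      using e1 unfolding w by (elim conjE; linarith)+
    have "N 2 3 + N 3 2 = 0" "N 4 5 + N 5 4 = 0" "N 6 7 + N 7 6 = 0"
      using q by linarith+
    moreover have "N 2 3 - N 3 2 = 2 * (4 * (b * r) - 2 * (r * t)) / 3" "N 4 5 - N 5 4 = 2 * (4 * (b * r)
        - 2 * (r * t)) / 3"
      "N 6 7 - N 7 6 = 2 * (4 * (b * r) - 2 * (r * t)) / 3"
      using sum by (simp_all add: field_simps)
    ultimately show "N 2 3 = (4 * b - 2 * t) / 3 * r" "N 3 2 = - ((4 * b - 2 * t) / 3 * r)"
      "N 4 5 = (4 * b - 2 * t) / 3 * r" "N 5 4 = - ((4 * b - 2 * t) / 3 * r)"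
      "N 6 7 = (4 * b - 2 * t) / 3 * r" "N 7 6 = - ((4 * b - 2 * t) / 3 * r)"
      unfolding c by (simp_all add: field_simps)
  qed
  have "\<forall>i j. N i j = (t - b * (1 + r * r)) * of_bool (i = j) + 4 * b * (r * r) * of_bool (i = 1 \<and> j = 1) + (4 * b
      - 2 * t) / 3 * (r * phi0 1 i j)"
    unfolding forall_7 by (simp add: diag off z1 z2 z3 phi0_table neq_7 del: eq_numeral_iff_iszero)
  then show ?thesis by blast
qed

section \<open>The local obstruction\<close>

locale deformed_pair = base: nearly_parallel_G2 S \<phi> g vol \<tau> + def: nearly_parallel_G2 S \<phi>' g' vol' \<tau>'
  for S \<phi> g vol \<tau> \<phi>' g' vol' \<tau>' +
  fixes v :: "real^7 \<Rightarrow> real^7"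
  assumes smooth_v: "\<And>i. smooth_on S (\<lambda>q. v q $ i)"
    and \<phi>'_eq: "\<And>q b c d. q \<in> S \<Longrightarrow>
      \<phi>' q b c d = \<phi> q b c d + (\<Sum>e\<in>UNIV. v q $ e * hodge3 (g q) (vol q) (\<phi> q) b c d e)"
begin

abbreviation "F \<equiv> base.F"
abbreviation "G \<equiv> base.G"
abbreviation "H \<equiv> base.H"
abbreviation "P \<equiv> base.P"
abbreviation "B \<equiv> base.B"
abbreviation "F' \<equiv> def.F"
abbreviation "H' \<equiv> def.H"
abbreviation "v' q \<equiv> frechet_derivative v (at q)"

section \<open>The linear equations for the derivative of the vector field\<close>

definition h where "h q = 1 + G q (v q) (v q)"
definition k where "k q = root 3 (h q)"
text \<open>\<open>M\<close> is the derivative of \<open>v\<close> with respect to the connection that makes \<open>\<phi>\<close> parallel.\<close>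

definition M where "M q x = v' q x + B q x (v q)"
definition Xi where "Xi q x y z t = h q * H q x y z t + wedge13 (G q (v q)) (F' q) x y z t"
text \<open>With this factor \<open>\<tau>' \<psi>'\<close> equals \<open>b\<close> times
  \<open>Xi\<close>, so no cube root appears in the torsion equations.\<close>

definition b where "b q = \<tau>' q / k q"

lemma F'_eq: "q \<in> S \<Longrightarrow> F' q x y z = F q x y z + H q x y z (v q)"
proof -
  assume q: "q \<in> S"
  have "\<phi>' q = (\<lambda>b c d. \<phi> q b c d + (\<Sum>e\<in>UNIV. v q $ e * hodge3 (g q) (vol q) (\<phi> q) b c d e))"
    using \<phi>'_eq[OF q] by blast
  then show ?thesis
    unfolding base.F_def def.F_def base.H_def form4_def by (simp add: form3_def distrib_left sum.distrib)
qed

lemma h_pos: "q \<in> S \<Longrightarrow> h q > 0"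
  using base.g_pos[of q "v q"] unfolding h_def base.G_def by (cases "v q = 0") auto

lemma k_pos: "q \<in> S \<Longrightarrow> k q > 0"
  unfolding k_def using h_pos by simp

lemma k_cube: "q \<in> S \<Longrightarrow> k q * k q * k q = h q"
  using h_pos[of q] real_root_pow_pos2[of 3 "h q"] unfolding k_def by (simp add: power3_eq_cube)

lemma H'_eq: "q \<in> S \<Longrightarrow> H' q x y z t = Xi q x y z t / k q"
proof -
  assume q: "q \<in> S"
  obtain L r where L: "\<phi> q = pull3 L phi0" "g q = transpose L ** L" "hodge3 (g q) (vol q) (\<phi> q) = pull4 L psi0"
    "L *v v q = r *\<^sub>R axis 1 1"
    using base.adapted[OF q] by metis
  have "\<phi>' q = (\<lambda>b c d. \<phi> q b c d + (\<Sum>e\<in>UNIV. v q $ e * hodge3 (g q) (vol q) (\<phi> q) b c d e))"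
    using \<phi>'_eq[OF q] by blast
  from deformed_hodge[OF L this def.vol_square[OF q] def.g_pos[OF q] def.g_vol[OF q]]
  show ?thesis
    unfolding Xi_def k_def h_def base.G_def base.H_def def.H_def def.F_def .
qed

lemma has_derivative_v: "q \<in> S \<Longrightarrow> (v has_derivative v' q) (at q)"
  using differentiable_vec[of v q] smooth_on_differentiable[OF smooth_v] frechet_derivative_works by blast

lemma linear_M: "q \<in> S \<Longrightarrow> linear (M q)"
  unfolding M_def by (intro linear_compose_add base.linear_B has_derivative_linear[OF has_derivative_v])

text \<open>The form \<open>\<phi>'\<close> is built from the parallel \<phi> and \<psi> and from
  \<open>v\<close>. So \<open>B\<close> acts on the constant arguments, and the only further term is
  \<psi> with \<open>v\<close> replaced by its covariant derivative \<open>M q x\<close>.\<close>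

lemma DF'_eq:
  assumes q: "q \<in> S"
  shows "def.DF q x y z t = F' q (B q x y) z t + F' q y (B q x z) t + F' q y z (B q x t) + H q y z t (M q x)"
proof -
  have "((\<lambda>p. F p y z t + H p y z t (v p)) has_derivative
      (\<lambda>x. base.DF q x y z t + (base.DH q x y z t (v q) + H q y z t (v' q x)))) (at q)"
    by (intro has_derivative_add base.has_derivative_F[OF q]
        has_derivative_linear_slot[OF base.linear_H(4) base.has_derivative_H[OF q] has_derivative_v[OF q]])
  then have "((\<lambda>p. F' p y z t) has_derivative
      (\<lambda>x. base.DF q x y z t + (base.DH q x y z t (v q) + H q y z t (v' q x)))) (at q)"
    by (rule has_derivative_transform_within_open[OF _ base.open_S q]) (simp add: F'_eq)
  then have "def.DF q x y z t = base.DF q x y z t + (base.DH q x y z t (v q) + H q y z t (v' q x))"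
    by (rule has_derivative_unique[OF def.has_derivative_F[OF q], THEN fun_cong])
  then show ?thesis
    unfolding base.DF_def base.DH_def M_def F'_eq[OF q] by (simp add: base.linear_simps)
qed

text \<open>The equation \<open>d\<phi>' = 4\<tau>'\<psi>'\<close>. The symmetric part of
  \<open>B\<close> cancels, and its antisymmetric part is responsible for the terms with
  \<open>2 * \<tau> q / 3\<close>.\<close>

lemma torsion_equation_1:
  assumes q: "q \<in> S"
  shows "(2 * \<tau> q / 3) * wedge22 (\<lambda>x y z t. F' q (P q x y) z t) x y z t + alt4 (\<lambda>x y z t. H q y z t (M q x)) x y z t
    = 4 * b q * Xi q x y z t"
proof -
  note s1 = def.F_slot(1)[OF q, of _ "B q _ _"] and s2 = def.F_slot(2)[OF q, of _ _ "B q _ _"]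
  note Bc = base.B_commute[OF q, of y x] base.B_commute[OF q, of z x] base.B_commute[OF q, of t x]
    base.B_commute[OF q, of z y] base.B_commute[OF q, of t y] base.B_commute[OF q, of t z]
  have "(2 * \<tau> q / 3) * wedge22 (\<lambda>x y z t. F' q (P q x y) z t) x y z t + alt4 (\<lambda>x y z t. H q y z t (M q x)) x y z t
      = alt4 (def.DF q) x y z t"
    unfolding alt4_def wedge22_def DF'_eq[OF q] s1 s2 unfolding Bc by (simp add: def.linear_simps algebra_simps)
  also have "\<dots> = 4 * b q * Xi q x y z t"
    unfolding def.alt4_DF[OF q] H'_eq[OF q] b_def by simp
  finally show ?thesis .
qed

definition dh where "dh q x = 2 * G q (M q x) (v q)"
text \<open>Here \<alpha> is the metric dual of \<open>v\<close>, and \<open>d\<alpha> q x y\<close>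
  is the full derivative of \<open>\<alpha> y\<close> along \<open>x\<close>, not yet
  antisymmetrised.\<close>

definition d\<alpha> where "d\<alpha> q x y = G q (M q x) y + G q (v q) (B q x y)"

lemma has_derivative_\<alpha>: "q \<in> S \<Longrightarrow> ((\<lambda>p. G p (v p) y) has_derivative (\<lambda>x. d\<alpha> q x y)) (at q)"
proof -
  assume q: "q \<in> S"
  have "((\<lambda>p. G p (v p) y) has_derivative (\<lambda>x. (G q (B q x (v q)) y + G q (v q) (B q x y)) + G q (v' q x) y)) (at q)"
    by (rule has_derivative_linear_slot[OF base.linear_G(1) base.has_derivative_G[OF q] has_derivative_v[OF q]])
  then show ?thesis unfolding d\<alpha>_def M_def by (simp add: base.linear_simps algebra_simps)
qed

lemma has_derivative_h: "q \<in> S \<Longrightarrow> (h has_derivative dh q) (at q)"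
proof -
  assume q: "q \<in> S"
  have "((\<lambda>p. G p (v p) (v p)) has_derivative (\<lambda>x. d\<alpha> q x (v q) + G q (v q) (v' q x))) (at q)"
    by (rule has_derivative_linear_slot[OF base.linear_G(2) has_derivative_\<alpha>[OF q] has_derivative_v[OF q]])
  then have "((\<lambda>p. 1 + G p (v p) (v p)) has_derivative (\<lambda>x. d\<alpha> q x (v q) + G q (v q) (v' q x))) (at q)"
    using has_derivative_add[OF has_derivative_const[of 1]] by fastforce
  moreover have "(\<lambda>x. d\<alpha> q x (v q) + G q (v q) (v' q x)) = dh q"
  proof
    show "d\<alpha> q x (v q) + G q (v q) (v' q x) = dh q x" for x
      using base.G_sym[OF q, of "v q" "M q x"] unfolding d\<alpha>_def dh_def M_def by (simp add: base.linear_simps)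
  qed
  ultimately show ?thesis unfolding h_def[abs_def] by simp
qed

lemma has_derivative_k: "q \<in> S \<Longrightarrow> (k has_derivative (\<lambda>x. dh q x / (3 * (k q * k q)))) (at q)"
proof -
  assume q: "q \<in> S"
  have "(k has_derivative (\<lambda>x. dh q x * inverse (real 3 * root 3 (h q) ^ (3 - Suc 0)))) (at q)"
    unfolding k_def[abs_def]
    by (rule DERIV_compose_FDERIV[OF DERIV_real_root has_derivative_h[OF q]]) (use h_pos[OF q] in auto)
  moreover have "real 3 * root 3 (h q) ^ (3 - Suc 0) = 3 * (k q * k q)"
    unfolding k_def by (simp add: power2_eq_square)
  ultimately show ?thesis by (simp only: divide_inverse)
qed

text \<open>The exterior derivative of
  \<open>k \<psi>' = h \<psi> + \<alpha> \<and> \<phi>'\<close>, in which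
  \<open>d\<psi>' = 0\<close> and \<open>d\<psi> = 0\<close>, multiplied by \<open>3 h\<close>. The
  multiplier removes the cube root: \<open>h = k ^ 3\<close> gives
  \<open>3 h dk \<and> \<psi>' = dh \<and> Xi\<close>.\<close>

lemma torsion_equation_2:
  assumes q: "q \<in> S"
  shows "3 * h q * wedge23 (\<lambda>x y. G q (M q x) y - G q (M q y) x + (2 * \<tau> q / 3) * F q x y (v q)) (F' q) x y z t u
    + alt5 (\<lambda>x y z t u. dh q x * (3 * h q * H q y z t u - Xi q y z t u)) x y z t u
    - 12 * h q * b q * alt5 (\<lambda>x y z t u. G q (v q) x * Xi q y z t u) x y z t u = 0"
proof -
  have kn: "k q \<noteq> 0" using k_pos[OF q] by simp
  define dk where "dk x = dh q x / (3 * (k q * k q))" for x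
  define W where "W x y z t u = (G q (v q) y * def.DF q x z t u + d\<alpha> q x y * F' q z t u)
      - (G q (v q) z * def.DF q x y t u + d\<alpha> q x z * F' q y t u)
      + (G q (v q) t * def.DF q x y z u + d\<alpha> q x t * F' q y z u)
      - (G q (v q) u * def.DF q x y z t + d\<alpha> q x u * F' q y z t)" for x y z t u
  have "k q * def.DH q x y z t u + dk x * H' q y z t u = h q * base.DH q x y z t u + dh q x * H q y z t u
      + W x y z t u" for x y z t u
  proof -
    have "((\<lambda>p. k p * H' p y z t u) has_derivative (\<lambda>x. k q * def.DH q x y z t u + dk x * H' q y z t u)) (at q)"
      unfolding dk_def by (rule has_derivative_mult[OF has_derivative_k[OF q] def.has_derivative_H[OF q]])
    moreover have "((\<lambda>p. h p * H p y z t u + wedge13 (G p (v p)) (F' p) y z t u) has_derivative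
        (\<lambda>x. (h q * base.DH q x y z t u + dh q x * H q y z t u) + W x y z t u)) (at q)"
      unfolding wedge13_def W_def
      by (intro has_derivative_add has_derivative_diff has_derivative_mult has_derivative_h[OF q]
          base.has_derivative_H[OF q]
          has_derivative_\<alpha>[OF q] def.has_derivative_F[OF q])
    then have "((\<lambda>p. k p * H' p y z t u) has_derivative
        (\<lambda>x. (h q * base.DH q x y z t u + dh q x * H q y z t u) + W x y z t u)) (at q)"
    proof (rule has_derivative_transform_within_open[OF _ base.open_S q])
      show "h p * H p y z t u + wedge13 (G p (v p)) (F' p) y z t u = k p * H' p y z t u" if "p \<in> S" for p
        using k_pos[OF that] unfolding H'_eq[OF that] Xi_def by simp
    qed
    ultimately show ?thesis
      by (rule has_derivative_unique[THEN fun_cong])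
  qed
  then have "alt5 (\<lambda>x y z t u. k q * def.DH q x y z t u + dk x * H' q y z t u) x y z t u =
      alt5 (\<lambda>x y z t u. h q * base.DH q x y z t u + dh q x * H q y z t u + W x y z t u) x y z t u" by simp
  then have "k q * alt5 (def.DH q) x y z t u + alt5 (\<lambda>x y z t u. dk x * H' q y z t u) x y z t u =
      h q * alt5 (base.DH q) x y z t u + alt5 (\<lambda>x y z t u. dh q x * H q y z t u) x y z t u + alt5 W x y z t u"
    unfolding alt5_def by (simp add: algebra_simps)
  moreover have "alt5 W x y z t u = wedge23 (\<lambda>x y. d\<alpha> q x y - d\<alpha> q y x) (F' q) x y z t u
      - alt5 (\<lambda>x y z t u. G q (v q) x * alt4 (def.DF q) y z t u) x y z t u"
    unfolding alt5_def alt4_def wedge23_def W_def by (simp add: algebra_simps)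
  moreover have "d\<alpha> q x y - d\<alpha> q y x = G q (M q x) y - G q (M q y) x + (2 * \<tau> q / 3) * F q x y (v q)" for x y
    unfolding d\<alpha>_def base.B_commute[OF q, of y x] by (simp add: base.linear_simps base.G_P[OF q])
  ultimately have eq: "alt5 (\<lambda>x y z t u. dk x * H' q y z t u) x y z t u
      = alt5 (\<lambda>x y z t u. dh q x * H q y z t u) x y z t u
      + wedge23 (\<lambda>x y. G q (M q x) y - G q (M q y) x + (2 * \<tau> q / 3) * F q x y (v q)) (F' q) x y z t u
      - alt5 (\<lambda>x y z t u. G q (v q) x * (4 * \<tau>' q * H' q y z t u)) x y z t u"
    unfolding base.alt5_DH[OF q] def.alt5_DH[OF q] def.alt4_DF[OF q] by simp
  have "3 * h q * (dk x * H' q y z t u) = dh q x * Xi q y z t u" for x y z t u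
    unfolding dk_def H'_eq[OF q] k_cube[OF q, symmetric] using kn by (simp add: field_simps)
  then have 1: "3 * h q * alt5 (\<lambda>x y z t u. dk x * H' q y z t u) x y z t u
      = alt5 (\<lambda>x y z t u. dh q x * Xi q y z t u) x y z t u"
    unfolding alt5_def by (simp only: right_diff_distrib distrib_left)
  have "3 * h q * (G q (v q) x * (4 * \<tau>' q * H' q y z t u))
      = 12 * h q * b q * (G q (v q) x * Xi q y z t u)" for x y z t u
    unfolding b_def H'_eq[OF q] by simp
  then have 2: "3 * h q * alt5 (\<lambda>x y z t u. G q (v q) x * (4 * \<tau>' q * H' q y z t u)) x y z t u
      = 12 * h q * b q * alt5 (\<lambda>x y z t u. G q (v q) x * Xi q y z t u) x y z t u"
    unfolding alt5_def by (simp only: right_diff_distrib distrib_left)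
  have 3: "alt5 (\<lambda>x y z t u. dh q x * (3 * h q * H q y z t u - Xi q y z t u)) x y z t u =
      3 * h q * alt5 (\<lambda>x y z t u. dh q x * H q y z t u) x y z t u - alt5 (\<lambda>x y z t u. dh q x * Xi q y z t u) x y z t u"
    unfolding alt5_def by (simp add: algebra_simps)
  show ?thesis using arg_cong[OF eq, of "\<lambda>a. 3 * h q * a"] unfolding 3 1[symmetric] 2[symmetric]
      by (simp add: algebra_simps)
qed

text \<open>In an adapted frame at \<open>q\<close> both torsion equations become the hypotheses of
  \<open>torsion_equations_solved\<close>. The solution is expressed by the metric, \<open>v\<close>
  and the cross product, so it can be read back without the frame.\<close>

lemma M_eq:
  assumes q: "q \<in> S"
  shows "M q x = (\<tau> q - b q * h q) *\<^sub>R x + (4 * b q * G q (v q) x) *\<^sub>R v q + ((4 * b q - 2 * \<tau> q) / 3) *\<^sub>R P q (v q) x"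
proof -
  obtain E r where frame: "base.adapted_frame q E" and v: "v q = r *\<^sub>R E 1"
    using base.exists_adapted_frame[OF q] .
  note E = base.adapted_frameD[OF frame]
  define N where "N i j = G q (M q (E i)) (E j)" for i j
  have hr: "h q = 1 + r * r" unfolding h_def v by (simp add: base.linear_simps E)
  have \<alpha>: "G q (v q) (E i) = r * of_bool (i = 1)" for i
    unfolding v by (simp add: base.linear_simps E)
  have F': "F' q (E i) (E j) (E k) = phi0_deformed r i j k" for i j k
    unfolding F'_eq[OF q] v phi0_deformed_def by (simp add: base.linear_simps E)
  have "H q (E j) (E k) (E l) w = (\<Sum>m\<in>UNIV. G q w (E m) * psi0 j k l m)" for j k l w
  proof -
    have "H q (E j) (E k) (E l) (\<Sum>m\<in>UNIV. G q (E m) w *\<^sub>R E m) = (\<Sum>m\<in>UNIV. G q (E m) w * psi0 j k l m)"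
      by (simp add: linear_sum[OF base.linear_H(4)] base.linear_simps E(3))
    then show ?thesis unfolding E(4) using base.G_sym[OF q] by simp
  qed
  then have HM: "H q (E j) (E k) (E l) (M q (E i)) = (\<Sum>m\<in>UNIV. N i m * psi0 j k l m)" for i j k l
    unfolding N_def by blast
  have P: "P q (E i) (E j) = (\<Sum>m\<in>UNIV. phi0 i j m *\<^sub>R E m)" for i j
    using E(4)[of "P q (E i) (E j)"] unfolding base.G_P[OF q] E(1) ..
  have F'P: "F' q (P q (E i) (E j)) (E k) (E l) = (\<Sum>m\<in>UNIV. phi0 i j m * phi0_deformed r m k l)" for i j k l
    unfolding P by (simp add: linear_sum[OF def.linear_F(1)] def.linear_simps F')
  have Xi: "Xi q (E i) (E j) (E k) (E l) = Xi0 r i j k l" for i j k l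
    unfolding Xi_def Xi0_def wedge13_def F' \<alpha> hr E(3) ..
  have dh: "dh q (E i) = 2 * r * N i 1" for i
    unfolding dh_def N_def v by (simp add: base.linear_simps)
  have Fv: "F q (E i) (E j) (v q) = r * phi0 i j 1" for i j
    unfolding v by (simp add: base.linear_simps E)
  have N: "N i j = (\<tau> q - b q * (1 + r * r)) * of_bool (i = j) + 4 * b q * (r * r) * of_bool (i = 1 \<and> j = 1)
      + (4 * b q - 2 * \<tau> q) / 3 * (r * phi0 1 i j)" for i j
  proof (rule torsion_equations_solved)
    show "(2 * \<tau> q / 3) * wedge22 (\<lambda>i j k l. \<Sum>m\<in>UNIV. phi0 i j m * phi0_deformed r m k l) i j k l
      + alt4 (\<lambda>i j k l. \<Sum>m\<in>UNIV. N i m * psi0 j k l m) i j k l = 4 * b q * Xi0 r i j k l" for i j k l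
      using torsion_equation_1[OF q, of "E i" "E j" "E k" "E l"] unfolding wedge22_def alt4_def F'P HM Xi .
    show "3 * (1 + r * r) * wedge23 (\<lambda>i j. N i j - N j i + (2 * \<tau> q / 3) * (r * phi0 i j 1)) (phi0_deformed r) i j k l m
      + alt5 (\<lambda>i j k l m. 2 * r * N i 1 * (3 * (1 + r * r) * psi0 j k l m - Xi0 r j k l m)) i j k l m
      - 12 * (1 + r * r) * b q * alt5 (\<lambda>i j k l m. r * of_bool (i = 1) * Xi0 r j k l m) i j k l m = 0" for i j k l m
      using torsion_equation_2[OF q, of "E i" "E j" "E k" "E l" "E m"]
      unfolding wedge23_def alt5_def F' \<alpha> Xi dh Fv hr E(3) N_def[symmetric] .
  qed
  define R where "R x = (\<tau> q - b q * h q) *\<^sub>R x + (4 * b q * G q (v q) x) *\<^sub>R v q + ((4 * b q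
      - 2 * \<tau> q) / 3) *\<^sub>R P q (v q) x" for x
  have R: "linear R"
    unfolding R_def linear_iff
    by (simp add: base.linear_simps linear_add[OF base.linear_P(2)] linear_scale[OF base.linear_P(2)] algebra_simps)
  have "M q (E i) = R (E i)" for i
  proof -
    have "G q (M q (E i)) (E j) = G q (R (E i)) (E j)" for j
    proof -
      have "G q (R (E i)) (E j) = N i j"
        unfolding N R_def \<alpha> hr unfolding v
        by (simp add: base.linear_simps E linear_scale[OF base.linear_P(1)] base.G_P[OF q] of_bool_conj)
      then show ?thesis unfolding N_def ..
    qed
    then have "(\<Sum>j\<in>UNIV. G q (E j) (M q (E i)) *\<^sub>R E j) = (\<Sum>j\<in>UNIV. G q (E j) (R (E i)) *\<^sub>R E j)"
      using base.G_sym[OF q] by simp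
    then show ?thesis unfolding E(4) .
  qed
  then have "M q (\<Sum>i\<in>UNIV. G q (E i) x *\<^sub>R E i) = R (\<Sum>i\<in>UNIV. G q (E i) x *\<^sub>R E i)"
    by (simp add: linear_sum[OF linear_M[OF q]] linear_sum[OF R] linear_scale[OF linear_M[OF q]] linear_scale[OF R])
  then show ?thesis unfolding E(4) R_def .
qed

section \<open>The integrability condition and the contradiction\<close>

lemma \<alpha>_self: "q \<in> S \<Longrightarrow> G q (v q) (v q) = h q - 1"
  unfolding h_def by simp

lemma dh_eq: "q \<in> S \<Longrightarrow> dh q x = 2 * (\<tau> q - b q * h q + 4 * b q * (h q - 1)) * G q (v q) x"
  using base.F_antisym(2)[of q "v q" x "v q"] base.F_antisym(1)[of q "v q" "v q" x] base.G_sym[of q x "v q"]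
  unfolding dh_def M_eq by (simp add: base.linear_simps base.G_P \<alpha>_self algebra_simps)

definition \<gamma> where "\<gamma> q = 2 / 3 * (4 * b q - \<tau> q)"

text \<open>The multiples of the identity and of \<alpha> tensor \<open>v\<close> in
  \<open>M\<close> are symmetric and drop out. The cross product in \<open>M\<close> contributes
  \<open>2 * (4 * b - 2 * \<tau>) / 3\<close>, the torsion of \<open>B\<close> contributes
  \<open>2 * \<tau> / 3\<close>, and the sum is \<gamma>.\<close>

lemma d\<alpha>_antisym: "q \<in> S \<Longrightarrow> d\<alpha> q x y - d\<alpha> q y x = \<gamma> q * F q (v q) x y"
proof -
  assume q: "q \<in> S"
  have "F q (v q) y x = - F q (v q) x y" "F q x y (v q) = F q (v q) x y"
    using base.F_antisym(2)[OF q, of "v q" y x] base.F_slot(2)[OF q, of x y "v q"] by simp_all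
  then show ?thesis
    using base.G_sym[OF q, of x y] unfolding d\<alpha>_def base.B_commute[OF q, of y x] M_eq[OF q] \<gamma>_def
    by (simp add: base.linear_simps base.G_P[OF q] field_simps)
qed

lemma differentiable_b: "q \<in> S \<Longrightarrow> b differentiable (at q)"
  unfolding b_def[abs_def]
  by (rule differentiable_divide) (use def.\<tau>_has_derivative_0 has_derivative_k k_pos
      in \<open>auto simp: differentiable_def less_imp_neq[symmetric]\<close>)

lemma \<gamma>_differentiable: "q \<in> S \<Longrightarrow> \<gamma> differentiable (at q)"
  unfolding \<gamma>_def[abs_def]
  by (intro differentiable_mult differentiable_diff differentiable_const differentiable_b)
    (use base.\<tau>_has_derivative_0 in \<open>auto simp: differentiable_def\<close>)

lemma twice_differentiable_\<alpha>: "twice_differentiable_on S (\<lambda>p. G p (v p) y)"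
  unfolding base.G_def inner_vec_def matrix_vector_mult_def inner_real_def vec_lambda_beta
  by (intro twice_differentiable_on_sum twice_differentiable_on_mult twice_differentiable_on_const
      smooth_on_twice_differentiable smooth_v base.smooth_g finite)

text \<open>The factor \<open>\<tau> - b h\<close> is the component of \<open>d(v \<lrcorner> \<phi>)\<close> at \<open>e\<^sub>2, e\<^sub>4, e\<^sub>6\<close>, up to the factor 3; the
  derivative of \<open>\<gamma>\<close> does not enter, since \<open>v \<lrcorner> \<phi>\<close> vanishes on this triple.\<close>

lemma \<gamma>_obstruction:
  assumes q: "q \<in> S"
  shows "\<gamma> q = 0 \<or> \<tau> q = b q * h q"
proof -
  obtain E r where frame: "base.adapted_frame q E" and v: "v q = r *\<^sub>R E 1"
    using base.exists_adapted_frame[OF q] .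
  note E = base.adapted_frameD[OF frame]
  have "\<exists>D. ((\<lambda>p. d\<alpha> p x y) has_derivative D) (at q)" for x y
    using twice_differentiable_onD[OF twice_differentiable_\<alpha> base.open_S q has_derivative_\<alpha>]
        unfolding differentiable_def .
  then obtain D2 where D2: "\<And>x y. ((\<lambda>p. d\<alpha> p x y) has_derivative D2 x y) (at q)" by metis
  have D2_sym: "D2 x y z = D2 z y x" for x y z
    by (rule second_derivative_symmetric[OF base.open_S q has_derivative_\<alpha> D2 D2])
  obtain \<gamma>' where \<gamma>': "(\<gamma> has_derivative \<gamma>') (at q)" using \<gamma>_differentiable[OF q] unfolding differentiable_def by blast
  have D: "D2 x y z - D2 y x z = \<gamma> q * (F q (M q z) x y + F q (v q) (B q z x) y + F q (v q) x (B q z y))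
      + \<gamma>' z * F q (v q) x y" for x y z
  proof -
    have "((\<lambda>p. F p (v p) x y) has_derivative (\<lambda>z. base.DF q z (v q) x y + F q (v' q z) x y)) (at q)"
      by (rule has_derivative_linear_slot[OF base.linear_F(1) base.has_derivative_F[OF q] has_derivative_v[OF q]])
    from has_derivative_mult[OF \<gamma>' this]
    have "((\<lambda>p. d\<alpha> p x y - d\<alpha> p y x) has_derivative (\<lambda>z. \<gamma> q * (base.DF q z (v q) x y + F q (v' q z) x y)
        + \<gamma>' z * F q (v q) x y)) (at q)"
      by (rule has_derivative_transform_within_open[OF _ base.open_S q]) (simp add: d\<alpha>_antisym)
    from has_derivative_unique[OF has_derivative_diff[OF D2 D2] this, THEN fun_cong, of z]
    show ?thesis unfolding base.DF_def M_def by (simp add: base.linear_simps algebra_simps)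
  qed
  have Fv: "F q (v q) (E i) (E j) = r * phi0 1 i j" for i j
    unfolding v by (simp add: base.linear_simps E)
  have \<alpha>: "G q (v q) (E i) = r * of_bool (i = 1)" for i
    unfolding v by (simp add: base.linear_simps E)
  have P: "P q (E i) (E j) = (\<Sum>m\<in>UNIV. phi0 i j m *\<^sub>R E m)" for i j
    using E(4)[of "P q (E i) (E j)"] unfolding base.G_P[OF q] E(1) ..
  have FM: "F q (M q (E i)) (E j) (E l) = (\<tau> q - b q * h q) * phi0 i j l + 4 * b q * G q (v q) (E i) * (r * phi0 1 j l)
      + (4 * b q - 2 * \<tau> q) / 3 * (r * (\<Sum>m\<in>UNIV. phi0 1 i m * phi0 m j l))" for i j l
    unfolding M_eq[OF q] unfolding v
    by (simp add: base.linear_simps E linear_scale[OF base.linear_P(1)] P linear_sum[OF base.linear_F(1)])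
  have FB: "F q (v q) (B q x y) z + F q (v q) z' (B q y' x') = F q (v q) (B q x y) z
      - F q (v q) (B q y' x') z'" for x y z x' y' z'
    using base.F_antisym(2)[OF q, of "v q" z' "B q y' x'"] by simp
  have FP: "F q (v q) (P q (E i) (E j)) (E l) = r * (\<Sum>m\<in>UNIV. phi0 i j m * phi0 1 m l)" for i j l
    unfolding v P by (simp add: base.linear_simps linear_sum[OF base.linear_F(2)] E sum_distrib_left mult.left_commute)
  \<comment> \<open>The component of \<open>d(d\<alpha>) = 0\<close> at the frame vectors 2, 4, 6:
    the six second derivatives cancel in pairs by \<open>D2_sym\<close>.\<close>
  have "(D2 (E 4) (E 6) (E 2) - D2 (E 6) (E 4) (E 2)) + (D2 (E 6) (E 2) (E 4) - D2 (E 2) (E 6) (E 4))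
      + (D2 (E 2) (E 4) (E 6) - D2 (E 4) (E 2) (E 6)) = 0"
    using D2_sym[of "E 4" "E 6" "E 2"] D2_sym[of "E 6" "E 4" "E 2"] D2_sym[of "E 6" "E 2" "E 4"] by simp
  then have "\<gamma> q * ((F q (M q (E 2)) (E 4) (E 6) + F q (M q (E 4)) (E 6) (E 2) + F q (M q (E 6)) (E 2) (E 4))
      + (F q (v q) (B q (E 2) (E 4) - B q (E 4) (E 2)) (E 6) + F q (v q) (B q (E 4) (E 6) - B q (E 6) (E 4)) (E 2)
        + F q (v q) (B q (E 6) (E 2) - B q (E 2) (E 6)) (E 4))) = 0"
    unfolding D Fv
    using base.F_antisym(2)[OF q, of "v q" "E 4" "B q (E 2) (E 6)"] base.F_antisym(2)[OF q, of "v q" "E 6"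
        "B q (E 4) (E 2)"]
      base.F_antisym(2)[OF q, of "v q" "E 2" "B q (E 6) (E 4)"]
    by (simp add: base.linear_simps phi0_table algebra_simps)
  then have "\<gamma> q * (3 * (\<tau> q - b q * h q)) = 0"
    unfolding FM base.B_commute[OF q, of "E 4" "E 2"] base.B_commute[OF q, of "E 6" "E 4"] base.B_commute[OF q, of
        "E 2" "E 6"]
    by (simp add: base.linear_simps FP phi0_contract phi0_table \<alpha> neq_7 mult.commute[of
        "b q"] del: eq_numeral_iff_iszero)
  then show ?thesis by simp
qed

lemma no_deformation:
  assumes q: "q \<in> S" and nz: "\<And>q. q \<in> S \<Longrightarrow> \<tau> q \<noteq> 0" "\<And>q. q \<in> S \<Longrightarrow> \<tau>' q \<noteq> 0" "\<And>q. q \<in> S \<Longrightarrow> v q \<noteq> 0"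
  shows False
proof -
  have h1: "h p > 1" if "p \<in> S" for p
    using base.g_pos[OF that nz(3)[OF that]] unfolding h_def base.G_def by simp
  have b0: "b p \<noteq> 0" if "p \<in> S" for p
    using nz(2)[OF that] k_pos[OF that] unfolding b_def by simp
  have critical: "\<tau> p - b p * h p + 4 * b p * (h p - 1) = 0" if p: "p \<in> S" and "\<And>x. dh p x = 0" for p
    using dh_eq[OF p, of "v p"] that(2) \<alpha>_self[OF p] h1[OF p] by simp
  show False
  proof (cases "\<exists>p\<in>S. \<gamma> p \<noteq> 0")
    case True
    then obtain p where p: "p \<in> S" "\<gamma> p \<noteq> 0" by blast
    have "isCont \<gamma> p" using \<gamma>_differentiable[OF p(1)] differentiable_imp_continuous_within by blast
    then have "\<forall>\<^sub>F x in at p. \<gamma> x \<noteq> 0" using p(2) unfolding isCont_def by (intro tendsto_imp_eventually_ne)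
    \<comment> \<open>Because \<open>b = \<tau>' / k\<close> and \<open>h = k ^ 3\<close>, the
      equation \<open>\<tau> = b h\<close> reads \<open>\<tau> = \<tau>' k\<^sup>2\<close>. Both
      torsion functions have zero derivative, hence so has \<open>k\<close> at
      \<open>p\<close>.\<close>
    then have ev: "\<forall>\<^sub>F x in at p. \<tau> x = \<tau>' x * (k x * k x)"
      using eventually_at_in_open'[OF base.open_S p(1)]
    proof eventually_elim
      case (elim x)
      then have "\<tau> x = b x * h x" using \<gamma>_obstruction by blast
      then show ?case unfolding b_def k_cube[OF elim(2), symmetric] using k_pos[OF elim(2)] by simp
    qed
    have at_p: "\<tau> p = \<tau>' p * (k p * k p)"
      using \<gamma>_obstruction[OF p(1)] p(2) k_pos[OF p(1)] unfolding b_def k_cube[OF p(1), symmetric] by simp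
    have 1: "((\<lambda>x. \<tau>' x * (k x * k x)) has_derivative (\<lambda>_. 0)) (at p)"
      by (rule has_derivative_transform_eventually[OF base.\<tau>_has_derivative_0[OF p(1)] ev at_p UNIV_I])
    have 2: "((\<lambda>x. \<tau>' x * (k x * k x)) has_derivative
       (\<lambda>x. \<tau>' p * (k p * (dh p x / (3 * (k p * k p))) + dh p x / (3 * (k p * k p)) * k p) + 0 * (k p * k p))) (at p)"
      by (intro has_derivative_mult has_derivative_k def.\<tau>_has_derivative_0 p(1))
    have "dh p x = 0" for x
      using fun_cong[OF has_derivative_unique[OF 1 2], of x] nz(2)[OF p(1)] k_pos[OF p(1)] by simp
    then have "\<tau> p - b p * h p + 4 * b p * (h p - 1) = 0" by (rule critical[OF p(1)])
    moreover have "\<tau> p = b p * h p" using \<gamma>_obstruction[OF p(1)] p(2) by blast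
    ultimately show False using b0[OF p(1)] h1[OF p(1)] by simp
  next
    case False
    \<comment> \<open>Now \<gamma> vanishes on all of \<open>S\<close>, so
      \<open>\<tau> k = 4 \<tau>'\<close> there, and again \<open>k\<close> has zero
      derivative.\<close>
    then have \<gamma>0: "\<tau> x = 4 * b x" if "x \<in> S" for x using that unfolding \<gamma>_def by simp
    have 2: "((\<lambda>x. \<tau> x * k x) has_derivative (\<lambda>x. \<tau> q * (dh q x / (3 * (k q * k q))) + 0 * k q)) (at q)"
      by (intro has_derivative_mult has_derivative_k base.\<tau>_has_derivative_0 q)
    have "((\<lambda>x. 4 * \<tau>' x) has_derivative (\<lambda>x. 4 * 0)) (at q)"
      by (intro has_derivative_mult_right def.\<tau>_has_derivative_0 q)
    then have 1: "((\<lambda>x. \<tau> x * k x) has_derivative (\<lambda>x. 4 * 0)) (at q)"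
    proof (rule has_derivative_transform_within_open[OF _ base.open_S q])
      show "4 * \<tau>' x = \<tau> x * k x" if "x \<in> S" for x
        using \<gamma>0[OF that] k_pos[OF that] unfolding b_def by simp
    qed
    have "dh q x = 0" for x
      using fun_cong[OF has_derivative_unique[OF 1 2], of x] nz(1)[OF q] k_pos[OF q] by simp
    then have "\<tau> q - b q * h q + 4 * b q * (h q - 1) = 0" by (rule critical[OF q])
    then have "3 * b q * h q = 0" using \<gamma>0[OF q] by (simp add: algebra_simps)
    then show False using b0[OF q] h1[OF q] by simp
  qed
qed
end

section \<open>From charts to the manifold\<close>

lemma C_k_on_subset: "C_k_on k S f \<Longrightarrow> T \<subseteq> S \<Longrightarrow> C_k_on k T f"
  by (induction k arbitrary: f) (auto intro: continuous_on_subset)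

lemma smooth_on_subset: "smooth_on S f \<Longrightarrow> T \<subseteq> S \<Longrightarrow> smooth_on T f"
  unfolding smooth_on_def using C_k_on_subset by blast

lemma nearly_parallel_G2_subset:
  assumes "nearly_parallel_G2 S \<phi> g vol \<tau>" "open T" "T \<subseteq> S"
  shows "nearly_parallel_G2 T \<phi> g vol \<tau>"
proof -
  interpret nearly_parallel_G2 S \<phi> g vol \<tau> by fact
  show ?thesis
    by unfold_locales
      (use assms(2,3) smooth_on_subset[OF smooth_phi assms(3)] smooth_on_subset[OF smooth_g assms(3)]
        g_transpose g_pos positive vol_square g_vol torsion in auto)
qed

definition W1_torsion :: "'m chart set \<Rightarrow> 'm field3 \<Rightarrow> 'm field2 \<Rightarrow> 'm density \<Rightarrow> ('m \<Rightarrow> real) \<Rightarrow> bool" where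
  "W1_torsion A \<phi> g vol \<tau>1 \<longleftrightarrow> (\<forall>c\<in>A. \<forall>p\<in>fst c. \<exists>T.
     full_torsion (\<phi> c) (g c) (vol c) (snd c p) T \<and>
     torsion_components (g c (snd c p)) (\<phi> c (snd c p)) T (\<tau>1 p) 0 (\<lambda>_ _. 0) (\<lambda>_ _. 0))"

lemma chart_inv_into:
  assumes "smooth_manifold7 X A" "c \<in> A" "p \<in> fst c"
  shows "inv_into (fst c) (snd c) (snd c p) = p"
proof -
  have c: "is_chart X c" using assms unfolding smooth_manifold7_def by blast
  then have "fst c \<subseteq> topspace X" unfolding is_chart_def using openin_subset by blast
  moreover have "inj_on (snd c) (topspace (subtopology X (fst c)))"
    using c unfolding is_chart_def by (blast intro: homeomorphic_imp_injective_map)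
  ultimately have "inj_on (snd c) (fst c)" by (simp add: inf.absorb2)
  then show ?thesis using assms(3) by (rule inv_into_f_f)
qed

text \<open>With the other components zero the torsion is a multiple of the metric. Raising an index
  turns it into a multiple of the identity, and the torsion equation becomes
  \<open>\<nabla>\<phi> = \<tau>\<psi>\<close>.\<close>

lemma chart_nearly_parallel:
  assumes X: "smooth_manifold7 X A" and G: "G2_structure A \<phi> g vol" and W: "W1_torsion A \<phi> g vol \<tau>1" and c: "c \<in> A"
  shows "nearly_parallel_G2 (chart_image c) (\<phi> c) (g c) (vol c) (\<lambda>q. \<tau>1 (inv_into (fst c) (snd c) q))"
proof
  show "open (chart_image c)" using X c unfolding smooth_manifold7_def is_chart_def by blast
  show "smooth_on (chart_image c) (\<lambda>q. \<phi> c q i j k)" for i j k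
    using G c unfolding G2_structure_def three_form_def by blast
  show "smooth_on (chart_image c) (\<lambda>q. g c q $ i $ j)" for i j
    using G c unfolding G2_structure_def riemannian_metric_def by blast
  fix q assume q: "q \<in> chart_image c"
  show "transpose (g c q) = g c q"
    using G c q unfolding G2_structure_def riemannian_metric_def by blast
  show pos: "u \<bullet> (g c q *v u) > 0" if "u \<noteq> 0" for u
    using G c q that unfolding G2_structure_def riemannian_metric_def by blast
  show "positive3 (\<phi> c q)" using G c q unfolding G2_structure_def by blast
  show "(vol c q)\<^sup>2 = det (g c q)" using G c q unfolding G2_structure_def volume_form_def by blast
  show "(u \<bullet> (g c q *v w)) * vol c q = wedge223 (interior3 u (\<phi> c q)) (interior3 w (\<phi> c q)) (\<phi> c q) / 6" for u w
    using G c q unfolding G2_structure_def by blast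
  obtain p where p: "p \<in> fst c" "q = snd c p" using q by blast
  obtain T where T: "full_torsion (\<phi> c) (g c) (vol c) q T"
    "torsion_components (g c q) (\<phi> c q) T (\<tau>1 p) 0 (\<lambda>_ _. 0) (\<lambda>_ _. 0)"
    using W c p unfolding W1_torsion_def by blast
  have "invertible (g c q)" by (rule invertible_if_positive) (rule pos)
  note inv = invertible_matrix_inv(1)[OF this]
  have Tab: "T a b = \<tau>1 p * g c q $ a $ b" for a b
    using T(2) unfolding torsion_components_def by (simp add: matrix_vector_mult_0_right)
  have "(\<Sum>m\<in>UNIV. T a m * matrix_inv (g c q) $ m $ e) = \<tau>1 p * of_bool (e = a)" for a e
  proof -
    have "(g c q ** matrix_inv (g c q)) $ a $ e = of_bool (e = a)" unfolding inv mat_def by simp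
    then show ?thesis unfolding Tab matrix_matrix_mult_def by (simp add: sum_distrib_left[symmetric] mult.assoc)
  qed
  then have "nabla3 (g c) (\<phi> c) q a b d e = (\<Sum>m\<in>UNIV. of_bool (m
      = a) * (\<tau>1 p * hodge3 (g c q) (vol c q) (\<phi> c q) m b d e))" for a b d e
    using T(1) unfolding full_torsion_def by (simp add: mult_ac)
  then show "nabla3 (g c) (\<phi> c) q a b d e = \<tau>1 (inv_into (fst c) (snd c) q) * hodge3 (g c q) (vol c q) (\<phi> c q) a b
      d e" for a b d e
    unfolding sum_of_bool p(2) chart_inv_into[OF X c p(1)] .
qed

lemma W1_torsion_locally_constant:
  assumes X: "smooth_manifold7 X A" and G: "G2_structure A \<phi> g vol" and W: "W1_torsion A \<phi> g vol \<tau>1" and p: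
      "p \<in> topspace X"
  shows "\<exists>U. openin X U \<and> p \<in> U \<and> (\<forall>p'\<in>U. \<tau>1 p' = \<tau>1 p)"
proof -
  obtain c where c: "c \<in> A" "p \<in> fst c" using X p unfolding smooth_manifold7_def by blast
  interpret nearly_parallel_G2 "chart_image c" "\<phi> c" "g c" "vol c" "\<lambda>q. \<tau>1 (inv_into (fst c) (snd c) q)"
    by (rule chart_nearly_parallel[OF X G W c(1)])
  obtain e where e: "e > 0" "ball (snd c p) e \<subseteq> chart_image c"
    using open_S c(2) openE by blast
  obtain a where a: "\<And>q. q \<in> ball (snd c p) e \<Longrightarrow> \<tau>1 (inv_into (fst c) (snd c) q) = a"
    using has_derivative_zero_constant[OF convex_ball, of "snd c p" e "\<lambda>q. \<tau>1 (inv_into (fst c) (snd c) q)"]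
      has_derivative_at_withinI[OF \<tau>_has_derivative_0] e(2) by blast
  have ch: "openin X (fst c)" "homeomorphic_map (subtopology X (fst c)) (top_of_set (chart_image c)) (snd c)"
    using X c unfolding smooth_manifold7_def is_chart_def by blast+
  have "continuous_map (subtopology X (fst c)) (top_of_set (chart_image c)) (snd c)"
    using ch(2) by (rule homeomorphic_imp_continuous_map)
  moreover have "openin (top_of_set (chart_image c)) (ball (snd c p) e)"
    using e(2) by (simp add: openin_open_eq[OF open_S])
  ultimately have "openin (subtopology X (fst c)) {x \<in> topspace (subtopology X (fst c)). snd c x \<in> ball (snd c p) e}"
    by (rule openin_continuous_map_preimage)
  then have "openin X {x \<in> topspace (subtopology X (fst c)). snd c x \<in> ball (snd c p) e}"
    using ch(1) openin_open_subtopology by blast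
  moreover have "topspace (subtopology X (fst c)) = fst c"
    using openin_subset[OF ch(1)] by auto
  ultimately have "openin X {x \<in> fst c. snd c x \<in> ball (snd c p) e}" by (simp only:)
  moreover have "\<tau>1 x = a" if "x \<in> fst c" "snd c x \<in> ball (snd c p) e" for x
    using a[OF that(2)] chart_inv_into[OF X c(1) that(1)] by simp
  ultimately show ?thesis using c(2) e(1) by (intro exI[of _ "{x \<in> fst c. snd c x \<in> ball (snd c p) e}"]) auto
qed

text \<open>Local constancy makes the zero set and its complement both open, so a connected
  component cannot meet both. Being nonzero somewhere on each component thus becomes being nonzero
  everywhere.\<close>

lemma W1_torsion_nonzero:
  assumes X: "smooth_manifold7 X A" and G: "G2_structure A \<phi> g vol" and W: "W1_torsion A \<phi> g vol \<tau>1"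
    and nz: "\<forall>K\<in>connected_components_of X. \<exists>p\<in>K. \<tau>1 p \<noteq> 0" and p: "p \<in> topspace X"
  shows "\<tau>1 p \<noteq> 0"
proof
  assume 0: "\<tau>1 p = 0"
  define K where "K = connected_component_of_set X p"
  have K: "K \<in> connected_components_of X" "p \<in> K"
    using p unfolding K_def connected_components_of_def by (auto simp: connected_component_of_refl)
  have open_level: "openin X {x \<in> topspace X. Q (\<tau>1 x)}" for Q
  proof (subst openin_subopen, rule ballI)
    fix x assume x: "x \<in> {x \<in> topspace X. Q (\<tau>1 x)}"
    then obtain U where "openin X U" "x \<in> U" "\<forall>p'\<in>U. \<tau>1 p' = \<tau>1 x"
      using W1_torsion_locally_constant[OF X G W] by blast
    then show "\<exists>T. openin X T \<and> x \<in> T \<and> T \<subseteq> {x \<in> topspace X. Q (\<tau>1 x)}"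
      using x openin_subset by (intro exI[of _ U]) fastforce
  qed
  obtain p' where p': "p' \<in> K" "\<tau>1 p' \<noteq> 0" using nz K(1) by blast
  have "connectedin X K" unfolding K_def by (rule connectedin_connected_component_of)
  then have sub: "K \<subseteq> topspace X" and "\<not> (\<exists>E1 E2. openin X E1 \<and> openin X E2 \<and> K \<subseteq> E1 \<union> E2 \<and> E1 \<inter> E2 \<inter> K = {}
      \<and> E1 \<inter> K \<noteq> {} \<and> E2 \<inter> K \<noteq> {})"
    unfolding connectedin by blast+
  moreover have "{x \<in> topspace X. \<tau>1 x = 0} \<inter> {x \<in> topspace X. \<tau>1 x \<noteq> 0} \<inter> K = {}" by blast
  moreover have "K \<subseteq> {x \<in> topspace X. \<tau>1 x = 0} \<union> {x \<in> topspace X. \<tau>1 x \<noteq> 0}" using sub by blast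
  moreover have "{x \<in> topspace X. \<tau>1 x = 0} \<inter> K \<noteq> {}" "{x \<in> topspace X. \<tau>1 x \<noteq> 0} \<inter> K \<noteq> {}"
    using K(2) p' 0 sub by blast+
  ultimately show False using open_level[of "\<lambda>a. a = 0"] open_level[of "\<lambda>a. a \<noteq> 0"] by blast
qed

theorem theorem25:
  fixes X :: "'m topology" and A :: "'m chart set"
    and \<phi> :: "'m field3" and g :: "'m field2" and vol :: "'m density"
  assumes "smooth_manifold7 X A"
    and "G2_structure A \<phi> g vol"
    and "strict_W1 X A \<phi> g vol"
  shows "\<not> (\<exists>v g' vol'.
           vector_field A v \<and> (\<exists>c\<in>A. \<exists>p\<in>fst c. v c (snd c p) \<noteq> 0) \<and>
           G2_structure A (deform \<phi> g vol v) g' vol' \<and>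
           strict_W1 X A (deform \<phi> g vol v) g' vol')"
proof
  assume "\<exists>v g' vol'.
           vector_field A v \<and> (\<exists>c\<in>A. \<exists>p\<in>fst c. v c (snd c p) \<noteq> 0) \<and>
           G2_structure A (deform \<phi> g vol v) g' vol' \<and>
           strict_W1 X A (deform \<phi> g vol v) g' vol'"
  then obtain v g' vol' c p where v: "vector_field A v" and cp: "c \<in> A" "p \<in> fst c" "v c (snd c p) \<noteq> 0"
    and G': "G2_structure A (deform \<phi> g vol v) g' vol'" and W': "strict_W1 X A (deform \<phi> g vol v) g' vol'"
    by blast
  obtain \<tau>1 where \<tau>1: "W1_torsion A \<phi> g vol \<tau>1" "\<forall>K\<in>connected_components_of X. \<exists>p\<in>K. \<tau>1 p \<noteq> 0"
    using assms(3) unfolding strict_W1_def W1_torsion_def by blast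
  obtain \<tau>2 where \<tau>2: "W1_torsion A (deform \<phi> g vol v) g' vol' \<tau>2" "\<forall>K\<in>connected_components_of X. \<exists>p\<in>K. \<tau>2 p \<noteq> 0"
    using W' unfolding strict_W1_def W1_torsion_def by blast
  define x where "x = inv_into (fst c) (snd c)"
  \<comment> \<open>The local obstruction needs \<open>v\<close> to vanish nowhere, so the chart
    domain is cut down to the open set where \<open>v\<close> is nonzero. It is inhabited because
    the deformation is not the trivial one.\<close>
  define S where "S = chart_image c \<inter> v c -` (- {0})"
  have smooth_v: "smooth_on (chart_image c) (\<lambda>q. v c q $ i)" for i
    using v cp(1) unfolding vector_field_def by blast
  have chart: "is_chart X c" using assms(1) cp(1) unfolding smooth_manifold7_def by blast
  have "v c differentiable (at q)" if "q \<in> chart_image c" for q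
    using differentiable_vec smooth_on_differentiable[OF smooth_v that] by blast
  then have "continuous_on (chart_image c) (v c)"
    by (intro continuous_at_imp_continuous_on ballI differentiable_imp_continuous_within)
  then have "open S" unfolding S_def
    using chart unfolding is_chart_def by (intro continuous_open_preimage) auto
  have "S \<subseteq> chart_image c" unfolding S_def by blast
  interpret pair: deformed_pair S "\<phi> c" "g c" "vol c" "\<lambda>q. \<tau>1 (x q)" "deform \<phi> g vol v c" "g' c" "vol' c"
      "\<lambda>q. \<tau>2 (x q)" "v c"
    unfolding x_def
  proof (intro deformed_pair.intro deformed_pair_axioms.intro)
    show "nearly_parallel_G2 S (\<phi> c) (g c) (vol c) (\<lambda>q. \<tau>1 (inv_into (fst c) (snd c) q))"
      by (rule nearly_parallel_G2_subset[OF chart_nearly_parallel]) fact+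
    show "nearly_parallel_G2 S (deform \<phi> g vol v c) (g' c) (vol' c) (\<lambda>q. \<tau>2 (inv_into (fst c) (snd c) q))"
      by (rule nearly_parallel_G2_subset[OF chart_nearly_parallel]) fact+
    show "smooth_on S (\<lambda>q. v c q $ i)" for i
      using smooth_on_subset[OF smooth_v \<open>S \<subseteq> chart_image c\<close>] .
  qed (simp add: deform_def)
  have "x q \<in> topspace X" if "q \<in> S" for q
  proof -
    have "q \<in> snd c ` fst c" using that unfolding S_def by blast
    then have "x q \<in> fst c" unfolding x_def by (rule inv_into_into)
    then show ?thesis using chart openin_subset unfolding is_chart_def by blast
  qed
  moreover have "snd c p \<in> S" unfolding S_def using cp by blast
  ultimately show False
    using pair.no_deformation[of "snd c p"] W1_torsion_nonzero[OF assms(1,2) \<tau>1] W1_torsion_nonzero[OF assms(1) G' \<tau>2]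
    unfolding S_def by blast
qed

end
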